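(* Let $\Bbbk$ be a field. Given left-right Yetter-Drinfel'd modules $(M_1,\lambda_1,\delta_1)$ and $(M_2,\lambda_2,\delta_2)$ over a finite-dimensional $\Bbbk$-linear bialgebra $H$, the morphisms $$\mathring\lambda_{M_1\otimes M_2}:=(\lambda_1\otimes\lambda_2)\circ(\mathrm{Id}_H\otimes c_{H,M_1}\otimes\mathrm{Id}_{M_2})\circ(\Delta^{op}\otimes\mathrm{Id}_{M_1\otimes M_2}),$$ $$\mathring\delta_{M_1\otimes M_2}:=(\mathrm{Id}_{M_1\otimes M_2}\otimes\mu)\circ(\mathrm{Id}_{M_1}\otimes c_{H,M_2}\otimes\mathrm{Id}_H)\circ(\delta_1\otimes\delta_2)$$ endow $M_1\otimes M_2$ with a Yetter-Drinfel'd module structure over $H$.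
   Context: Here $\mu,\Delta$ are the multiplication and comultiplication of $H$, $c$ is the flip $c(v\otimes w)=w\otimes v$ of vector spaces, and $\Delta^{op}=c_{H,H}\circ\Delta$. A left-right Yetter-Drinfel'd module over $H$ is a vector space $M$ with a left $H$-module structure $\lambda:H\otimes M\to M$ and a right $H$-comodule structure $\delta:M\to M\otimes H$ such that $$(\mathrm{Id}_M\otimes\mu)(\delta\otimes\mathrm{Id}_H)c_{H,M}(\mathrm{Id}_H\otimes\lambda)(\Delta\otimes\mathrm{Id}_M)=(\lambda\otimes\mu)(\mathrm{Id}_H\otimes c_{H,M}\otimes\mathrm{Id}_H)(\Delta\otimes\delta).$$ *)

theory Defs
  imports "HOL-Algebra.Module" "HOL-Algebra.AbelCoset"
begin

text \<open>
  A vector space over a field \<open>R\<close> is a \<^locale>\<open>module\<close> over \<open>R\<close>. The record type of modules extends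
  that of rings; its fields \<^const>\<open>mult\<close> and \<^const>\<open>one\<close> play no role for modules and are never
  used below. In particular the multiplication of a bialgebra is a linear map
  on a tensor product and not this record field.
\<close>

definition finite_dimensional :: "('a, 'r) ring_scheme \<Rightarrow> ('a, 'm, 'x) module_scheme \<Rightarrow> bool" where
  "finite_dimensional R M \<longleftrightarrow>
     (\<exists>B. finite B \<and> B \<subseteq> carrier M \<and>
        (\<forall>x\<in>carrier M. \<exists>c\<in>B \<rightarrow> carrier R. x = (\<Oplus>\<^bsub>M\<^esub>b\<in>B. c b \<odot>\<^bsub>M\<^esub> b)))"

definition linear_maps ::
  "('a, 'r) ring_scheme \<Rightarrow> ('a, 'm, 'x) module_scheme \<Rightarrow> ('a, 'n, 'y) module_scheme \<Rightarrow> ('m \<Rightarrow> 'n) set"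
where
  "linear_maps R M N =
     {f \<in> carrier M \<rightarrow> carrier N.
        (\<forall>x\<in>carrier M. \<forall>y\<in>carrier M. f (x \<oplus>\<^bsub>M\<^esub> y) = f x \<oplus>\<^bsub>N\<^esub> f y) \<and>
        (\<forall>a\<in>carrier R. \<forall>x\<in>carrier M. f (a \<odot>\<^bsub>M\<^esub> x) = a \<odot>\<^bsub>N\<^esub> f x)}"

definition scalar_module :: "('a, 'r) ring_scheme \<Rightarrow> ('a, 'a) module" where
  "scalar_module R =
     \<lparr>carrier = carrier R, mult = mult R, one = one R, zero = zero R, add = add R, smult = mult R\<rparr>"


section \<open>Tensor products\<close>

definition free_module :: "('a, 'r) ring_scheme \<Rightarrow> 'i set \<Rightarrow> ('a, 'i \<Rightarrow> 'a) module" where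
  "free_module R X =
     \<lparr>carrier = {f. f \<in> X \<rightarrow> carrier R \<and> (\<forall>i. i \<notin> X \<longrightarrow> f i = \<zero>\<^bsub>R\<^esub>) \<and> finite {i. f i \<noteq> \<zero>\<^bsub>R\<^esub>}},
      mult = undefined, one = undefined,
      zero = (\<lambda>i. \<zero>\<^bsub>R\<^esub>),
      add = (\<lambda>f g i. f i \<oplus>\<^bsub>R\<^esub> g i),
      smult = (\<lambda>a f i. a \<otimes>\<^bsub>R\<^esub> f i)\<rparr>"

definition free_gen :: "('a, 'r) ring_scheme \<Rightarrow> 'i \<Rightarrow> 'i \<Rightarrow> 'a" where
  "free_gen R i = (\<lambda>j. if j = i then \<one>\<^bsub>R\<^esub> else \<zero>\<^bsub>R\<^esub>)"

definition generated_submodule ::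
  "('a, 'r) ring_scheme \<Rightarrow> ('a, 'm, 'x) module_scheme \<Rightarrow> 'm set \<Rightarrow> 'm set" where
  "generated_submodule R M S = \<Inter> {K. submodule K R M \<and> S \<subseteq> K}"

definition quotient_module ::
  "('a, 'r) ring_scheme \<Rightarrow> ('a, 'm, 'x) module_scheme \<Rightarrow> 'm set \<Rightarrow> ('a, 'm set) module" where
  "quotient_module R M K =
     \<lparr>carrier = a_rcosets\<^bsub>M\<^esub> K,
      mult = undefined, one = undefined,
      zero = K,
      add = (\<lambda>X Y. X <+>\<^bsub>M\<^esub> Y),
      smult = (\<lambda>a X. \<Union>x\<in>X. K +>\<^bsub>M\<^esub> (a \<odot>\<^bsub>M\<^esub> x))\<rparr>"

definition tensor_relations ::
  "('a, 'r) ring_scheme \<Rightarrow> ('a, 'm, 'x) module_scheme \<Rightarrow> ('a, 'n, 'y) module_scheme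
     \<Rightarrow> ('m \<times> 'n \<Rightarrow> 'a) set"
where
  "tensor_relations R M N =
     (let F = free_module R (carrier M \<times> carrier N); e = (\<lambda>x y. free_gen R (x, y)) in
       {e (x \<oplus>\<^bsub>M\<^esub> x') y \<ominus>\<^bsub>F\<^esub> (e x y \<oplus>\<^bsub>F\<^esub> e x' y) | x x' y.
          x \<in> carrier M \<and> x' \<in> carrier M \<and> y \<in> carrier N} \<union>
       {e x (y \<oplus>\<^bsub>N\<^esub> y') \<ominus>\<^bsub>F\<^esub> (e x y \<oplus>\<^bsub>F\<^esub> e x y') | x y y'.
          x \<in> carrier M \<and> y \<in> carrier N \<and> y' \<in> carrier N} \<union>
       {e (a \<odot>\<^bsub>M\<^esub> x) y \<ominus>\<^bsub>F\<^esub> (a \<odot>\<^bsub>F\<^esub> e x y) | a x y.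
          a \<in> carrier R \<and> x \<in> carrier M \<and> y \<in> carrier N} \<union>
       {e x (a \<odot>\<^bsub>N\<^esub> y) \<ominus>\<^bsub>F\<^esub> (a \<odot>\<^bsub>F\<^esub> e x y) | a x y.
          a \<in> carrier R \<and> x \<in> carrier M \<and> y \<in> carrier N})"

definition tensor_kernel ::
  "('a, 'r) ring_scheme \<Rightarrow> ('a, 'm, 'x) module_scheme \<Rightarrow> ('a, 'n, 'y) module_scheme
     \<Rightarrow> ('m \<times> 'n \<Rightarrow> 'a) set"
where
  "tensor_kernel R M N =
     generated_submodule R (free_module R (carrier M \<times> carrier N)) (tensor_relations R M N)"

definition tensor ::
  "('a, 'm, 'x) module_scheme \<Rightarrow> ('a, 'r) ring_scheme \<Rightarrow> ('a, 'n, 'y) module_scheme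
     \<Rightarrow> ('a, ('m \<times> 'n \<Rightarrow> 'a) set) module"
  (\<open>(_ \<boxtimes>[_] _)\<close> [70, 0, 71] 70)
where
  "M \<boxtimes>[R] N =
     quotient_module R (free_module R (carrier M \<times> carrier N)) (tensor_kernel R M N)"

definition pure_tensor ::
  "('a, 'r) ring_scheme \<Rightarrow> ('a, 'm, 'x) module_scheme \<Rightarrow> ('a, 'n, 'y) module_scheme
     \<Rightarrow> 'm \<Rightarrow> 'n \<Rightarrow> ('m \<times> 'n \<Rightarrow> 'a) set"
where
  "pure_tensor R M N x y =
     tensor_kernel R M N +>\<^bsub>free_module R (carrier M \<times> carrier N)\<^esub> free_gen R (x, y)"

text \<open>
  The linear map into \<open>P\<close> induced by a bilinear map \<open>\<beta>\<close>: the value on a coset is computed from any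
  formal linear combination \<open>r\<close> of pairs representing it; for bilinear \<open>\<beta>\<close> it does not depend on \<open>r\<close>,
  so that the image below is a singleton.
\<close>

definition tensor_lift ::
  "('a, 'r) ring_scheme \<Rightarrow> ('a, 'p, 'z) module_scheme \<Rightarrow> ('m \<Rightarrow> 'n \<Rightarrow> 'p)
     \<Rightarrow> ('m \<times> 'n \<Rightarrow> 'a) set \<Rightarrow> 'p"
where
  "tensor_lift R P \<beta> t =
     the_elem ((\<lambda>r. \<Oplus>\<^bsub>P\<^esub>p\<in>{p. r p \<noteq> \<zero>\<^bsub>R\<^esub>}. r p \<odot>\<^bsub>P\<^esub> \<beta> (fst p) (snd p)) ` t)"

text \<open>
  The module arguments of \<open>tensor_map\<close> are the \<^emph>\<open>codomains\<close> of \<open>f\<close> and \<open>g\<close>.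
\<close>

definition tensor_map ::
  "('a, 'r) ring_scheme \<Rightarrow> ('a, 'p, 'x) module_scheme \<Rightarrow> ('a, 'q, 'y) module_scheme
     \<Rightarrow> ('m \<Rightarrow> 'p) \<Rightarrow> ('n \<Rightarrow> 'q) \<Rightarrow> ('m \<times> 'n \<Rightarrow> 'a) set \<Rightarrow> ('p \<times> 'q \<Rightarrow> 'a) set"
where
  "tensor_map R P Q f g =
     tensor_lift R (P \<boxtimes>[R] Q) (\<lambda>x y. pure_tensor R P Q (f x) (g y))"

definition tensor_flip ::
  "('a, 'r) ring_scheme \<Rightarrow> ('a, 'm, 'x) module_scheme \<Rightarrow> ('a, 'n, 'y) module_scheme
     \<Rightarrow> ('m \<times> 'n \<Rightarrow> 'a) set \<Rightarrow> ('n \<times> 'm \<Rightarrow> 'a) set"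
where
  "tensor_flip R M N = tensor_lift R (N \<boxtimes>[R] M) (\<lambda>x y. pure_tensor R N M y x)"

text \<open>
  The canonical isomorphisms usually left implicit: \<open>(A \<otimes> B) \<otimes> C \<rightarrow> A \<otimes> (B \<otimes> C)\<close> and its inverse,
  \<open>k \<otimes> M \<rightarrow> M\<close> and \<open>M \<otimes> k \<rightarrow> M\<close>.
\<close>

definition tensor_assoc ::
  "('a, 'r) ring_scheme \<Rightarrow> ('a, 'm, 'x) module_scheme \<Rightarrow> ('a, 'n, 'y) module_scheme
     \<Rightarrow> ('a, 'p, 'z) module_scheme
     \<Rightarrow> (('m \<times> 'n \<Rightarrow> 'a) set \<times> 'p \<Rightarrow> 'a) set \<Rightarrow> ('m \<times> ('n \<times> 'p \<Rightarrow> 'a) set \<Rightarrow> 'a) set"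
where
  "tensor_assoc R A B C =
     tensor_lift R (A \<boxtimes>[R] (B \<boxtimes>[R] C))
       (\<lambda>t z. tensor_lift R (A \<boxtimes>[R] (B \<boxtimes>[R] C))
          (\<lambda>x y. pure_tensor R A (B \<boxtimes>[R] C) x (pure_tensor R B C y z)) t)"

definition tensor_assoc_inv ::
  "('a, 'r) ring_scheme \<Rightarrow> ('a, 'm, 'x) module_scheme \<Rightarrow> ('a, 'n, 'y) module_scheme
     \<Rightarrow> ('a, 'p, 'z) module_scheme
     \<Rightarrow> ('m \<times> ('n \<times> 'p \<Rightarrow> 'a) set \<Rightarrow> 'a) set \<Rightarrow> (('m \<times> 'n \<Rightarrow> 'a) set \<times> 'p \<Rightarrow> 'a) set"
where
  "tensor_assoc_inv R A B C =
     tensor_lift R ((A \<boxtimes>[R] B) \<boxtimes>[R] C)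
       (\<lambda>x t. tensor_lift R ((A \<boxtimes>[R] B) \<boxtimes>[R] C)
          (\<lambda>y z. pure_tensor R (A \<boxtimes>[R] B) C (pure_tensor R A B x y) z) t)"

definition tensor_lunit ::
  "('a, 'r) ring_scheme \<Rightarrow> ('a, 'm, 'x) module_scheme \<Rightarrow> ('a \<times> 'm \<Rightarrow> 'a) set \<Rightarrow> 'm" where
  "tensor_lunit R M = tensor_lift R M (\<lambda>a x. a \<odot>\<^bsub>M\<^esub> x)"

definition tensor_runit ::
  "('a, 'r) ring_scheme \<Rightarrow> ('a, 'm, 'x) module_scheme \<Rightarrow> ('m \<times> 'a \<Rightarrow> 'a) set \<Rightarrow> 'm" where
  "tensor_runit R M = tensor_lift R M (\<lambda>x a. a \<odot>\<^bsub>M\<^esub> x)"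

text \<open>
  \<open>Id\<^sub>A \<otimes> c\<^bsub>B,C\<^esub> \<otimes> Id\<^sub>D\<close>, bracketed as a map \<open>(A \<otimes> B) \<otimes> (C \<otimes> D) \<rightarrow> (A \<otimes> C) \<otimes> (B \<otimes> D)\<close>.
\<close>

definition middle_flip ::
  "('a, 'r) ring_scheme \<Rightarrow> ('a, 'm, 'x) module_scheme \<Rightarrow> ('a, 'n, 'y) module_scheme
     \<Rightarrow> ('a, 'p, 'z) module_scheme \<Rightarrow> ('a, 'q, 'w) module_scheme
     \<Rightarrow> (('m \<times> 'n \<Rightarrow> 'a) set \<times> ('p \<times> 'q \<Rightarrow> 'a) set \<Rightarrow> 'a) set
     \<Rightarrow> (('m \<times> 'p \<Rightarrow> 'a) set \<times> ('n \<times> 'q \<Rightarrow> 'a) set \<Rightarrow> 'a) set"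
where
  "middle_flip R A B C D =
     tensor_assoc_inv R A C (B \<boxtimes>[R] D)
     \<circ> tensor_map R A (C \<boxtimes>[R] (B \<boxtimes>[R] D)) id
         (tensor_assoc R C B D
          \<circ> tensor_map R (C \<boxtimes>[R] B) D (tensor_flip R B C) id
          \<circ> tensor_assoc_inv R B C D)
     \<circ> tensor_assoc R A B (C \<boxtimes>[R] D)"


section \<open>Bialgebras\<close>

text \<open>
  Functions on carriers are only meaningful there, so equality of linear maps is equality on the
  carrier of the domain.
\<close>

locale unital_algebra = module R A for R (structure) and A (structure) +
  fixes \<mu> and \<eta>
  assumes mult_linear: "\<mu> \<in> linear_maps R (A \<boxtimes>[R] A) A"
    and unit_linear: "\<eta> \<in> linear_maps R (scalar_module R) A"
    and mult_assoc: "\<forall>t\<in>carrier ((A \<boxtimes>[R] A) \<boxtimes>[R] A).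
      (\<mu> \<circ> tensor_map R A A \<mu> id) t =
      (\<mu> \<circ> tensor_map R A A id \<mu> \<circ> tensor_assoc R A A A) t"
    and mult_unit_left: "\<forall>t\<in>carrier (scalar_module R \<boxtimes>[R] A).
      (\<mu> \<circ> tensor_map R A A \<eta> id) t = tensor_lunit R A t"
    and mult_unit_right: "\<forall>t\<in>carrier (A \<boxtimes>[R] scalar_module R).
      (\<mu> \<circ> tensor_map R A A id \<eta>) t = tensor_runit R A t"

locale counital_coalgebra = module R C for R (structure) and C (structure) +
  fixes \<Delta> and \<epsilon>
  assumes comult_linear: "\<Delta> \<in> linear_maps R C (C \<boxtimes>[R] C)"
    and counit_linear: "\<epsilon> \<in> linear_maps R C (scalar_module R)"
    and comult_coassoc: "\<forall>x\<in>carrier C.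
      (tensor_assoc R C C C \<circ> tensor_map R (C \<boxtimes>[R] C) C \<Delta> id \<circ> \<Delta>) x =
      (tensor_map R C (C \<boxtimes>[R] C) id \<Delta> \<circ> \<Delta>) x"
    and comult_counit_left: "\<forall>x\<in>carrier C.
      (tensor_lunit R C \<circ> tensor_map R (scalar_module R) C \<epsilon> id \<circ> \<Delta>) x = x"
    and comult_counit_right: "\<forall>x\<in>carrier C.
      (tensor_runit R C \<circ> tensor_map R C (scalar_module R) id \<epsilon> \<circ> \<Delta>) x = x"

text \<open>
  The four compatibility conditions say that \<open>\<Delta>\<close> and \<open>\<epsilon>\<close> are morphisms of unital algebras. The ones
  for \<open>\<eta>\<close> are evaluated at \<open>1\<close>, which spans the field \<open>R\<close>.
\<close>

locale bialgebra = field R + unital_algebra R H \<mu> \<eta> + counital_coalgebra R H \<Delta> \<epsilon>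
  for R (structure) and H (structure) and \<mu> and \<eta> and \<Delta> and \<epsilon> +
  assumes comult_mult: "\<forall>t\<in>carrier (H \<boxtimes>[R] H).
      (\<Delta> \<circ> \<mu>) t =
      (tensor_map R H H \<mu> \<mu> \<circ> middle_flip R H H H H
        \<circ> tensor_map R (H \<boxtimes>[R] H) (H \<boxtimes>[R] H) \<Delta> \<Delta>) t"
    and comult_unit: "\<Delta> (\<eta> \<one>\<^bsub>R\<^esub>) = pure_tensor R H H (\<eta> \<one>\<^bsub>R\<^esub>) (\<eta> \<one>\<^bsub>R\<^esub>)"
    and counit_mult: "\<forall>t\<in>carrier (H \<boxtimes>[R] H).
      (\<epsilon> \<circ> \<mu>) t =
      (tensor_lunit R (scalar_module R)
        \<circ> tensor_map R (scalar_module R) (scalar_module R) \<epsilon> \<epsilon>) t"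
    and counit_unit: "\<epsilon> (\<eta> \<one>\<^bsub>R\<^esub>) = \<one>\<^bsub>R\<^esub>"


section \<open>Yetter-Drinfel'd modules\<close>

locale left_action = unital_algebra R H \<mu> \<eta> + M?: module R M
  for R (structure) and H (structure) and \<mu> and \<eta> and M (structure) +
  fixes \<rho>
  assumes action_linear: "\<rho> \<in> linear_maps R (H \<boxtimes>[R] M) M"
    and action_mult: "\<forall>t\<in>carrier ((H \<boxtimes>[R] H) \<boxtimes>[R] M).
      (\<rho> \<circ> tensor_map R H M \<mu> id) t =
      (\<rho> \<circ> tensor_map R H M id \<rho> \<circ> tensor_assoc R H H M) t"
    and action_unit: "\<forall>t\<in>carrier (scalar_module R \<boxtimes>[R] M).
      (\<rho> \<circ> tensor_map R H M \<eta> id) t = tensor_lunit R M t"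

locale right_coaction = counital_coalgebra R H \<Delta> \<epsilon> + M?: module R M
  for R (structure) and H (structure) and \<Delta> and \<epsilon> and M (structure) +
  fixes \<delta>
  assumes coaction_linear: "\<delta> \<in> linear_maps R M (M \<boxtimes>[R] H)"
    and coaction_comult: "\<forall>x\<in>carrier M.
      (tensor_assoc R M H H \<circ> tensor_map R (M \<boxtimes>[R] H) H \<delta> id \<circ> \<delta>) x =
      (tensor_map R M (H \<boxtimes>[R] H) id \<Delta> \<circ> \<delta>) x"
    and coaction_counit: "\<forall>x\<in>carrier M.
      (tensor_runit R M \<circ> tensor_map R M (scalar_module R) id \<epsilon> \<circ> \<delta>) x = x"

locale yetter_drinfeld_module =
    bialgebra R H \<mu> \<eta> \<Delta> \<epsilon> + left_action R H \<mu> \<eta> M \<rho> + right_coaction R H \<Delta> \<epsilon> M \<delta>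
  for R (structure) and H (structure) and \<mu> and \<eta> and \<Delta> and \<epsilon> and M (structure) and \<rho> and \<delta> +
  assumes yetter_drinfeld: "\<forall>t\<in>carrier (H \<boxtimes>[R] M).
      (tensor_map R M H id \<mu>
        \<circ> tensor_assoc R M H H
        \<circ> tensor_map R (M \<boxtimes>[R] H) H \<delta> id
        \<circ> tensor_flip R H M
        \<circ> tensor_map R H M id \<rho>
        \<circ> tensor_assoc R H H M
        \<circ> tensor_map R (H \<boxtimes>[R] H) M \<Delta> id) t =
      (tensor_map R M H \<rho> \<mu>
        \<circ> middle_flip R H H M H
        \<circ> tensor_map R (H \<boxtimes>[R] H) (M \<boxtimes>[R] H) \<Delta> \<delta>) t"

end

theory Submission
  imports Defs
begin

text \<open>
  Write \<open>\<Delta> h = h\<^sub>1 \<otimes> h\<^sub>2\<close> and \<open>\<delta> m = m\<^sub>0 \<otimes> m\<^sub>1\<close>, sums being understood. On \<open>M \<otimes> N\<close> the action is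
  \<open>h(m \<otimes> n) = h\<^sub>2 m \<otimes> h\<^sub>1 n\<close> and the coaction is \<open>m \<otimes> n \<mapsto> (m\<^sub>0 \<otimes> n\<^sub>0) \<otimes> m\<^sub>1 n\<^sub>1\<close>. The first is an action
  and the second a coaction because \<open>\<Delta>\<close> and \<open>\<epsilon>\<close> are morphisms of unital algebras: \<open>\<Delta>(a b) = \<Delta> a \<Delta> b\<close> is what
  associativity of the one and coassociativity of the other need beyond the same law for \<open>M\<close> and \<open>N\<close>. The compatibility condition
  \<open>(h\<^sub>2 m)\<^sub>0 \<otimes> (h\<^sub>2 m)\<^sub>1 h\<^sub>1 = h\<^sub>1 m\<^sub>0 \<otimes> h\<^sub>2 m\<^sub>1\<close> for \<open>M \<otimes> N\<close> follows from the condition for \<open>N\<close>, then that for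
  \<open>M\<close>, each used between applications of coassociativity:
  \<open>(h\<^sub>3 m)\<^sub>0 \<otimes> (h\<^sub>2 n)\<^sub>0 \<otimes> (h\<^sub>3 m)\<^sub>1 (h\<^sub>2 n)\<^sub>1 h\<^sub>1
     = (h\<^sub>3 m)\<^sub>0 \<otimes> h\<^sub>1 n\<^sub>0 \<otimes> (h\<^sub>3 m)\<^sub>1 h\<^sub>2 n\<^sub>1
     = h\<^sub>2 m\<^sub>0 \<otimes> h\<^sub>1 n\<^sub>0 \<otimes> h\<^sub>3 m\<^sub>1 n\<^sub>1\<close>.
  The flip in the action puts \<open>h\<^sub>2\<close> and \<open>h\<^sub>1\<close>, in this order, next to each other in the first
  expression, so that the condition for \<open>N\<close> applies.

  Such a calculation names components of tensors that are not pure. Here a sum \<open>F(t\<^sub>1, t\<^sub>2)\<close> over the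
  components of a tensor \<open>t\<close> is \<open>tensor_lift R P F t\<close>, the value at \<open>t\<close> of the linear map induced by the
  bilinear map \<open>F\<close>. This turns Sweedler's notation into an honest iterated sum with three rules of
  calculation: a linear map moves inside (\<open>tensor_lift_hom\<close>), equal terms may be exchanged for each other
  under the sum (\<open>tensor_lift_cong\<close>), and two independent sums commute (\<open>tensor_lift_swap\<close>). The first and
  the third are consequences of the universal property of the tensor product, \<open>tensor_lift_pure\<close> together
  with \<open>tensor_ext\<close>. The axioms, given as equations of composites of structural maps, are
  rewritten as equations of such sums
  (\<open>coassoc_lift\<close>, \<open>counit_lift\<close>, \<open>comult_mult_lift\<close>, \<open>yetter_drinfeld_lift\<close>) and back (\<open>left_actionI\<close>,
  \<open>right_coactionI\<close>, and at the end of \<open>yetter_drinfeld_tensor\<close>).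
\<close>

section \<open>Linear and bilinear maps\<close>

lemma linear_mapsI:
  assumes "\<And>x. x \<in> carrier M \<Longrightarrow> f x \<in> carrier N"
    and "\<And>x y. \<lbrakk>x \<in> carrier M; y \<in> carrier M\<rbrakk> \<Longrightarrow> f (x \<oplus>\<^bsub>M\<^esub> y) = f x \<oplus>\<^bsub>N\<^esub> f y"
    and "\<And>a x. \<lbrakk>a \<in> carrier R; x \<in> carrier M\<rbrakk> \<Longrightarrow> f (a \<odot>\<^bsub>M\<^esub> x) = a \<odot>\<^bsub>N\<^esub> f x"
  shows "f \<in> linear_maps R M N"
  using assms by (simp add: linear_maps_def)

lemma linear_mapsD:
  assumes "f \<in> linear_maps R M N"
  shows linear_closed: "x \<in> carrier M \<Longrightarrow> f x \<in> carrier N"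
    and linear_add: "\<lbrakk>x \<in> carrier M; y \<in> carrier M\<rbrakk> \<Longrightarrow> f (x \<oplus>\<^bsub>M\<^esub> y) = f x \<oplus>\<^bsub>N\<^esub> f y"
    and linear_smult: "\<lbrakk>a \<in> carrier R; x \<in> carrier M\<rbrakk> \<Longrightarrow> f (a \<odot>\<^bsub>M\<^esub> x) = a \<odot>\<^bsub>N\<^esub> f x"
  using assms by (auto simp: linear_maps_def)

lemma linear_ident: "(\<lambda>x. x) \<in> linear_maps R M M"
  by (simp add: linear_maps_def)

lemma linear_comp:
  assumes "f \<in> linear_maps R N P" and "g \<in> linear_maps R M N"
  shows "(\<lambda>x. f (g x)) \<in> linear_maps R M P"
  using assms by (auto simp: linear_maps_def Pi_def)

lemma linear_zero:
  assumes "f \<in> linear_maps R M N" and "module R M" and "module R N"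
  shows "f \<zero>\<^bsub>M\<^esub> = \<zero>\<^bsub>N\<^esub>"
proof -
  interpret M: module R M by fact
  interpret N: module R N by fact
  have "f \<zero>\<^bsub>M\<^esub> = f (\<zero>\<^bsub>R\<^esub> \<odot>\<^bsub>M\<^esub> \<zero>\<^bsub>M\<^esub>)" by simp
  also have "\<dots> = \<zero>\<^bsub>R\<^esub> \<odot>\<^bsub>N\<^esub> f \<zero>\<^bsub>M\<^esub>" by (rule linear_smult[OF assms(1)]) simp_all
  finally show ?thesis using linear_closed[OF assms(1)] by simp
qed

lemma linear_minus:
  assumes "f \<in> linear_maps R M N" and "module R M" and "module R N"
    and "x \<in> carrier M" and "y \<in> carrier M"
  shows "f (x \<ominus>\<^bsub>M\<^esub> y) = f x \<ominus>\<^bsub>N\<^esub> f y"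
proof -
  interpret M: module R M by fact
  interpret N: module R N by fact
  have neg: "\<ominus>\<^bsub>M\<^esub> y = (\<ominus>\<^bsub>R\<^esub> \<one>\<^bsub>R\<^esub>) \<odot>\<^bsub>M\<^esub> y" using assms by (simp add: M.smult_l_minus)
  have "f (\<ominus>\<^bsub>M\<^esub> y) = (\<ominus>\<^bsub>R\<^esub> \<one>\<^bsub>R\<^esub>) \<odot>\<^bsub>N\<^esub> f y"
    unfolding neg using assms by (intro linear_smult[OF assms(1)]) simp_all
  also have "\<dots> = \<ominus>\<^bsub>N\<^esub> f y" using assms linear_closed[OF assms(1)] by (simp add: N.smult_l_minus)
  finally show ?thesis using assms linear_add[OF assms(1)] by (simp add: a_minus_def)
qed

lemma submodule_kernel:
  assumes "f \<in> linear_maps R M N" and "module R M" and "module R N"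
  shows "submodule {x \<in> carrier M. f x = \<zero>\<^bsub>N\<^esub>} R M"
proof -
  interpret M: module R M by fact
  interpret N: module R N by fact
  note z = linear_zero[OF assms]
  show ?thesis
  proof (rule M.submoduleI)
    fix a assume "a \<in> {x \<in> carrier M. f x = \<zero>\<^bsub>N\<^esub>}"
    then show "\<ominus>\<^bsub>M\<^esub> a \<in> {x \<in> carrier M. f x = \<zero>\<^bsub>N\<^esub>}"
      using linear_minus[OF assms, of "\<zero>\<^bsub>M\<^esub>" a] z by (simp add: a_minus_def)
  qed (auto simp: z linear_add[OF assms(1)] linear_smult[OF assms(1)])
qed

definition bilinear_maps ::
  "('a, 'r) ring_scheme \<Rightarrow> ('a, 'm, 'x) module_scheme \<Rightarrow> ('a, 'n, 'y) module_scheme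
     \<Rightarrow> ('a, 'p, 'z) module_scheme \<Rightarrow> ('m \<Rightarrow> 'n \<Rightarrow> 'p) set"
where
  "bilinear_maps R M N P =
     {\<beta>. (\<forall>x\<in>carrier M. (\<lambda>y. \<beta> x y) \<in> linear_maps R N P) \<and>
         (\<forall>y\<in>carrier N. (\<lambda>x. \<beta> x y) \<in> linear_maps R M P)}"

lemma bilinearI:
  assumes "\<And>x. x \<in> carrier M \<Longrightarrow> (\<lambda>y. \<beta> x y) \<in> linear_maps R N P"
    and "\<And>y. y \<in> carrier N \<Longrightarrow> (\<lambda>x. \<beta> x y) \<in> linear_maps R M P"
  shows "(\<lambda>x y. \<beta> x y) \<in> bilinear_maps R M N P"
  using assms by (simp add: bilinear_maps_def)

lemma bilinearD:
  assumes "\<beta> \<in> bilinear_maps R M N P"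
  shows bilinear_right: "x \<in> carrier M \<Longrightarrow> (\<lambda>y. \<beta> x y) \<in> linear_maps R N P"
    and bilinear_left: "y \<in> carrier N \<Longrightarrow> (\<lambda>x. \<beta> x y) \<in> linear_maps R M P"
    and bilinear_closed: "\<lbrakk>x \<in> carrier M; y \<in> carrier N\<rbrakk> \<Longrightarrow> \<beta> x y \<in> carrier P"
  using assms by (auto simp: bilinear_maps_def linear_maps_def)

section \<open>Free modules and quotients\<close>

lemma free_module_simps:
  "f \<in> carrier (free_module R X) \<longleftrightarrow>
     f \<in> X \<rightarrow> carrier R \<and> (\<forall>i. i \<notin> X \<longrightarrow> f i = \<zero>\<^bsub>R\<^esub>) \<and> finite {i. f i \<noteq> \<zero>\<^bsub>R\<^esub>}"
  "\<zero>\<^bsub>free_module R X\<^esub> = (\<lambda>i. \<zero>\<^bsub>R\<^esub>)"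
  "f \<oplus>\<^bsub>free_module R X\<^esub> g = (\<lambda>i. f i \<oplus>\<^bsub>R\<^esub> g i)"
  "a \<odot>\<^bsub>free_module R X\<^esub> f = (\<lambda>i. a \<otimes>\<^bsub>R\<^esub> f i)"
  by (simp_all add: free_module_def)

context cring
begin

lemma free_module_closed:
  "f \<in> carrier (free_module R X) \<Longrightarrow> f i \<in> carrier R"
  by (cases "i \<in> X") (auto simp: free_module_simps)

lemma free_module_add_closed:
  assumes "f \<in> carrier (free_module R X)" and "g \<in> carrier (free_module R X)"
  shows "(\<lambda>i. f i \<oplus> g i) \<in> carrier (free_module R X)"
proof -
  have "{i. f i \<oplus> g i \<noteq> \<zero>} \<subseteq> {i. f i \<noteq> \<zero>} \<union> {i. g i \<noteq> \<zero>}"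
    by auto
  then have "finite {i. f i \<oplus> g i \<noteq> \<zero>}"
    using assms unfolding free_module_simps by (blast intro: finite_subset)
  then show ?thesis using assms by (auto simp: free_module_simps)
qed

lemma free_module_smult_closed:
  assumes "a \<in> carrier R" and "f \<in> carrier (free_module R X)"
  shows "(\<lambda>i. a \<otimes> f i) \<in> carrier (free_module R X)"
proof -
  have "{i. a \<otimes> f i \<noteq> \<zero>} \<subseteq> {i. f i \<noteq> \<zero>}"
    using assms by auto
  then have "finite {i. a \<otimes> f i \<noteq> \<zero>}"
    using assms unfolding free_module_simps by (blast intro: finite_subset)
  then show ?thesis using assms by (auto simp: free_module_simps)
qed

lemma free_module_is_module: "module R (free_module R X)"
proof (rule moduleI)
  show "abelian_group (free_module R X)"
  proof (rule abelian_groupI)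
    fix f assume f: "f \<in> carrier (free_module R X)"
    show "\<exists>g\<in>carrier (free_module R X). g \<oplus>\<^bsub>free_module R X\<^esub> f = \<zero>\<^bsub>free_module R X\<^esub>"
    proof
      show "(\<lambda>i. \<ominus> \<one> \<otimes> f i) \<in> carrier (free_module R X)"
        using f by (intro free_module_smult_closed) simp_all
      show "(\<lambda>i. \<ominus> \<one> \<otimes> f i) \<oplus>\<^bsub>free_module R X\<^esub> f = \<zero>\<^bsub>free_module R X\<^esub>"
        using free_module_closed[OF f] by (simp add: free_module_simps fun_eq_iff l_minus l_neg)
    qed
  next
    show "\<zero>\<^bsub>free_module R X\<^esub> \<in> carrier (free_module R X)"
      by (simp add: free_module_simps)
  qed (auto simp: free_module_simps(2,3) free_module_closed fun_eq_iff a_ac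
         intro: free_module_add_closed)
qed (auto simp: free_module_simps(3,4) free_module_closed fun_eq_iff l_distr r_distr m_assoc
       intro: is_cring free_module_smult_closed)

lemma free_gen_closed: "i \<in> X \<Longrightarrow> free_gen R i \<in> carrier (free_module R X)"
  by (auto simp: free_module_simps free_gen_def)

text \<open>
  The linear extension to the free module of a function given on the generators. For a function of pairs
  it is the sum that \<open>tensor_lift\<close> evaluates on every representative of a coset.
\<close>

definition free_lift :: "('a, 'p, 'z) module_scheme \<Rightarrow> ('i \<Rightarrow> 'p) \<Rightarrow> ('i \<Rightarrow> 'a) \<Rightarrow> 'p" where
  "free_lift P \<beta> r = (\<Oplus>\<^bsub>P\<^esub>p\<in>{p. r p \<noteq> \<zero>}. r p \<odot>\<^bsub>P\<^esub> \<beta> p)"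

text \<open>
  The support of a sum of two finitely supported functions need not be the union of their supports, so
  linearity of \<open>free_lift\<close> is proved by summing over a set large enough for all functions involved.
\<close>

lemma free_lift_superset:
  assumes "module R P" and "r \<in> carrier (free_module R X)" and "\<beta> \<in> X \<rightarrow> carrier P"
    and "finite B" and "B \<subseteq> X" and "\<And>p. r p \<noteq> \<zero>\<^bsub>R\<^esub> \<Longrightarrow> p \<in> B"
  shows "free_lift P \<beta> r = (\<Oplus>\<^bsub>P\<^esub>p\<in>B. r p \<odot>\<^bsub>P\<^esub> \<beta> p)"
proof -
  interpret P: module R P by fact
  have "p \<in> X" if "r p \<noteq> \<zero>\<^bsub>R\<^esub>" for p
    using that assms(2) by (auto simp: free_module_simps)
  then show ?thesis
    unfolding free_lift_def using assms free_module_closed[OF assms(2)]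
    by (intro P.add.finprod_mono_neutral_cong_left) (auto simp: Pi_def)
qed

lemma free_lift_linear:
  assumes P: "module R P" and \<beta>: "\<beta> \<in> X \<rightarrow> carrier P"
  shows "free_lift P \<beta> \<in> linear_maps R (free_module R X) P"
proof -
  interpret P: module R P by fact
  have closed: "free_lift P \<beta> r \<in> carrier P" if "r \<in> carrier (free_module R X)" for r
    using that \<beta> free_module_closed[OF that] unfolding free_lift_def
    by (intro P.finsum_closed) (auto simp: free_module_simps intro!: P.smult_closed)
  show ?thesis
  proof (rule linear_mapsI)
    fix r s assume r: "r \<in> carrier (free_module R X)" and s: "s \<in> carrier (free_module R X)"
    let ?B = "{p. r p \<noteq> \<zero>} \<union> {p. s p \<noteq> \<zero>}"
    have B: "finite ?B" "?B \<subseteq> X" using r s by (auto simp: free_module_simps)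
    have rc: "r p \<in> carrier R" and sc: "s p \<in> carrier R" for p
      using free_module_closed[OF r] free_module_closed[OF s] by simp_all
    have bc: "\<beta> p \<in> carrier P" if "p \<in> ?B" for p using that \<beta> B by auto
    have "free_lift P \<beta> (\<lambda>i. r i \<oplus> s i) = (\<Oplus>\<^bsub>P\<^esub>p\<in>?B. (r p \<oplus> s p) \<odot>\<^bsub>P\<^esub> \<beta> p)"
      by (rule free_lift_superset[OF P free_module_add_closed[OF r s] \<beta> B]) (use rc sc in auto)
    also have "\<dots> = (\<Oplus>\<^bsub>P\<^esub>p\<in>?B. r p \<odot>\<^bsub>P\<^esub> \<beta> p \<oplus>\<^bsub>P\<^esub> s p \<odot>\<^bsub>P\<^esub> \<beta> p)"
      by (rule P.finsum_cong') (use rc sc bc in \<open>auto simp: P.smult_l_distr\<close>)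
    also have "\<dots> = (\<Oplus>\<^bsub>P\<^esub>p\<in>?B. r p \<odot>\<^bsub>P\<^esub> \<beta> p) \<oplus>\<^bsub>P\<^esub> (\<Oplus>\<^bsub>P\<^esub>p\<in>?B. s p \<odot>\<^bsub>P\<^esub> \<beta> p)"
      by (rule P.finsum_addf) (use rc sc bc in auto)
    also have "(\<Oplus>\<^bsub>P\<^esub>p\<in>?B. r p \<odot>\<^bsub>P\<^esub> \<beta> p) = free_lift P \<beta> r"
      by (rule free_lift_superset[OF P r \<beta> B, symmetric]) auto
    also have "(\<Oplus>\<^bsub>P\<^esub>p\<in>?B. s p \<odot>\<^bsub>P\<^esub> \<beta> p) = free_lift P \<beta> s"
      by (rule free_lift_superset[OF P s \<beta> B, symmetric]) auto
    finally show "free_lift P \<beta> (r \<oplus>\<^bsub>free_module R X\<^esub> s) = free_lift P \<beta> r \<oplus>\<^bsub>P\<^esub> free_lift P \<beta> s"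
      by (simp add: free_module_simps)
  next
    fix a r assume a: "a \<in> carrier R" and r: "r \<in> carrier (free_module R X)"
    let ?B = "{p. r p \<noteq> \<zero>}"
    have B: "finite ?B" "?B \<subseteq> X" using r by (auto simp: free_module_simps)
    have rc: "r p \<in> carrier R" for p using free_module_closed[OF r] by simp
    have bc: "\<beta> p \<in> carrier P" if "p \<in> ?B" for p using that \<beta> B by auto
    have "free_lift P \<beta> (\<lambda>i. a \<otimes> r i) = (\<Oplus>\<^bsub>P\<^esub>p\<in>?B. (a \<otimes> r p) \<odot>\<^bsub>P\<^esub> \<beta> p)"
      by (rule free_lift_superset[OF P free_module_smult_closed[OF a r] \<beta> B]) (use a rc in auto)
    also have "\<dots> = (\<Oplus>\<^bsub>P\<^esub>p\<in>?B. a \<odot>\<^bsub>P\<^esub> (r p \<odot>\<^bsub>P\<^esub> \<beta> p))"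
      by (rule P.finsum_cong') (use a rc bc in \<open>auto simp: P.smult_assoc1\<close>)
    also have "\<dots> = a \<odot>\<^bsub>P\<^esub> free_lift P \<beta> r"
      unfolding free_lift_def
      by (rule P.finsum_smult_ldistr[symmetric]) (use B a rc bc in auto)
    finally show "free_lift P \<beta> (a \<odot>\<^bsub>free_module R X\<^esub> r) = a \<odot>\<^bsub>P\<^esub> free_lift P \<beta> r"
      by (simp add: free_module_simps)
  qed (fact closed)
qed

lemma free_lift_gen:
  assumes P: "module R P" and \<beta>: "\<beta> \<in> X \<rightarrow> carrier P" and p: "p \<in> X"
  shows "free_lift P \<beta> (free_gen R p) = \<beta> p"
proof -
  interpret P: module R P by fact
  have bp: "\<beta> p \<in> carrier P" using \<beta> p by auto
  have "free_lift P \<beta> (free_gen R p) = (\<Oplus>\<^bsub>P\<^esub>q\<in>{p}. free_gen R p q \<odot>\<^bsub>P\<^esub> \<beta> q)"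
    by (rule free_lift_superset[OF P free_gen_closed[OF p] \<beta>])
       (use p in \<open>auto simp: free_gen_def split: if_splits\<close>)
  also have "\<dots> = \<beta> p" using bp by (simp add: free_gen_def)
  finally show ?thesis .
qed

lemma free_module_induct [consumes 1, case_names zero gen]:
  assumes r: "r \<in> carrier (free_module R X)"
    and zero: "Q \<zero>\<^bsub>free_module R X\<^esub>"
    and gen: "\<And>a p r. \<lbrakk>a \<in> carrier R; p \<in> X; r \<in> carrier (free_module R X); Q r\<rbrakk>
      \<Longrightarrow> Q (a \<odot>\<^bsub>free_module R X\<^esub> free_gen R p \<oplus>\<^bsub>free_module R X\<^esub> r)"
  shows "Q r"
proof -
  have "finite {i. r i \<noteq> \<zero>}" using r by (simp add: free_module_simps)
  then show ?thesis using r
  proof (induction "{i. r i \<noteq> \<zero>}" arbitrary: r rule: finite_induct)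
    case empty
    then have "r = \<zero>\<^bsub>free_module R X\<^esub>" by (auto simp: free_module_simps)
    then show ?case using zero by simp
  next
    case (insert p B)
    have rc: "r i \<in> carrier R" for i using insert.prems by (rule free_module_closed)
    let ?s = "r(p := \<zero>)"
    have B: "B = {i. ?s i \<noteq> \<zero>}" using insert.hyps by auto
    have s: "?s \<in> carrier (free_module R X)"
      using insert.prems insert.hyps(1) B by (auto simp: free_module_simps)
    have p: "p \<in> X" using insert.prems insert.hyps(4) by (auto simp: free_module_simps)
    have "r = r p \<odot>\<^bsub>free_module R X\<^esub> free_gen R p \<oplus>\<^bsub>free_module R X\<^esub> ?s"
      using rc by (auto simp: free_module_simps free_gen_def fun_eq_iff)
    then show ?case using gen[OF rc[of p] p s insert.hyps(3)[OF B s]] by simp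
  qed
qed

lemma generated_submodule_least:
  assumes "module R M" and "S \<subseteq> carrier M"
  shows "submodule (generated_submodule R M S) R M"
    and "S \<subseteq> generated_submodule R M S"
    and "\<And>K. \<lbrakk>submodule K R M; S \<subseteq> K\<rbrakk> \<Longrightarrow> generated_submodule R M S \<subseteq> K"
proof -
  interpret M: module R M by fact
  have c: "submodule (carrier M) R M" by (rule M.carrier_is_submodule)
  show "submodule (generated_submodule R M S) R M"
  proof (rule M.submoduleI)
    show "generated_submodule R M S \<subseteq> carrier M"
      using c assms by (auto simp: generated_submodule_def)
    have "\<zero>\<^bsub>M\<^esub> \<in> K" if "submodule K R M" for K
      using subgroup.one_closed[OF submodule.axioms(1)[OF that]] by simp
    then show "\<zero>\<^bsub>M\<^esub> \<in> generated_submodule R M S"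
      by (simp add: generated_submodule_def)
  qed (simp_all add: generated_submodule_def M.submoduleE(3,4,5))
qed (auto simp: generated_submodule_def)

text \<open>
  The rules for calculating with cosets. The scalar multiplication of the quotient is defined as a union
  of cosets over all representatives; these cosets coincide because \<open>K\<close> is closed under scalars.
\<close>

lemma quotient_module_cosets:
  assumes M: "module R M" and K: "submodule K R M"
  shows "carrier (quotient_module R M K) = (\<lambda>x. K +>\<^bsub>M\<^esub> x) ` carrier M"
    and "\<lbrakk>x \<in> carrier M; y \<in> carrier M\<rbrakk> \<Longrightarrow>
      (K +>\<^bsub>M\<^esub> x) \<oplus>\<^bsub>quotient_module R M K\<^esub> (K +>\<^bsub>M\<^esub> y) = K +>\<^bsub>M\<^esub> (x \<oplus>\<^bsub>M\<^esub> y)"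
    and "\<lbrakk>a \<in> carrier R; x \<in> carrier M\<rbrakk> \<Longrightarrow>
      a \<odot>\<^bsub>quotient_module R M K\<^esub> (K +>\<^bsub>M\<^esub> x) = K +>\<^bsub>M\<^esub> (a \<odot>\<^bsub>M\<^esub> x)"
    and "\<zero>\<^bsub>quotient_module R M K\<^esub> = K"
    and "x \<in> carrier M \<Longrightarrow> x \<in> K +>\<^bsub>M\<^esub> x"
    and "\<lbrakk>x \<in> carrier M; z \<in> K +>\<^bsub>M\<^esub> x\<rbrakk> \<Longrightarrow> z \<in> carrier M \<and> z \<ominus>\<^bsub>M\<^esub> x \<in> K"
    and "\<lbrakk>x \<in> carrier M; y \<in> carrier M; x \<ominus>\<^bsub>M\<^esub> y \<in> K\<rbrakk> \<Longrightarrow> K +>\<^bsub>M\<^esub> x = K +>\<^bsub>M\<^esub> y"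
proof -
  interpret M: module R M by fact
  interpret K: abelian_subgroup K M
    by (rule abelian_subgroupI2[OF M.a_comm_group submodule.axioms(1)[OF K]])
  have eq: "K +>\<^bsub>M\<^esub> x = K +>\<^bsub>M\<^esub> y" if "x \<in> carrier M" "y \<in> carrier M" "x \<ominus>\<^bsub>M\<^esub> y \<in> K" for x y
  proof -
    have "x \<in> K +>\<^bsub>M\<^esub> y" using K.a_rcos_module_rev[of y x] that by (simp add: a_minus_def)
    from K.a_repr_independence'[OF this that(2)] show ?thesis by simp
  qed
  have mem: "z \<in> carrier M \<and> z \<ominus>\<^bsub>M\<^esub> x \<in> K" if "x \<in> carrier M" "z \<in> K +>\<^bsub>M\<^esub> x" for x z
    using K.a_elemrcos_carrier[OF that] K.a_rcos_module_imp[OF that] by (simp add: a_minus_def)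
  show "carrier (quotient_module R M K) = (\<lambda>x. K +>\<^bsub>M\<^esub> x) ` carrier M"
    by (auto simp: quotient_module_def A_RCOSETS_def')
  show "(K +>\<^bsub>M\<^esub> x) \<oplus>\<^bsub>quotient_module R M K\<^esub> (K +>\<^bsub>M\<^esub> y) = K +>\<^bsub>M\<^esub> (x \<oplus>\<^bsub>M\<^esub> y)"
    if "x \<in> carrier M" "y \<in> carrier M"
    using that by (simp add: quotient_module_def K.a_rcos_sum)
  show self: "x \<in> K +>\<^bsub>M\<^esub> x" if "x \<in> carrier M" for x
    using that K.a_rcos_self by blast
  show "a \<odot>\<^bsub>quotient_module R M K\<^esub> (K +>\<^bsub>M\<^esub> x) = K +>\<^bsub>M\<^esub> (a \<odot>\<^bsub>M\<^esub> x)"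
    if a: "a \<in> carrier R" and x: "x \<in> carrier M"
  proof -
    have "K +>\<^bsub>M\<^esub> (a \<odot>\<^bsub>M\<^esub> z) = K +>\<^bsub>M\<^esub> (a \<odot>\<^bsub>M\<^esub> x)" if z: "z \<in> K +>\<^bsub>M\<^esub> x" for z
    proof (rule eq)
      have zc: "z \<in> carrier M" and zx: "z \<ominus>\<^bsub>M\<^esub> x \<in> K" using mem[OF x z] by auto
      then show "a \<odot>\<^bsub>M\<^esub> z \<in> carrier M" "a \<odot>\<^bsub>M\<^esub> x \<in> carrier M" using a x by auto
      have "a \<odot>\<^bsub>M\<^esub> (z \<ominus>\<^bsub>M\<^esub> x) \<in> K" using submodule.smult_closed[OF K a zx] .
      then show "a \<odot>\<^bsub>M\<^esub> z \<ominus>\<^bsub>M\<^esub> a \<odot>\<^bsub>M\<^esub> x \<in> K"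
        using a x zc by (simp add: a_minus_def M.smult_r_distr M.smult_r_minus)
    qed
    then have "(\<Union>z\<in>K +>\<^bsub>M\<^esub> x. K +>\<^bsub>M\<^esub> (a \<odot>\<^bsub>M\<^esub> z)) = K +>\<^bsub>M\<^esub> (a \<odot>\<^bsub>M\<^esub> x)"
      using self[OF x] by blast
    then show ?thesis by (simp add: quotient_module_def)
  qed
  show "\<zero>\<^bsub>quotient_module R M K\<^esub> = K" by (simp add: quotient_module_def)
  show "\<lbrakk>x \<in> carrier M; z \<in> K +>\<^bsub>M\<^esub> x\<rbrakk> \<Longrightarrow> z \<in> carrier M \<and> z \<ominus>\<^bsub>M\<^esub> x \<in> K" by (rule mem)
  show "\<lbrakk>x \<in> carrier M; y \<in> carrier M; x \<ominus>\<^bsub>M\<^esub> y \<in> K\<rbrakk> \<Longrightarrow> K +>\<^bsub>M\<^esub> x = K +>\<^bsub>M\<^esub> y" by (rule eq)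
qed

lemma quotient_module_is_module:
  assumes M: "module R M" and K: "submodule K R M"
  shows "module R (quotient_module R M K)"
proof -
  interpret M: module R M by fact
  interpret K: abelian_subgroup K M
    by (rule abelian_subgroupI2[OF M.a_comm_group submodule.axioms(1)[OF K]])
  let ?Q = "quotient_module R M K"
  note S = quotient_module_cosets(1-3)[OF M K]
  have zero: "\<zero>\<^bsub>?Q\<^esub> = K +>\<^bsub>M\<^esub> \<zero>\<^bsub>M\<^esub>"
    using K.a_subset by (simp add: quotient_module_cosets(4)[OF M K])
  have "abelian_group ?Q"
  proof (rule abelian_groupI)
    fix X assume "X \<in> carrier ?Q"
    then obtain x where x: "x \<in> carrier M" and X: "X = K +>\<^bsub>M\<^esub> x" by (auto simp: S)
    show "\<exists>Y\<in>carrier ?Q. Y \<oplus>\<^bsub>?Q\<^esub> X = \<zero>\<^bsub>?Q\<^esub>"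
      using x by (intro bexI[of _ "K +>\<^bsub>M\<^esub> (\<ominus>\<^bsub>M\<^esub> x)"]) (auto simp: X S zero M.l_neg)
  qed (auto simp: S zero M.a_ac)
  then show ?thesis
    by (rule moduleI[OF is_cring])
       (auto simp: S M.smult_l_distr M.smult_r_distr M.smult_assoc1)
qed

lemma quotient_module_proj_linear:
  assumes "module R M" and "submodule K R M"
  shows "(\<lambda>x. K +>\<^bsub>M\<^esub> x) \<in> linear_maps R M (quotient_module R M K)"
  by (rule linear_mapsI) (auto simp: quotient_module_cosets(1-3)[OF assms])


section \<open>The universal property of the tensor product\<close>

lemma tensor_relations_subset:
  assumes "module R M" and "module R N"
  shows "tensor_relations R M N \<subseteq> carrier (free_module R (carrier M \<times> carrier N))"
proof -
  interpret M: module R M by fact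
  interpret N: module R N by fact
  interpret F: module R "free_module R (carrier M \<times> carrier N)" by (rule free_module_is_module)
  have g: "free_gen R (x, y) \<in> carrier (free_module R (carrier M \<times> carrier N))"
    if "x \<in> carrier M" "y \<in> carrier N" for x y
    using that by (intro free_gen_closed) simp
  show ?thesis
    unfolding tensor_relations_def Let_def
    by (auto intro!: F.minus_closed F.add.m_closed F.smult_closed g)
qed

lemma
  assumes "module R M" and "module R N"
  shows submodule_tensor_kernel:
      "submodule (tensor_kernel R M N) R (free_module R (carrier M \<times> carrier N))"
    and tensor_relations_subset_kernel: "tensor_relations R M N \<subseteq> tensor_kernel R M N"
    and tensor_kernel_least:
      "\<lbrakk>submodule K R (free_module R (carrier M \<times> carrier N)); tensor_relations R M N \<subseteq> K\<rbrakk>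
        \<Longrightarrow> tensor_kernel R M N \<subseteq> K"
  unfolding tensor_kernel_def
  using generated_submodule_least[OF free_module_is_module tensor_relations_subset[OF assms]]
  by blast+

lemma tensor_is_module:
  assumes "module R M" and "module R N"
  shows "module R (M \<boxtimes>[R] N)"
  unfolding tensor_def
  by (intro quotient_module_is_module free_module_is_module submodule_tensor_kernel assms)

text \<open>
  Each of the four families of relations is one of the four laws of bilinearity, read in the quotient.
\<close>

lemma pure_tensor_bilinear:
  fixes M :: "('a, 'm, 'x) module_scheme" and N :: "('a, 'n, 'y) module_scheme"
  assumes M: "module R M" and N: "module R N"
  shows "pure_tensor R M N \<in> bilinear_maps R M N (M \<boxtimes>[R] N)"
proof -
  interpret M: module R M by fact
  interpret N: module R N by fact
  let ?F = "free_module R (carrier M \<times> carrier N)"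
  let ?K = "tensor_kernel R M N"
  interpret F: module R ?F by (rule free_module_is_module)
  note S = quotient_module_cosets[OF free_module_is_module submodule_tensor_kernel[OF M N],
      folded tensor_def]
  have g: "free_gen R (x, y) \<in> carrier ?F" if "x \<in> carrier M" "y \<in> carrier N" for x y
    using that by (intro free_gen_closed) simp
  have rel: "?K +>\<^bsub>?F\<^esub> r = ?K +>\<^bsub>?F\<^esub> s"
    if "r \<ominus>\<^bsub>?F\<^esub> s \<in> tensor_relations R M N" "r \<in> carrier ?F" "s \<in> carrier ?F" for r s
    using that tensor_relations_subset_kernel[OF M N] by (intro S(7)) auto
  note [intro!] = g
  show ?thesis
  proof (rule bilinearI[of M "pure_tensor R M N" R N "M \<boxtimes>[R] N"])
    fix x assume x: "x \<in> carrier M"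
    show "(\<lambda>y. pure_tensor R M N x y) \<in> linear_maps R N (M \<boxtimes>[R] N)"
    proof (rule linear_mapsI)
      fix y assume "y \<in> carrier N"
      with x show "pure_tensor R M N x y \<in> carrier (M \<boxtimes>[R] N)"
        by (auto simp: pure_tensor_def S(1))
    next
      fix y y' assume y: "y \<in> carrier N" and y': "y' \<in> carrier N"
      have "?K +>\<^bsub>?F\<^esub> free_gen R (x, y \<oplus>\<^bsub>N\<^esub> y')
          = ?K +>\<^bsub>?F\<^esub> (free_gen R (x, y) \<oplus>\<^bsub>?F\<^esub> free_gen R (x, y'))"
      proof (rule rel)
        show "free_gen R (x, y \<oplus>\<^bsub>N\<^esub> y') \<ominus>\<^bsub>?F\<^esub> (free_gen R (x, y) \<oplus>\<^bsub>?F\<^esub> free_gen R (x, y'))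
            \<in> tensor_relations R M N"
          unfolding tensor_relations_def Let_def using x y y' by blast
      qed (use x y y' in auto)
      then show "pure_tensor R M N x (y \<oplus>\<^bsub>N\<^esub> y')
          = pure_tensor R M N x y \<oplus>\<^bsub>M \<boxtimes>[R] N\<^esub> pure_tensor R M N x y'"
        unfolding pure_tensor_def using x y y' by (subst S(2)) auto
    next
      fix a y assume a: "a \<in> carrier R" and y: "y \<in> carrier N"
      have "?K +>\<^bsub>?F\<^esub> free_gen R (x, a \<odot>\<^bsub>N\<^esub> y) = ?K +>\<^bsub>?F\<^esub> (a \<odot>\<^bsub>?F\<^esub> free_gen R (x, y))"
      proof (rule rel)
        show "free_gen R (x, a \<odot>\<^bsub>N\<^esub> y) \<ominus>\<^bsub>?F\<^esub> (a \<odot>\<^bsub>?F\<^esub> free_gen R (x, y)) \<in> tensor_relations R M N"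
          unfolding tensor_relations_def Let_def using x y a by blast
      qed (use x y a in auto)
      then show "pure_tensor R M N x (a \<odot>\<^bsub>N\<^esub> y) = a \<odot>\<^bsub>M \<boxtimes>[R] N\<^esub> pure_tensor R M N x y"
        unfolding pure_tensor_def using x y a by (subst S(3)) auto
    qed
  next
    fix y assume y: "y \<in> carrier N"
    show "(\<lambda>x. pure_tensor R M N x y) \<in> linear_maps R M (M \<boxtimes>[R] N)"
    proof (rule linear_mapsI)
      fix x assume "x \<in> carrier M"
      with y show "pure_tensor R M N x y \<in> carrier (M \<boxtimes>[R] N)"
        by (auto simp: pure_tensor_def S(1))
    next
      fix x x' assume x: "x \<in> carrier M" and x': "x' \<in> carrier M"
      have "?K +>\<^bsub>?F\<^esub> free_gen R (x \<oplus>\<^bsub>M\<^esub> x', y)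
          = ?K +>\<^bsub>?F\<^esub> (free_gen R (x, y) \<oplus>\<^bsub>?F\<^esub> free_gen R (x', y))"
      proof (rule rel)
        show "free_gen R (x \<oplus>\<^bsub>M\<^esub> x', y) \<ominus>\<^bsub>?F\<^esub> (free_gen R (x, y) \<oplus>\<^bsub>?F\<^esub> free_gen R (x', y))
            \<in> tensor_relations R M N"
          unfolding tensor_relations_def Let_def using x x' y by blast
      qed (use x x' y in auto)
      then show "pure_tensor R M N (x \<oplus>\<^bsub>M\<^esub> x') y
          = pure_tensor R M N x y \<oplus>\<^bsub>M \<boxtimes>[R] N\<^esub> pure_tensor R M N x' y"
        unfolding pure_tensor_def using x x' y by (subst S(2)) auto
    next
      fix a x assume a: "a \<in> carrier R" and x: "x \<in> carrier M"
      have "?K +>\<^bsub>?F\<^esub> free_gen R (a \<odot>\<^bsub>M\<^esub> x, y) = ?K +>\<^bsub>?F\<^esub> (a \<odot>\<^bsub>?F\<^esub> free_gen R (x, y))"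
      proof (rule rel)
        show "free_gen R (a \<odot>\<^bsub>M\<^esub> x, y) \<ominus>\<^bsub>?F\<^esub> (a \<odot>\<^bsub>?F\<^esub> free_gen R (x, y)) \<in> tensor_relations R M N"
          unfolding tensor_relations_def Let_def using x y a by blast
      qed (use x y a in auto)
      then show "pure_tensor R M N (a \<odot>\<^bsub>M\<^esub> x) y = a \<odot>\<^bsub>M \<boxtimes>[R] N\<^esub> pure_tensor R M N x y"
        unfolding pure_tensor_def using x y a by (subst S(3)) auto
    qed
  qed
qed

text \<open>
  The uniqueness half of the universal property. The tensor product is a quotient of the free module on
  pairs, whose generators go to the pure tensors.
\<close>

lemma tensor_ext:
  fixes P :: "('a, 'p, 'z) module_scheme"
  assumes M: "module R M" and N: "module R N" and P: "module R P"
    and f: "f \<in> linear_maps R (M \<boxtimes>[R] N) P" and g: "g \<in> linear_maps R (M \<boxtimes>[R] N) P"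
    and eq: "\<And>x y. \<lbrakk>x \<in> carrier M; y \<in> carrier N\<rbrakk>
      \<Longrightarrow> f (pure_tensor R M N x y) = g (pure_tensor R M N x y)"
    and t: "t \<in> carrier (M \<boxtimes>[R] N)"
  shows "f t = g t"
proof -
  let ?F = "free_module R (carrier M \<times> carrier N)"
  let ?\<pi> = "\<lambda>r. tensor_kernel R M N +>\<^bsub>?F\<^esub> r"
  interpret F: module R ?F by (rule free_module_is_module)
  note K = submodule_tensor_kernel[OF M N]
  have \<pi>: "?\<pi> \<in> linear_maps R ?F (M \<boxtimes>[R] N)"
    unfolding tensor_def by (rule quotient_module_proj_linear[OF free_module_is_module K])
  note f' = linear_comp[OF f \<pi>] and g' = linear_comp[OF g \<pi>]
  have "f (?\<pi> r) = g (?\<pi> r)" if "r \<in> carrier ?F" for r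
    using that
  proof (induction rule: free_module_induct)
    case zero
    show ?case
      using linear_zero[OF f' free_module_is_module P] linear_zero[OF g' free_module_is_module P]
      by simp
  next
    case (gen a p r)
    have p: "free_gen R p \<in> carrier ?F" by (rule free_gen_closed) fact
    have "f (?\<pi> (free_gen R p)) = g (?\<pi> (free_gen R p))"
      using eq[of "fst p" "snd p"] gen by (auto simp: pure_tensor_def)
    then show ?case
      using gen p by (simp add: linear_add[OF f'] linear_add[OF g'] linear_smult[OF f'] linear_smult[OF g'])
  qed
  moreover obtain r where "r \<in> carrier ?F" "t = ?\<pi> r"
    using t quotient_module_cosets(1)[OF free_module_is_module K] by (auto simp: tensor_def)
  ultimately show ?thesis by simp
qed

text \<open>
  The existence half of the universal property. The kernel of the linear extension of \<open>\<beta>\<close> to the free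
  module is a submodule and, \<open>\<beta>\<close> being bilinear, contains the relations. It therefore contains the
  submodule that they generate, and the extension is constant on cosets.
\<close>

lemma
  fixes P :: "('a, 'p, 'z) module_scheme"
  assumes M: "module R M" and N: "module R N" and P: "module R P"
    and \<beta>: "\<beta> \<in> bilinear_maps R M N P"
  shows tensor_lift_linear: "tensor_lift R P \<beta> \<in> linear_maps R (M \<boxtimes>[R] N) P"
    and tensor_lift_pure: "\<lbrakk>x \<in> carrier M; y \<in> carrier N\<rbrakk>
      \<Longrightarrow> tensor_lift R P \<beta> (pure_tensor R M N x y) = \<beta> x y"
proof -
  interpret M: module R M by fact
  interpret N: module R N by fact
  interpret P: module R P by fact
  let ?X = "carrier M \<times> carrier N"
  let ?F = "free_module R ?X"
  let ?K = "tensor_kernel R M N"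
  let ?L = "free_lift P (\<lambda>p. \<beta> (fst p) (snd p))"
  interpret F: module R ?F by (rule free_module_is_module)
  note F = free_module_is_module
  note S = quotient_module_cosets[OF free_module_is_module submodule_tensor_kernel[OF M N],
      folded tensor_def]
  have \<beta>X: "(\<lambda>p. \<beta> (fst p) (snd p)) \<in> ?X \<rightarrow> carrier P"
    using bilinear_closed[OF \<beta>] by auto
  note L = free_lift_linear[OF P \<beta>X]
  have Lgen: "?L (free_gen R (x, y)) = \<beta> x y" if "x \<in> carrier M" "y \<in> carrier N" for x y
    using free_lift_gen[OF P \<beta>X, of "(x, y)"] that by simp
  have g: "free_gen R (x, y) \<in> carrier ?F" if "x \<in> carrier M" "y \<in> carrier N" for x y
    using that by (intro free_gen_closed) simp
  note bc = bilinear_closed[OF \<beta>]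
  note lin = linear_add[OF bilinear_left[OF \<beta>]] linear_add[OF bilinear_right[OF \<beta>]]
    linear_smult[OF bilinear_left[OF \<beta>]] linear_smult[OF bilinear_right[OF \<beta>]]
  have "?L r = \<zero>\<^bsub>P\<^esub>" if "r \<in> tensor_relations R M N" for r
  proof -
    have min: "?L (r \<ominus>\<^bsub>?F\<^esub> s) = \<zero>\<^bsub>P\<^esub>" if "r \<in> carrier ?F" "s \<in> carrier ?F" "?L r = ?L s" for r s
      using linear_minus[OF L F P that(1,2)] that linear_closed[OF L that(1)]
      by (simp add: a_minus_def P.r_neg)
    show ?thesis
      using that unfolding tensor_relations_def Let_def
      by (auto intro!: min F.add.m_closed F.smult_closed g
          simp: linear_add[OF L] linear_smult[OF L] Lgen g lin bc)
  qed
  then have "tensor_relations R M N \<subseteq> {r \<in> carrier ?F. ?L r = \<zero>\<^bsub>P\<^esub>}"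
    using tensor_relations_subset[OF M N] by auto
  then have ker: "?K \<subseteq> {r \<in> carrier ?F. ?L r = \<zero>\<^bsub>P\<^esub>}"
    by (rule tensor_kernel_least[OF M N submodule_kernel[OF L F P]])
  have lift: "tensor_lift R P \<beta> (?K +>\<^bsub>?F\<^esub> r) = ?L r" if r: "r \<in> carrier ?F" for r
  proof -
    have "?L s = ?L r" if "s \<in> ?K +>\<^bsub>?F\<^esub> r" for s
    proof -
      have s: "s \<in> carrier ?F" "s \<ominus>\<^bsub>?F\<^esub> r \<in> ?K" using S(6)[OF r that] by auto
      have "?L s \<ominus>\<^bsub>P\<^esub> ?L r = \<zero>\<^bsub>P\<^esub>"
        using linear_minus[OF L F P s(1) r] s(2) ker by auto
      then show ?thesis
        using linear_closed[OF L r] linear_closed[OF L s(1)]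
          P.minus_equality[of "?L s" "\<ominus>\<^bsub>P\<^esub> ?L r"]
        by (simp add: a_minus_def)
    qed
    then have "?L ` (?K +>\<^bsub>?F\<^esub> r) = {?L r}" using S(5)[OF r] by blast
    then show ?thesis unfolding tensor_lift_def free_lift_def by simp
  qed
  show "tensor_lift R P \<beta> \<in> linear_maps R (M \<boxtimes>[R] N) P"
    by (rule linear_mapsI)
       (auto simp: S(1-3) lift linear_add[OF L] linear_smult[OF L] intro: linear_closed[OF L])
  show "tensor_lift R P \<beta> (pure_tensor R M N x y) = \<beta> x y" if "x \<in> carrier M" "y \<in> carrier N"
    using that by (simp add: pure_tensor_def lift g Lgen)
qed

end

section \<open>Calculating with elements of tensor products\<close>

text \<open>
  In the calculations below every bound variable occurs exactly once in its term, so linearity in it is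
  decided by the syntax. The collection \<open>multilinear\<close> has one introduction rule for each operation and each
  argument that may contain the variable; unification with the pattern of a rule finds this argument.
  The rules that close the other arguments under the operations are part of the collection, so that
  \<open>(assumption | rule multilinear)+\<close> proves the side conditions that arise.
\<close>

named_theorems multilinear

lemma foldSetD_cong:
  assumes "(A, y) \<in> foldSetD D f e" and "\<And>x. x \<in> A \<Longrightarrow> f x = g x"
  shows "(A, y) \<in> foldSetD D g e"
  using assms
proof induction
  case emptyI
  then show ?case by (auto intro: foldSetD.emptyI)
next
  case (insertI x A y)
  then show ?case by (metis foldSetD.insertI insertCI)
qed

text \<open>
  The fold behind \<open>finsum\<close> only looks at values on the index set, so the values need not lie in the
  carrier. Rewriting under \<open>tensor_lift\<close> thereby becomes free of side conditions on the summands.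
\<close>

lemma finsum_cong_pointwise:
  assumes "\<And>x. x \<in> A \<Longrightarrow> f x = g x"
  shows "finsum M f A = finsum M g A"
proof -
  have "foldD D (add M \<circ> f) e A = foldD D (add M \<circ> g) e A" for D e
  proof -
    have "(A, y) \<in> foldSetD D (add M \<circ> f) e \<longleftrightarrow> (A, y) \<in> foldSetD D (add M \<circ> g) e" for y
      using foldSetD_cong[of A y D "add M \<circ> f" e "add M \<circ> g"]
        foldSetD_cong[of A y D "add M \<circ> g" e "add M \<circ> f"] assms by auto
    then show ?thesis unfolding foldD_def by simp
  qed
  then show ?thesis by (simp add: finsum_def finprod_def)
qed

context cring
begin

lemma tensor_lift_cong:
  assumes M: "module R M" and N: "module R N" and t: "t \<in> carrier (M \<boxtimes>[R] N)"
    and eq: "\<And>x y. \<lbrakk>x \<in> carrier M; y \<in> carrier N\<rbrakk> \<Longrightarrow> \<beta> x y = \<gamma> x y"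
  shows "tensor_lift R P \<beta> t = tensor_lift R P \<gamma> t"
proof -
  let ?F = "free_module R (carrier M \<times> carrier N)"
  note S = quotient_module_cosets[OF free_module_is_module submodule_tensor_kernel[OF M N],
      folded tensor_def]
  have "\<beta> (fst p) (snd p) = \<gamma> (fst p) (snd p)" if "r \<in> t" "r p \<noteq> \<zero>" for r p
  proof -
    have "r \<in> carrier ?F" using t that S(6) by (auto simp: S(1))
    then have "p \<in> carrier M \<times> carrier N" using that by (cases p) (auto simp: free_module_simps)
    then show ?thesis using eq by auto
  qed
  then have "(\<lambda>r. \<Oplus>\<^bsub>P\<^esub>p\<in>{p. r p \<noteq> \<zero>}. r p \<odot>\<^bsub>P\<^esub> \<beta> (fst p) (snd p)) ` t
      = (\<lambda>r. \<Oplus>\<^bsub>P\<^esub>p\<in>{p. r p \<noteq> \<zero>}. r p \<odot>\<^bsub>P\<^esub> \<gamma> (fst p) (snd p)) ` t"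
    by (intro image_cong finsum_cong_pointwise) auto
  then show ?thesis by (simp add: tensor_lift_def)
qed

declare tensor_is_module [multilinear] bilinearI [multilinear] linear_ident [multilinear]

lemma scalar_module_is_module [multilinear]: "module R (scalar_module R)"
proof (rule moduleI)
  show "abelian_group (scalar_module R)"
  proof (rule abelian_groupI)
    fix x assume "x \<in> carrier (scalar_module R)"
    then show "\<exists>y\<in>carrier (scalar_module R). y \<oplus>\<^bsub>scalar_module R\<^esub> x = \<zero>\<^bsub>scalar_module R\<^esub>"
      by (intro bexI[of _ "\<ominus> x"]) (simp_all add: scalar_module_def l_neg)
  qed (simp_all add: scalar_module_def a_ac)
qed (simp_all add: scalar_module_def is_cring l_distr r_distr m_assoc)

lemma pure_tensor_closed [multilinear]:
  assumes "module R M" and "module R N" and "x \<in> carrier M" and "y \<in> carrier N"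
  shows "pure_tensor R M N x y \<in> carrier (M \<boxtimes>[R] N)"
  by (rule bilinear_closed[OF pure_tensor_bilinear]) (fact assms)+

lemma tensor_lift_closed [multilinear]:
  assumes "t \<in> carrier (M \<boxtimes>[R] N)" and "module R M" and "module R N" and "module R P"
    and "(\<lambda>x y. \<beta> x y) \<in> bilinear_maps R M N P"
  shows "tensor_lift R P (\<lambda>x y. \<beta> x y) t \<in> carrier P"
  by (rule linear_closed[OF tensor_lift_linear]) (fact assms)+

lemma linear_pure_tensor_left [multilinear]:
  assumes "module R M" and "module R N" and "y \<in> carrier N" and "(\<lambda>x. f x) \<in> linear_maps R X M"
  shows "(\<lambda>x. pure_tensor R M N (f x) y) \<in> linear_maps R X (M \<boxtimes>[R] N)"
  using assms by (intro linear_comp[OF bilinear_left[OF pure_tensor_bilinear]])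

lemma linear_pure_tensor_right [multilinear]:
  assumes "module R M" and "module R N" and "x \<in> carrier M" and "(\<lambda>y. f y) \<in> linear_maps R X N"
  shows "(\<lambda>y. pure_tensor R M N x (f y)) \<in> linear_maps R X (M \<boxtimes>[R] N)"
  using assms by (intro linear_comp[OF bilinear_right[OF pure_tensor_bilinear]])

lemma linear_tensor_lift_arg [multilinear]:
  assumes "(\<lambda>x. f x) \<in> linear_maps R X (M \<boxtimes>[R] N)"
    and "module R M" and "module R N" and "module R P" and "(\<lambda>x y. \<beta> x y) \<in> bilinear_maps R M N P"
  shows "(\<lambda>x. tensor_lift R P (\<lambda>x y. \<beta> x y) (f x)) \<in> linear_maps R X P"
  using assms by (intro linear_comp[OF tensor_lift_linear])


lemma linear_sum:
  assumes f: "f \<in> linear_maps R M N" and g: "g \<in> linear_maps R M N" and N: "module R N"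
  shows "(\<lambda>x. f x \<oplus>\<^bsub>N\<^esub> g x) \<in> linear_maps R M N"
proof -
  interpret N: module R N by fact
  note c = linear_closed[OF f] linear_closed[OF g]
  show ?thesis
    by (rule linear_mapsI)
       (simp_all add: c linear_add[OF f] linear_add[OF g] linear_smult[OF f] linear_smult[OF g]
          N.smult_r_distr N.a_ac)
qed

lemma linear_scale:
  assumes f: "f \<in> linear_maps R M N" and a: "a \<in> carrier R" and N: "module R N"
  shows "(\<lambda>x. a \<odot>\<^bsub>N\<^esub> f x) \<in> linear_maps R M N"
proof -
  interpret N: module R N by fact
  note c = linear_closed[OF f]
  have "a \<odot>\<^bsub>N\<^esub> (b \<odot>\<^bsub>N\<^esub> y) = b \<odot>\<^bsub>N\<^esub> (a \<odot>\<^bsub>N\<^esub> y)" if "b \<in> carrier R" "y \<in> carrier N" for b y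
    using that a by (simp add: N.smult_assoc1[symmetric] m_comm)
  then show ?thesis
    using a by (intro linear_mapsI)
      (simp_all add: c linear_add[OF f] linear_smult[OF f] N.smult_r_distr)
qed

text \<open>
  Linearity in a variable that occurs in the summand and not in the tensor: the identities to be shown
  are, for a fixed argument, equations of linear maps in \<open>t\<close>, and hold for pure \<open>t\<close>.
\<close>

lemma linear_tensor_lift_fun [multilinear]:
  fixes P :: "('a, 'p, 'z) module_scheme"
  assumes t: "t \<in> carrier (M \<boxtimes>[R] N)" and M: "module R M" and N: "module R N" and P: "module R P"
    and X: "module R X"
    and \<beta>: "\<And>x. x \<in> carrier X \<Longrightarrow> (\<lambda>u v. \<beta> x u v) \<in> bilinear_maps R M N P"
    and lin: "\<And>u v. \<lbrakk>u \<in> carrier M; v \<in> carrier N\<rbrakk> \<Longrightarrow> (\<lambda>x. \<beta> x u v) \<in> linear_maps R X P"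
  shows "(\<lambda>x. tensor_lift R P (\<lambda>u v. \<beta> x u v) t) \<in> linear_maps R X P"
proof -
  interpret X: module R X by fact
  note L = tensor_lift_linear[OF M N P \<beta>]
  note pure = tensor_lift_pure[OF M N P \<beta>]
  show ?thesis
  proof (rule linear_mapsI)
    fix x assume "x \<in> carrier X"
    from linear_closed[OF L[OF this] t] show "tensor_lift R P (\<beta> x) t \<in> carrier P" .
  next
    fix x y assume x: "x \<in> carrier X" and y: "y \<in> carrier X"
    then have xy: "x \<oplus>\<^bsub>X\<^esub> y \<in> carrier X" by simp
    show "tensor_lift R P (\<beta> (x \<oplus>\<^bsub>X\<^esub> y)) t = tensor_lift R P (\<beta> x) t \<oplus>\<^bsub>P\<^esub> tensor_lift R P (\<beta> y) t"
      by (rule tensor_ext[OF M N P L[OF xy] linear_sum[OF L[OF x] L[OF y] P] _ t])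
         (simp add: pure x y xy linear_add[OF lin])
  next
    fix a x assume a: "a \<in> carrier R" and x: "x \<in> carrier X"
    then have ax: "a \<odot>\<^bsub>X\<^esub> x \<in> carrier X" by simp
    show "tensor_lift R P (\<beta> (a \<odot>\<^bsub>X\<^esub> x)) t = a \<odot>\<^bsub>P\<^esub> tensor_lift R P (\<beta> x) t"
      by (rule tensor_ext[OF M N P L[OF ax] linear_scale[OF L[OF x] a P] _ t])
         (simp add: pure a x ax linear_smult[OF lin])
  qed
qed

lemma tensor_lift_hom:
  fixes P :: "('a, 'p, 'z) module_scheme" and Q :: "('a, 'q, 'w) module_scheme"
  assumes f: "f \<in> linear_maps R P Q" and t: "t \<in> carrier (M \<boxtimes>[R] N)"
    and M: "module R M" and N: "module R N" and P: "module R P" and Q: "module R Q"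
    and \<beta>: "(\<lambda>x y. \<beta> x y) \<in> bilinear_maps R M N P"
  shows "f (tensor_lift R P (\<lambda>x y. \<beta> x y) t) = tensor_lift R Q (\<lambda>x y. f (\<beta> x y)) t"
proof -
  have f\<beta>: "(\<lambda>x y. f (\<beta> x y)) \<in> bilinear_maps R M N Q"
    using bilinear_left[OF \<beta>] bilinear_right[OF \<beta>] by (intro bilinearI linear_comp[OF f])
  show ?thesis
    by (rule tensor_ext[OF M N Q linear_comp[OF f tensor_lift_linear[OF M N P \<beta>]]
          tensor_lift_linear[OF M N Q f\<beta>] _ t])
       (simp add: tensor_lift_pure[OF M N P \<beta>] tensor_lift_pure[OF M N Q f\<beta>])
qed

text \<open>
  Both sides are linear in \<open>s\<close>, and for a pure tensor \<open>s\<close> both are the inner sum over \<open>t\<close>.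
\<close>

lemma tensor_lift_swap:
  fixes P :: "('a, 'p, 'z) module_scheme"
  assumes s: "s \<in> carrier (A \<boxtimes>[R] B)" and t: "t \<in> carrier (C \<boxtimes>[R] D)"
    and A: "module R A" and B: "module R B" and C: "module R C" and D: "module R D"
    and P: "module R P"
    and st: "\<And>x y. \<lbrakk>x \<in> carrier A; y \<in> carrier B\<rbrakk> \<Longrightarrow> (\<lambda>u v. \<beta> x y u v) \<in> bilinear_maps R C D P"
    and ts: "\<And>u v. \<lbrakk>u \<in> carrier C; v \<in> carrier D\<rbrakk> \<Longrightarrow> (\<lambda>x y. \<beta> x y u v) \<in> bilinear_maps R A B P"
  shows "tensor_lift R P (\<lambda>x y. tensor_lift R P (\<lambda>u v. \<beta> x y u v) t) s
    = tensor_lift R P (\<lambda>u v. tensor_lift R P (\<lambda>x y. \<beta> x y u v) s) t"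
proof -
  note lin = bilinear_left[OF st] bilinear_right[OF st] bilinear_left[OF ts] bilinear_right[OF ts]
  have inner: "(\<lambda>x y. tensor_lift R P (\<lambda>u v. \<beta> x y u v) t) \<in> bilinear_maps R A B P"
    by (assumption | rule multilinear s t A B C D P lin)+
  have outer: "(\<lambda>u v. tensor_lift R P (\<lambda>x y. \<beta> x y u v) s) \<in> bilinear_maps R C D P"
    if "s \<in> carrier (A \<boxtimes>[R] B)" for s
    by (assumption | rule multilinear that t A B C D P lin)+
  show ?thesis
  proof (rule tensor_ext[OF A B P tensor_lift_linear[OF A B P inner] _ _ s])
    show "(\<lambda>s. tensor_lift R P (\<lambda>u v. tensor_lift R P (\<lambda>x y. \<beta> x y u v) s) t)
        \<in> linear_maps R (A \<boxtimes>[R] B) P"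
      by (assumption | rule multilinear t A B C D P lin)+
    fix x y assume x: "x \<in> carrier A" and y: "y \<in> carrier B"
    show "tensor_lift R P (\<lambda>x y. tensor_lift R P (\<lambda>u v. \<beta> x y u v) t) (pure_tensor R A B x y)
        = tensor_lift R P (\<lambda>u v. tensor_lift R P (\<lambda>x y. \<beta> x y u v) (pure_tensor R A B x y)) t"
      unfolding tensor_lift_pure[OF A B P inner x y]
      by (rule tensor_lift_cong[OF C D t]) (simp add: tensor_lift_pure[OF A B P ts] x y)
  qed
qed

lemma tensor_lift_pure_self:
  assumes M: "module R M" and N: "module R N" and t: "t \<in> carrier (M \<boxtimes>[R] N)"
  shows "tensor_lift R (M \<boxtimes>[R] N) (\<lambda>x y. pure_tensor R M N x y) t = t"
  by (rule tensor_ext[OF M N tensor_is_module[OF M N] _ linear_ident _ t])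
     (use pure_tensor_bilinear[OF M N] M N in
       \<open>auto simp: tensor_lift_pure tensor_is_module intro!: tensor_lift_linear\<close>)

end

section \<open>The structural maps\<close>

lemma linear_o:
  assumes "f \<in> linear_maps R N P" and "g \<in> linear_maps R M N"
  shows "f \<circ> g \<in> linear_maps R M P"
  using linear_comp[OF assms] by (simp add: comp_def)

lemma linear_id: "id \<in> linear_maps R M M"
  by (simp add: linear_maps_def)

context cring
begin

lemma
  assumes M: "module R M" and N: "module R N" and P: "module R P" and Q: "module R Q"
    and f: "f \<in> linear_maps R M P" and g: "g \<in> linear_maps R N Q"
  shows linear_tensor_map: "tensor_map R P Q f g \<in> linear_maps R (M \<boxtimes>[R] N) (P \<boxtimes>[R] Q)"
    and tensor_map_pure: "\<lbrakk>x \<in> carrier M; y \<in> carrier N\<rbrakk>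
      \<Longrightarrow> tensor_map R P Q f g (pure_tensor R M N x y) = pure_tensor R P Q (f x) (g y)"
proof -
  have \<beta>: "(\<lambda>x y. pure_tensor R P Q (f x) (g y)) \<in> bilinear_maps R M N (P \<boxtimes>[R] Q)"
    by (assumption | rule multilinear assms linear_comp[OF f] linear_comp[OF g]
        linear_closed[OF f] linear_closed[OF g])+
  show "tensor_map R P Q f g \<in> linear_maps R (M \<boxtimes>[R] N) (P \<boxtimes>[R] Q)"
    unfolding tensor_map_def by (rule tensor_lift_linear[OF M N tensor_is_module[OF P Q] \<beta>])
  show "tensor_map R P Q f g (pure_tensor R M N x y) = pure_tensor R P Q (f x) (g y)"
    if "x \<in> carrier M" "y \<in> carrier N"
    unfolding tensor_map_def by (rule tensor_lift_pure[OF M N tensor_is_module[OF P Q] \<beta> that])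
qed

lemma
  assumes M: "module R M" and N: "module R N"
  shows linear_tensor_flip: "tensor_flip R M N \<in> linear_maps R (M \<boxtimes>[R] N) (N \<boxtimes>[R] M)"
    and tensor_flip_pure: "\<lbrakk>x \<in> carrier M; y \<in> carrier N\<rbrakk>
      \<Longrightarrow> tensor_flip R M N (pure_tensor R M N x y) = pure_tensor R N M y x"
proof -
  have \<beta>: "(\<lambda>x y. pure_tensor R N M y x) \<in> bilinear_maps R M N (N \<boxtimes>[R] M)"
    by (assumption | rule multilinear assms)+
  show "tensor_flip R M N \<in> linear_maps R (M \<boxtimes>[R] N) (N \<boxtimes>[R] M)"
    unfolding tensor_flip_def by (rule tensor_lift_linear[OF M N tensor_is_module[OF N M] \<beta>])
  show "tensor_flip R M N (pure_tensor R M N x y) = pure_tensor R N M y x"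
    if "x \<in> carrier M" "y \<in> carrier N"
    unfolding tensor_flip_def by (rule tensor_lift_pure[OF M N tensor_is_module[OF N M] \<beta> that])
qed

lemma
  assumes A: "module R A" and B: "module R B" and C: "module R C"
  shows linear_tensor_assoc:
      "tensor_assoc R A B C \<in> linear_maps R ((A \<boxtimes>[R] B) \<boxtimes>[R] C) (A \<boxtimes>[R] (B \<boxtimes>[R] C))"
    and tensor_assoc_pure_right: "\<lbrakk>t \<in> carrier (A \<boxtimes>[R] B); z \<in> carrier C\<rbrakk>
      \<Longrightarrow> tensor_assoc R A B C (pure_tensor R (A \<boxtimes>[R] B) C t z)
        = tensor_lift R (A \<boxtimes>[R] (B \<boxtimes>[R] C))
            (\<lambda>x y. pure_tensor R A (B \<boxtimes>[R] C) x (pure_tensor R B C y z)) t"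
    and tensor_assoc_pure: "\<lbrakk>x \<in> carrier A; y \<in> carrier B; z \<in> carrier C\<rbrakk>
      \<Longrightarrow> tensor_assoc R A B C (pure_tensor R (A \<boxtimes>[R] B) C (pure_tensor R A B x y) z)
        = pure_tensor R A (B \<boxtimes>[R] C) x (pure_tensor R B C y z)"
proof -
  note AB = tensor_is_module[OF A B] and ABC = tensor_is_module[OF A tensor_is_module[OF B C]]
  have \<beta>: "(\<lambda>x y. pure_tensor R A (B \<boxtimes>[R] C) x (pure_tensor R B C y z))
      \<in> bilinear_maps R A B (A \<boxtimes>[R] (B \<boxtimes>[R] C))" if "z \<in> carrier C" for z
    by (assumption | rule multilinear assms that)+
  have \<gamma>: "(\<lambda>t z. tensor_lift R (A \<boxtimes>[R] (B \<boxtimes>[R] C))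
        (\<lambda>x y. pure_tensor R A (B \<boxtimes>[R] C) x (pure_tensor R B C y z)) t)
      \<in> bilinear_maps R (A \<boxtimes>[R] B) C (A \<boxtimes>[R] (B \<boxtimes>[R] C))"
    by (assumption | rule multilinear assms)+
  show "tensor_assoc R A B C \<in> linear_maps R ((A \<boxtimes>[R] B) \<boxtimes>[R] C) (A \<boxtimes>[R] (B \<boxtimes>[R] C))"
    unfolding tensor_assoc_def by (rule tensor_lift_linear[OF AB C ABC \<gamma>])
  show *: "tensor_assoc R A B C (pure_tensor R (A \<boxtimes>[R] B) C t z)
      = tensor_lift R (A \<boxtimes>[R] (B \<boxtimes>[R] C))
          (\<lambda>x y. pure_tensor R A (B \<boxtimes>[R] C) x (pure_tensor R B C y z)) t"
    if "t \<in> carrier (A \<boxtimes>[R] B)" "z \<in> carrier C" for t z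
    unfolding tensor_assoc_def by (rule tensor_lift_pure[OF AB C ABC \<gamma> that])
  show "tensor_assoc R A B C (pure_tensor R (A \<boxtimes>[R] B) C (pure_tensor R A B x y) z)
      = pure_tensor R A (B \<boxtimes>[R] C) x (pure_tensor R B C y z)"
    if "x \<in> carrier A" "y \<in> carrier B" "z \<in> carrier C"
    using that A B by (simp add: * pure_tensor_closed tensor_lift_pure[OF A B ABC \<beta>])
qed

lemma
  assumes A: "module R A" and B: "module R B" and C: "module R C"
  shows linear_tensor_assoc_inv:
      "tensor_assoc_inv R A B C \<in> linear_maps R (A \<boxtimes>[R] (B \<boxtimes>[R] C)) ((A \<boxtimes>[R] B) \<boxtimes>[R] C)"
    and tensor_assoc_inv_pure: "\<lbrakk>x \<in> carrier A; y \<in> carrier B; z \<in> carrier C\<rbrakk>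
      \<Longrightarrow> tensor_assoc_inv R A B C (pure_tensor R A (B \<boxtimes>[R] C) x (pure_tensor R B C y z))
        = pure_tensor R (A \<boxtimes>[R] B) C (pure_tensor R A B x y) z"
proof -
  note BC = tensor_is_module[OF B C] and ABC = tensor_is_module[OF tensor_is_module[OF A B] C]
  have \<beta>: "(\<lambda>y z. pure_tensor R (A \<boxtimes>[R] B) C (pure_tensor R A B x y) z)
      \<in> bilinear_maps R B C ((A \<boxtimes>[R] B) \<boxtimes>[R] C)" if "x \<in> carrier A" for x
    by (assumption | rule multilinear assms that)+
  have \<gamma>: "(\<lambda>x t. tensor_lift R ((A \<boxtimes>[R] B) \<boxtimes>[R] C)
        (\<lambda>y z. pure_tensor R (A \<boxtimes>[R] B) C (pure_tensor R A B x y) z) t)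
      \<in> bilinear_maps R A (B \<boxtimes>[R] C) ((A \<boxtimes>[R] B) \<boxtimes>[R] C)"
    by (assumption | rule multilinear assms)+
  show "tensor_assoc_inv R A B C \<in> linear_maps R (A \<boxtimes>[R] (B \<boxtimes>[R] C)) ((A \<boxtimes>[R] B) \<boxtimes>[R] C)"
    unfolding tensor_assoc_inv_def by (rule tensor_lift_linear[OF A BC ABC \<gamma>])
  show "tensor_assoc_inv R A B C (pure_tensor R A (B \<boxtimes>[R] C) x (pure_tensor R B C y z))
      = pure_tensor R (A \<boxtimes>[R] B) C (pure_tensor R A B x y) z"
    if "x \<in> carrier A" "y \<in> carrier B" "z \<in> carrier C"
    unfolding tensor_assoc_inv_def
    using that B C
    by (simp add: tensor_lift_pure[OF A BC ABC \<gamma>] pure_tensor_closed tensor_lift_pure[OF B C ABC \<beta>])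
qed

lemma
  assumes M: "module R M"
  shows linear_tensor_lunit: "tensor_lunit R M \<in> linear_maps R (scalar_module R \<boxtimes>[R] M) M"
    and tensor_lunit_pure: "\<lbrakk>a \<in> carrier (scalar_module R); x \<in> carrier M\<rbrakk>
      \<Longrightarrow> tensor_lunit R M (pure_tensor R (scalar_module R) M a x) = a \<odot>\<^bsub>M\<^esub> x"
    and linear_tensor_runit: "tensor_runit R M \<in> linear_maps R (M \<boxtimes>[R] scalar_module R) M"
    and tensor_runit_pure: "\<lbrakk>a \<in> carrier (scalar_module R); x \<in> carrier M\<rbrakk>
      \<Longrightarrow> tensor_runit R M (pure_tensor R M (scalar_module R) x a) = a \<odot>\<^bsub>M\<^esub> x"
    and smult_bilinear: "(\<lambda>a x. a \<odot>\<^bsub>M\<^esub> x) \<in> bilinear_maps R (scalar_module R) M M"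
proof -
  interpret M: module R M by fact
  have l: "(\<lambda>x. a \<odot>\<^bsub>M\<^esub> x) \<in> linear_maps R M M" if "a \<in> carrier (scalar_module R)" for a
    using linear_scale[OF linear_ident _ M] that by (simp add: scalar_module_def)
  have r: "(\<lambda>a. a \<odot>\<^bsub>M\<^esub> x) \<in> linear_maps R (scalar_module R) M" if "x \<in> carrier M" for x
    using that by (intro linear_mapsI) (simp_all add: scalar_module_def M.smult_l_distr M.smult_assoc1)
  show \<beta>: "(\<lambda>a x. a \<odot>\<^bsub>M\<^esub> x) \<in> bilinear_maps R (scalar_module R) M M"
    by (intro bilinearI l r)
  have \<gamma>: "(\<lambda>x a. a \<odot>\<^bsub>M\<^esub> x) \<in> bilinear_maps R M (scalar_module R) M"
    by (intro bilinearI l r)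
  show "tensor_lunit R M \<in> linear_maps R (scalar_module R \<boxtimes>[R] M) M"
    unfolding tensor_lunit_def by (rule tensor_lift_linear[OF scalar_module_is_module M M \<beta>])
  show "tensor_runit R M \<in> linear_maps R (M \<boxtimes>[R] scalar_module R) M"
    unfolding tensor_runit_def by (rule tensor_lift_linear[OF M scalar_module_is_module M \<gamma>])
  assume a: "a \<in> carrier (scalar_module R)" and x: "x \<in> carrier M"
  show "tensor_lunit R M (pure_tensor R (scalar_module R) M a x) = a \<odot>\<^bsub>M\<^esub> x"
    unfolding tensor_lunit_def by (rule tensor_lift_pure[OF scalar_module_is_module M M \<beta> a x])
  show "tensor_runit R M (pure_tensor R M (scalar_module R) x a) = a \<odot>\<^bsub>M\<^esub> x"
    unfolding tensor_runit_def by (rule tensor_lift_pure[OF M scalar_module_is_module M \<gamma> x a])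
qed

lemma linear_smult_left [multilinear]:
  assumes "module R M" and "x \<in> carrier M" and "(\<lambda>a. f a) \<in> linear_maps R X (scalar_module R)"
  shows "(\<lambda>a. f a \<odot>\<^bsub>M\<^esub> x) \<in> linear_maps R X M"
  using assms by (intro linear_comp[OF bilinear_left[OF smult_bilinear]])

lemma linear_smult_right [multilinear]:
  assumes "module R M" and "a \<in> carrier (scalar_module R)" and "(\<lambda>x. f x) \<in> linear_maps R X M"
  shows "(\<lambda>x. a \<odot>\<^bsub>M\<^esub> f x) \<in> linear_maps R X M"
  using assms by (intro linear_comp[OF bilinear_right[OF smult_bilinear]])

lemma smult_scalar_closed [multilinear]:
  assumes "module R M" and "a \<in> carrier (scalar_module R)" and "x \<in> carrier M"
  shows "a \<odot>\<^bsub>M\<^esub> x \<in> carrier M"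
  using assms by (intro bilinear_closed[OF smult_bilinear])

lemma
  assumes A: "module R A" and B: "module R B" and C: "module R C" and D: "module R D"
  shows linear_middle_flip: "middle_flip R A B C D
      \<in> linear_maps R ((A \<boxtimes>[R] B) \<boxtimes>[R] (C \<boxtimes>[R] D)) ((A \<boxtimes>[R] C) \<boxtimes>[R] (B \<boxtimes>[R] D))"
    and middle_flip_pure: "\<lbrakk>a \<in> carrier A; b \<in> carrier B; c \<in> carrier C; d \<in> carrier D\<rbrakk>
      \<Longrightarrow> middle_flip R A B C D
          (pure_tensor R (A \<boxtimes>[R] B) (C \<boxtimes>[R] D) (pure_tensor R A B a b) (pure_tensor R C D c d))
        = pure_tensor R (A \<boxtimes>[R] C) (B \<boxtimes>[R] D) (pure_tensor R A C a c) (pure_tensor R B D b d)"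
proof -
  note lin = linear_o linear_tensor_assoc linear_tensor_assoc_inv linear_tensor_map
    linear_tensor_flip linear_id tensor_is_module A B C D
  have inner: "tensor_assoc R C B D \<circ> tensor_map R (C \<boxtimes>[R] B) D (tensor_flip R B C) id
      \<circ> tensor_assoc_inv R B C D
      \<in> linear_maps R (B \<boxtimes>[R] (C \<boxtimes>[R] D)) (C \<boxtimes>[R] (B \<boxtimes>[R] D))"
    by (rule lin)+
  show "middle_flip R A B C D
      \<in> linear_maps R ((A \<boxtimes>[R] B) \<boxtimes>[R] (C \<boxtimes>[R] D)) ((A \<boxtimes>[R] C) \<boxtimes>[R] (B \<boxtimes>[R] D))"
    unfolding middle_flip_def by (rule lin)+
  assume "a \<in> carrier A" "b \<in> carrier B" "c \<in> carrier C" "d \<in> carrier D"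
  then show "middle_flip R A B C D
        (pure_tensor R (A \<boxtimes>[R] B) (C \<boxtimes>[R] D) (pure_tensor R A B a b) (pure_tensor R C D c d))
      = pure_tensor R (A \<boxtimes>[R] C) (B \<boxtimes>[R] D) (pure_tensor R A C a c) (pure_tensor R B D b d)"
    using A B C D inner
    by (simp add: middle_flip_def tensor_assoc_pure tensor_is_module pure_tensor_closed
        tensor_map_pure linear_id tensor_assoc_inv_pure linear_tensor_flip tensor_flip_pure)
qed

lemma tensor_ext_left:
  fixes P :: "('a, 'p, 'z) module_scheme"
  assumes A: "module R A" and B: "module R B" and C: "module R C" and P: "module R P"
    and f: "f \<in> linear_maps R ((A \<boxtimes>[R] B) \<boxtimes>[R] C) P"
    and g: "g \<in> linear_maps R ((A \<boxtimes>[R] B) \<boxtimes>[R] C) P"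
    and eq: "\<And>a b c. \<lbrakk>a \<in> carrier A; b \<in> carrier B; c \<in> carrier C\<rbrakk>
      \<Longrightarrow> f (pure_tensor R (A \<boxtimes>[R] B) C (pure_tensor R A B a b) c)
        = g (pure_tensor R (A \<boxtimes>[R] B) C (pure_tensor R A B a b) c)"
    and t: "t \<in> carrier ((A \<boxtimes>[R] B) \<boxtimes>[R] C)"
  shows "f t = g t"
proof (rule tensor_ext[OF tensor_is_module[OF A B] C P f g _ t])
  fix s c assume s: "s \<in> carrier (A \<boxtimes>[R] B)" and c: "c \<in> carrier C"
  show "f (pure_tensor R (A \<boxtimes>[R] B) C s c) = g (pure_tensor R (A \<boxtimes>[R] B) C s c)"
    by (rule tensor_ext[OF A B P _ _ _ s])
       (assumption | rule eq multilinear A B C P c linear_comp[OF f] linear_comp[OF g])+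
qed

lemma tensor_ext_both:
  fixes P :: "('a, 'p, 'z) module_scheme"
  assumes A: "module R A" and B: "module R B" and C: "module R C" and D: "module R D"
    and P: "module R P"
    and f: "f \<in> linear_maps R ((A \<boxtimes>[R] B) \<boxtimes>[R] (C \<boxtimes>[R] D)) P"
    and g: "g \<in> linear_maps R ((A \<boxtimes>[R] B) \<boxtimes>[R] (C \<boxtimes>[R] D)) P"
    and eq: "\<And>a b c d. \<lbrakk>a \<in> carrier A; b \<in> carrier B; c \<in> carrier C; d \<in> carrier D\<rbrakk>
      \<Longrightarrow> f (pure_tensor R (A \<boxtimes>[R] B) (C \<boxtimes>[R] D) (pure_tensor R A B a b) (pure_tensor R C D c d))
        = g (pure_tensor R (A \<boxtimes>[R] B) (C \<boxtimes>[R] D) (pure_tensor R A B a b) (pure_tensor R C D c d))"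
    and t: "t \<in> carrier ((A \<boxtimes>[R] B) \<boxtimes>[R] (C \<boxtimes>[R] D))"
  shows "f t = g t"
proof (rule tensor_ext_left[OF A B tensor_is_module[OF C D] P f g _ t])
  fix a b s assume a: "a \<in> carrier A" and b: "b \<in> carrier B" and s: "s \<in> carrier (C \<boxtimes>[R] D)"
  show "f (pure_tensor R (A \<boxtimes>[R] B) (C \<boxtimes>[R] D) (pure_tensor R A B a b) s)
      = g (pure_tensor R (A \<boxtimes>[R] B) (C \<boxtimes>[R] D) (pure_tensor R A B a b) s)"
    by (rule tensor_ext[OF C D P _ _ _ s])
       (assumption | rule eq multilinear A B C D P a b linear_comp[OF f] linear_comp[OF g])+
qed

text \<open>
  The comultiplications and coactions feed non-pure tensors into \<open>middle_flip\<close>. Its value there is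
  determined by the values on quadruples of elements, since both sides are bilinear in \<open>s\<close> and \<open>t\<close>.
\<close>

lemma middle_flip_lift:
  assumes A: "module R A" and B: "module R B" and C: "module R C" and D: "module R D"
    and s: "s \<in> carrier (A \<boxtimes>[R] B)" and t: "t \<in> carrier (C \<boxtimes>[R] D)"
  shows "middle_flip R A B C D (pure_tensor R (A \<boxtimes>[R] B) (C \<boxtimes>[R] D) s t)
    = tensor_lift R ((A \<boxtimes>[R] C) \<boxtimes>[R] (B \<boxtimes>[R] D)) (\<lambda>a b.
        tensor_lift R ((A \<boxtimes>[R] C) \<boxtimes>[R] (B \<boxtimes>[R] D)) (\<lambda>c d.
          pure_tensor R (A \<boxtimes>[R] C) (B \<boxtimes>[R] D) (pure_tensor R A C a c) (pure_tensor R B D b d)) t) s"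
proof -
  let ?P = "(A \<boxtimes>[R] C) \<boxtimes>[R] (B \<boxtimes>[R] D)"
  let ?\<beta> = "\<lambda>a b c d. pure_tensor R (A \<boxtimes>[R] C) (B \<boxtimes>[R] D) (pure_tensor R A C a c) (pure_tensor R B D b d)"
  let ?\<gamma> = "\<lambda>t a b. tensor_lift R ?P (?\<beta> a b) t"
  let ?\<phi> = "\<lambda>s t. tensor_lift R ?P (?\<gamma> t) s"
  have P: "module R ?P" by (rule multilinear A B C D)+
  have \<beta>: "?\<beta> a b \<in> bilinear_maps R C D ?P" if "a \<in> carrier A" "b \<in> carrier B" for a b
    by (assumption | rule multilinear that A B C D)+
  have \<gamma>: "?\<gamma> t \<in> bilinear_maps R A B ?P" if "t \<in> carrier (C \<boxtimes>[R] D)" for t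
    by (assumption | rule multilinear that A B C D)+
  have \<phi>: "?\<phi> \<in> bilinear_maps R (A \<boxtimes>[R] B) (C \<boxtimes>[R] D) ?P"
    by (assumption | rule multilinear A B C D)+
  note AB = tensor_is_module[OF A B] and CD = tensor_is_module[OF C D]
  have st: "pure_tensor R (A \<boxtimes>[R] B) (C \<boxtimes>[R] D) s t \<in> carrier ((A \<boxtimes>[R] B) \<boxtimes>[R] (C \<boxtimes>[R] D))"
    by (rule pure_tensor_closed[OF AB CD s t])
  have "middle_flip R A B C D (pure_tensor R (A \<boxtimes>[R] B) (C \<boxtimes>[R] D) s t)
      = tensor_lift R ?P ?\<phi> (pure_tensor R (A \<boxtimes>[R] B) (C \<boxtimes>[R] D) s t)"
  proof (rule tensor_ext_both[OF A B C D P linear_middle_flip[OF A B C D]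
        tensor_lift_linear[OF AB CD P \<phi>] _ st])
    fix a b c d
    assume "a \<in> carrier A" "b \<in> carrier B" "c \<in> carrier C" "d \<in> carrier D"
    then show "middle_flip R A B C D
          (pure_tensor R (A \<boxtimes>[R] B) (C \<boxtimes>[R] D) (pure_tensor R A B a b) (pure_tensor R C D c d))
        = tensor_lift R ?P ?\<phi>
          (pure_tensor R (A \<boxtimes>[R] B) (C \<boxtimes>[R] D) (pure_tensor R A B a b) (pure_tensor R C D c d))"
      by (simp add: middle_flip_pure[OF A B C D] tensor_lift_pure[OF AB CD P \<phi>]
          pure_tensor_closed[OF A B] pure_tensor_closed[OF C D]
          tensor_lift_pure[OF A B P \<gamma>] tensor_lift_pure[OF C D P \<beta>])
  qed
  also have "\<dots> = ?\<phi> s t" by (rule tensor_lift_pure[OF AB CD P \<phi> s t])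
  finally show ?thesis .
qed

text \<open>
  The common shape of the product on \<open>H \<otimes> H\<close>, of the tensor product coaction and of the right-hand side of
  the compatibility condition.
\<close>

lemma tensor_map_middle_flip:
  fixes P :: "('a, 'p, 'x) module_scheme" and Q :: "('a, 'q, 'y) module_scheme"
  assumes A: "module R A" and B: "module R B" and C: "module R C" and D: "module R D"
    and P: "module R P" and Q: "module R Q"
    and f: "f \<in> linear_maps R (A \<boxtimes>[R] C) P" and g: "g \<in> linear_maps R (B \<boxtimes>[R] D) Q"
    and s: "s \<in> carrier (A \<boxtimes>[R] B)" and t: "t \<in> carrier (C \<boxtimes>[R] D)"
  shows "tensor_map R P Q f g (middle_flip R A B C D (pure_tensor R (A \<boxtimes>[R] B) (C \<boxtimes>[R] D) s t))
    = tensor_lift R (P \<boxtimes>[R] Q) (\<lambda>a b. tensor_lift R (P \<boxtimes>[R] Q) (\<lambda>c d.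
        pure_tensor R P Q (f (pure_tensor R A C a c)) (g (pure_tensor R B D b d))) t) s"
proof -
  note modules = multilinear A B C D P Q
  let ?P = "(A \<boxtimes>[R] C) \<boxtimes>[R] (B \<boxtimes>[R] D)"
  have AC: "module R (A \<boxtimes>[R] C)" and BD: "module R (B \<boxtimes>[R] D)" by (rule modules)+
  note fg = linear_tensor_map[OF AC BD P Q f g]
  have "tensor_map R P Q f g (middle_flip R A B C D (pure_tensor R (A \<boxtimes>[R] B) (C \<boxtimes>[R] D) s t))
      = tensor_map R P Q f g (tensor_lift R ?P (\<lambda>a b. tensor_lift R ?P (\<lambda>c d.
          pure_tensor R (A \<boxtimes>[R] C) (B \<boxtimes>[R] D) (pure_tensor R A C a c) (pure_tensor R B D b d)) t) s)"
    by (simp only: middle_flip_lift[OF A B C D s t])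
  also have "\<dots> = tensor_lift R (P \<boxtimes>[R] Q) (\<lambda>a b. tensor_map R P Q f g (tensor_lift R ?P (\<lambda>c d.
          pure_tensor R (A \<boxtimes>[R] C) (B \<boxtimes>[R] D) (pure_tensor R A C a c) (pure_tensor R B D b d)) t)) s"
    by (rule tensor_lift_hom[OF fg s]) (assumption | rule modules t)+
  also have "\<dots> = tensor_lift R (P \<boxtimes>[R] Q) (\<lambda>a b. tensor_lift R (P \<boxtimes>[R] Q) (\<lambda>c d.
          tensor_map R P Q f g (pure_tensor R (A \<boxtimes>[R] C) (B \<boxtimes>[R] D)
            (pure_tensor R A C a c) (pure_tensor R B D b d))) t) s"
    by (rule tensor_lift_cong[OF A B s], rule tensor_lift_hom[OF fg t]) (assumption | rule modules)+
  also have "\<dots> = tensor_lift R (P \<boxtimes>[R] Q) (\<lambda>a b. tensor_lift R (P \<boxtimes>[R] Q) (\<lambda>c d.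
        pure_tensor R P Q (f (pure_tensor R A C a c)) (g (pure_tensor R B D b d))) t) s"
    by (rule tensor_lift_cong[OF A B s], rule tensor_lift_cong[OF C D t])
       (simp add: tensor_map_pure[OF AC BD P Q f g] pure_tensor_closed A B C D)
  finally show ?thesis .
qed

end

section \<open>Actions, coactions and compatibility evaluated on elements\<close>

context cring
begin

text \<open>
  Both axioms of an action are equations of linear maps, hence may be tested on pure tensors. The unit
  axiom involves \<open>\<eta> r\<close> for all scalars \<open>r\<close>, but \<open>\<eta> r = r \<eta>(1)\<close>.
\<close>

lemma left_actionI:
  fixes M :: "('a, 'm, 'x) module_scheme"
  assumes H: "unital_algebra R H \<mu> \<eta>" and M: "module R M"
    and \<rho>: "\<rho> \<in> linear_maps R (H \<boxtimes>[R] M) M"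
    and assoc: "\<And>a b x. \<lbrakk>a \<in> carrier H; b \<in> carrier H; x \<in> carrier M\<rbrakk>
      \<Longrightarrow> \<rho> (pure_tensor R H M (\<mu> (pure_tensor R H H a b)) x)
        = \<rho> (pure_tensor R H M a (\<rho> (pure_tensor R H M b x)))"
    and unit: "\<And>x. x \<in> carrier M \<Longrightarrow> \<rho> (pure_tensor R H M (\<eta> \<one>) x) = x"
  shows "left_action R H \<mu> \<eta> M \<rho>"
proof -
  note Hm = unital_algebra.axioms(1)[OF H]
  note \<mu> = unital_algebra.mult_linear[OF H] and \<eta> = unital_algebra.unit_linear[OF H]
  note lin = linear_o linear_tensor_assoc linear_tensor_map \<mu> \<eta> \<rho> linear_id multilinear Hm M
    linear_tensor_lunit
  show ?thesis
  proof (intro left_action.intro left_action_axioms.intro H M \<rho> ballI)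
    fix t assume t: "t \<in> carrier ((H \<boxtimes>[R] H) \<boxtimes>[R] M)"
    show "(\<rho> \<circ> tensor_map R H M \<mu> id) t = (\<rho> \<circ> tensor_map R H M id \<rho> \<circ> tensor_assoc R H H M) t"
    proof (rule tensor_ext_left[OF Hm Hm M M _ _ _ t])
      show "\<rho> \<circ> tensor_map R H M \<mu> id \<in> linear_maps R (H \<boxtimes>[R] H \<boxtimes>[R] M) M"
        by (rule lin)+
      show "\<rho> \<circ> tensor_map R H M id \<rho> \<circ> tensor_assoc R H H M \<in> linear_maps R (H \<boxtimes>[R] H \<boxtimes>[R] M) M"
        by (rule lin)+
      fix a b x assume "a \<in> carrier H" "b \<in> carrier H" "x \<in> carrier M"
      then show "(\<rho> \<circ> tensor_map R H M \<mu> id)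
            (pure_tensor R (H \<boxtimes>[R] H) M (pure_tensor R H H a b) x)
          = (\<rho> \<circ> tensor_map R H M id \<rho> \<circ> tensor_assoc R H H M)
            (pure_tensor R (H \<boxtimes>[R] H) M (pure_tensor R H H a b) x)"
        by (simp add: tensor_map_pure tensor_assoc_pure tensor_is_module Hm M \<mu> \<rho> linear_id
            pure_tensor_closed assoc)
    qed
  next
    fix t assume t: "t \<in> carrier (scalar_module R \<boxtimes>[R] M)"
    show "(\<rho> \<circ> tensor_map R H M \<eta> id) t = tensor_lunit R M t"
    proof (rule tensor_ext[OF scalar_module_is_module M M _ _ _ t])
      show "\<rho> \<circ> tensor_map R H M \<eta> id \<in> linear_maps R (scalar_module R \<boxtimes>[R] M) M"
        by (rule lin)+
      show "tensor_lunit R M \<in> linear_maps R (scalar_module R \<boxtimes>[R] M) M"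
        by (rule lin)+
      fix r x assume r: "r \<in> carrier (scalar_module R)" and x: "x \<in> carrier M"
      have r': "r \<in> carrier R" and one: "\<one> \<in> carrier (scalar_module R)"
        using r by (simp_all add: scalar_module_def)
      have "\<eta> r = \<eta> (r \<odot>\<^bsub>scalar_module R\<^esub> \<one>)" using r' by (simp add: scalar_module_def)
      also have "\<dots> = r \<odot>\<^bsub>H\<^esub> \<eta> \<one>" by (rule linear_smult[OF \<eta> r' one])
      finally have \<eta>r: "\<eta> r = r \<odot>\<^bsub>H\<^esub> \<eta> \<one>" .
      have "(\<lambda>h. \<rho> (pure_tensor R H M h x)) \<in> linear_maps R H M"
        by (assumption | rule lin x linear_comp[OF \<rho>])+
      from linear_smult[OF this r' linear_closed[OF \<eta> one]]
      show "(\<rho> \<circ> tensor_map R H M \<eta> id) (pure_tensor R (scalar_module R) M r x)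
          = tensor_lunit R M (pure_tensor R (scalar_module R) M r x)"
        using r x
        by (simp add: tensor_map_pure scalar_module_is_module Hm M \<eta> linear_id tensor_lunit_pure \<eta>r unit)
    qed
  qed
qed

text \<open>
  The sum \<open>(h\<^sub>2 x)\<^sub>0 \<otimes> (h\<^sub>2 x)\<^sub>1 h\<^sub>1\<close>. All maps after the first \<open>tensor_assoc\<close> form one linear map \<open>?K\<close>, which moves
  under the sum over the components of \<open>\<Delta> h\<close> and then only meets pure tensors.
\<close>

lemma yetter_drinfeld_left_side:
  fixes M :: "('a, 'm, 'x) module_scheme" and H :: "('a, 'h, 'y) module_scheme"
  assumes H: "module R H" and M: "module R M"
    and \<mu>: "\<mu> \<in> linear_maps R (H \<boxtimes>[R] H) H" and \<Delta>: "\<Delta> \<in> linear_maps R H (H \<boxtimes>[R] H)"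
    and \<rho>: "\<rho> \<in> linear_maps R (H \<boxtimes>[R] M) M" and \<delta>: "\<delta> \<in> linear_maps R M (M \<boxtimes>[R] H)"
    and h: "h \<in> carrier H" and x: "x \<in> carrier M"
  shows "(tensor_map R M H id \<mu> \<circ> tensor_assoc R M H H \<circ> tensor_map R (M \<boxtimes>[R] H) H \<delta> id
        \<circ> tensor_flip R H M \<circ> tensor_map R H M id \<rho> \<circ> tensor_assoc R H H M
        \<circ> tensor_map R (H \<boxtimes>[R] H) M \<Delta> id) (pure_tensor R H M h x)
    = tensor_lift R (M \<boxtimes>[R] H) (\<lambda>a b. tensor_lift R (M \<boxtimes>[R] H)
        (\<lambda>p q. pure_tensor R M H p (\<mu> (pure_tensor R H H q a)))
        (\<delta> (\<rho> (pure_tensor R H M b x)))) (\<Delta> h)"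
proof -
  note modules = multilinear H M
  let ?K = "tensor_map R M H id \<mu> \<circ> tensor_assoc R M H H \<circ> tensor_map R (M \<boxtimes>[R] H) H \<delta> id
        \<circ> tensor_flip R H M \<circ> tensor_map R H M id \<rho>"
  have MH: "module R (M \<boxtimes>[R] H)" and HM: "module R (H \<boxtimes>[R] M)"
    by (rule modules)+
  have K: "?K \<in> linear_maps R (H \<boxtimes>[R] (H \<boxtimes>[R] M)) (M \<boxtimes>[R] H)"
    by (rule linear_o linear_tensor_assoc linear_tensor_map linear_tensor_flip
        linear_id tensor_is_module H M \<mu> \<rho> \<delta>)+
  have \<Delta>h: "\<Delta> h \<in> carrier (H \<boxtimes>[R] H)" by (rule linear_closed[OF \<Delta> h])
  have K_pure: "?K (pure_tensor R H (H \<boxtimes>[R] M) a (pure_tensor R H M b x))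
      = tensor_lift R (M \<boxtimes>[R] H) (\<lambda>p q. pure_tensor R M H p (\<mu> (pure_tensor R H H q a)))
          (\<delta> (\<rho> (pure_tensor R H M b x)))" if a: "a \<in> carrier H" and b: "b \<in> carrier H" for a b
  proof -
    have y: "\<rho> (pure_tensor R H M b x) \<in> carrier M"
      by (rule linear_closed[OF \<rho>] modules b x)+
    then have \<delta>y: "\<delta> (\<rho> (pure_tensor R H M b x)) \<in> carrier (M \<boxtimes>[R] H)"
      by (rule linear_closed[OF \<delta>])
    have "?K (pure_tensor R H (H \<boxtimes>[R] M) a (pure_tensor R H M b x))
        = tensor_map R M H id \<mu> (tensor_lift R (M \<boxtimes>[R] (H \<boxtimes>[R] H))
            (\<lambda>p q. pure_tensor R M (H \<boxtimes>[R] H) p (pure_tensor R H H q a)) (\<delta> (\<rho> (pure_tensor R H M b x))))"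
      using a b x y \<delta>y
      by (simp add: tensor_map_pure[OF H HM H M linear_id \<rho>] tensor_map_pure[OF M H MH H \<delta> linear_id]
          tensor_flip_pure[OF H M] pure_tensor_closed[OF H M] tensor_assoc_pure_right[OF M H H])
    also have "\<dots> = tensor_lift R (M \<boxtimes>[R] H) (\<lambda>p q. tensor_map R M H id \<mu>
        (pure_tensor R M (H \<boxtimes>[R] H) p (pure_tensor R H H q a))) (\<delta> (\<rho> (pure_tensor R H M b x)))"
      by (rule tensor_lift_hom[OF linear_tensor_map \<delta>y])
         (assumption | rule modules \<mu> linear_id a)+
    also have "\<dots> = tensor_lift R (M \<boxtimes>[R] H) (\<lambda>p q. pure_tensor R M H p (\<mu> (pure_tensor R H H q a)))
        (\<delta> (\<rho> (pure_tensor R H M b x)))"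
      by (rule tensor_lift_cong[OF M H \<delta>y])
         (simp add: tensor_map_pure[OF M _ M H linear_id \<mu>] tensor_is_module H pure_tensor_closed a)
    finally show ?thesis .
  qed
  have "(?K \<circ> tensor_assoc R H H M \<circ> tensor_map R (H \<boxtimes>[R] H) M \<Delta> id) (pure_tensor R H M h x)
      = ?K (tensor_lift R (H \<boxtimes>[R] (H \<boxtimes>[R] M))
          (\<lambda>a b. pure_tensor R H (H \<boxtimes>[R] M) a (pure_tensor R H M b x)) (\<Delta> h))"
    using h x \<Delta>h
    by (simp add: tensor_map_pure[OF H M _ M \<Delta> linear_id] tensor_is_module H tensor_assoc_pure_right[OF H H M])
  also have "\<dots> = tensor_lift R (M \<boxtimes>[R] H)
      (\<lambda>a b. ?K (pure_tensor R H (H \<boxtimes>[R] M) a (pure_tensor R H M b x))) (\<Delta> h)"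
    by (rule tensor_lift_hom[OF K \<Delta>h]) (assumption | rule modules x)+
  also have "\<dots> = tensor_lift R (M \<boxtimes>[R] H) (\<lambda>a b. tensor_lift R (M \<boxtimes>[R] H)
        (\<lambda>p q. pure_tensor R M H p (\<mu> (pure_tensor R H H q a)))
        (\<delta> (\<rho> (pure_tensor R H M b x)))) (\<Delta> h)"
    by (rule tensor_lift_cong[OF H H \<Delta>h K_pure])
  finally show ?thesis by (simp add: comp_assoc)
qed

text \<open>
  The sum \<open>h\<^sub>1 x\<^sub>0 \<otimes> h\<^sub>2 x\<^sub>1\<close>.
\<close>

lemma yetter_drinfeld_right_side:
  fixes M :: "('a, 'm, 'x) module_scheme" and H :: "('a, 'h, 'y) module_scheme"
  assumes H: "module R H" and M: "module R M"
    and \<mu>: "\<mu> \<in> linear_maps R (H \<boxtimes>[R] H) H" and \<Delta>: "\<Delta> \<in> linear_maps R H (H \<boxtimes>[R] H)"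
    and \<rho>: "\<rho> \<in> linear_maps R (H \<boxtimes>[R] M) M" and \<delta>: "\<delta> \<in> linear_maps R M (M \<boxtimes>[R] H)"
    and h: "h \<in> carrier H" and x: "x \<in> carrier M"
  shows "(tensor_map R M H \<rho> \<mu> \<circ> middle_flip R H H M H
        \<circ> tensor_map R (H \<boxtimes>[R] H) (M \<boxtimes>[R] H) \<Delta> \<delta>) (pure_tensor R H M h x)
    = tensor_lift R (M \<boxtimes>[R] H) (\<lambda>a b. tensor_lift R (M \<boxtimes>[R] H)
        (\<lambda>p q. pure_tensor R M H (\<rho> (pure_tensor R H M a p)) (\<mu> (pure_tensor R H H b q)))
        (\<delta> x)) (\<Delta> h)"
proof -
  have HH: "module R (H \<boxtimes>[R] H)" and MH: "module R (M \<boxtimes>[R] H)" by (rule multilinear H M)+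
  show ?thesis
    by (simp add: tensor_map_pure[OF H M HH MH \<Delta> \<delta> h x]
        tensor_map_middle_flip[OF H H M H M H \<rho> \<mu> linear_closed[OF \<Delta> h] linear_closed[OF \<delta> x]])
qed


text \<open>
  With \<open>coassoc_right_side\<close>, this writes coassociativity as \<open>x\<^sub>0\<^sub>0 \<otimes> (x\<^sub>0\<^sub>1 \<otimes> x\<^sub>1) = x\<^sub>0 \<otimes> (x\<^sub>1\<^sub>1 \<otimes> x\<^sub>1\<^sub>2)\<close>.
\<close>

lemma coassoc_left_side:
  fixes M :: "('a, 'm, 'x) module_scheme" and H :: "('a, 'h, 'y) module_scheme"
  assumes H: "module R H" and M: "module R M"
    and \<delta>: "\<delta> \<in> linear_maps R M (M \<boxtimes>[R] H)" and x: "x \<in> carrier M"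
  shows "(tensor_assoc R M H H \<circ> tensor_map R (M \<boxtimes>[R] H) H \<delta> id \<circ> \<delta>) x
    = tensor_lift R (M \<boxtimes>[R] (H \<boxtimes>[R] H)) (\<lambda>p q. tensor_lift R (M \<boxtimes>[R] (H \<boxtimes>[R] H))
        (\<lambda>u v. pure_tensor R M (H \<boxtimes>[R] H) u (pure_tensor R H H v q)) (\<delta> p)) (\<delta> x)"
proof -
  note modules = multilinear H M
  note \<delta>x = linear_closed[OF \<delta> x]
  have "(tensor_assoc R M H H \<circ> tensor_map R (M \<boxtimes>[R] H) H \<delta> id \<circ> \<delta>) x
      = tensor_assoc R M H H (tensor_lift R ((M \<boxtimes>[R] H) \<boxtimes>[R] H)
          (\<lambda>p q. pure_tensor R (M \<boxtimes>[R] H) H (\<delta> p) q) (\<delta> x))"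
    by (simp add: tensor_map_def)
  also have "\<dots> = tensor_lift R (M \<boxtimes>[R] (H \<boxtimes>[R] H))
      (\<lambda>p q. tensor_assoc R M H H (pure_tensor R (M \<boxtimes>[R] H) H (\<delta> p) q)) (\<delta> x)"
    by (rule tensor_lift_hom[OF linear_tensor_assoc \<delta>x])
       (assumption | rule modules linear_comp[OF \<delta>] linear_closed[OF \<delta>])+
  also have "\<dots> = tensor_lift R (M \<boxtimes>[R] (H \<boxtimes>[R] H)) (\<lambda>p q. tensor_lift R (M \<boxtimes>[R] (H \<boxtimes>[R] H))
        (\<lambda>u v. pure_tensor R M (H \<boxtimes>[R] H) u (pure_tensor R H H v q)) (\<delta> p)) (\<delta> x)"
    by (rule tensor_lift_cong[OF M H \<delta>x])
       (simp add: tensor_assoc_pure_right[OF M H H] linear_closed[OF \<delta>])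
  finally show ?thesis .
qed

lemma coassoc_right_side:
  fixes M :: "('a, 'm, 'x) module_scheme" and H :: "('a, 'h, 'y) module_scheme"
  assumes H: "module R H" and M: "module R M" and \<Delta>: "\<Delta> \<in> linear_maps R H (H \<boxtimes>[R] H)"
    and \<delta>: "\<delta> \<in> linear_maps R M (M \<boxtimes>[R] H)" and x: "x \<in> carrier M"
  shows "(tensor_map R M (H \<boxtimes>[R] H) id \<Delta> \<circ> \<delta>) x
    = tensor_lift R (M \<boxtimes>[R] (H \<boxtimes>[R] H)) (\<lambda>p q. tensor_lift R (M \<boxtimes>[R] (H \<boxtimes>[R] H))
        (\<lambda>u v. pure_tensor R M (H \<boxtimes>[R] H) p (pure_tensor R H H u v)) (\<Delta> q)) (\<delta> x)"
proof -
  note modules = multilinear H M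
  note \<delta>x = linear_closed[OF \<delta> x]
  have "pure_tensor R M (H \<boxtimes>[R] H) p (\<Delta> q) = tensor_lift R (M \<boxtimes>[R] (H \<boxtimes>[R] H))
        (\<lambda>u v. pure_tensor R M (H \<boxtimes>[R] H) p (pure_tensor R H H u v)) (\<Delta> q)"
    if p: "p \<in> carrier M" and q: "q \<in> carrier H" for p q
  proof -
    note \<Delta>q = linear_closed[OF \<Delta> q]
    have p_lin: "(\<lambda>t. pure_tensor R M (H \<boxtimes>[R] H) p t)
        \<in> linear_maps R (H \<boxtimes>[R] H) (M \<boxtimes>[R] (H \<boxtimes>[R] H))"
      by (assumption | rule modules p)+
    have "pure_tensor R M (H \<boxtimes>[R] H) p (\<Delta> q)
        = pure_tensor R M (H \<boxtimes>[R] H) p (tensor_lift R (H \<boxtimes>[R] H) (\<lambda>u v. pure_tensor R H H u v) (\<Delta> q))"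
      by (simp only: tensor_lift_pure_self[OF H H \<Delta>q])
    also have "\<dots> = tensor_lift R (M \<boxtimes>[R] (H \<boxtimes>[R] H))
        (\<lambda>u v. pure_tensor R M (H \<boxtimes>[R] H) p (pure_tensor R H H u v)) (\<Delta> q)"
      by (rule tensor_lift_hom[OF p_lin \<Delta>q]) (assumption | rule modules)+
    finally show ?thesis .
  qed
  then show ?thesis
    by (simp only: tensor_map_def comp_apply id_apply) (rule tensor_lift_cong[OF M H \<delta>x])
qed

lemma counit_side:
  fixes M :: "('a, 'm, 'x) module_scheme" and H :: "('a, 'h, 'y) module_scheme"
  assumes H: "module R H" and M: "module R M" and \<epsilon>: "\<epsilon> \<in> linear_maps R H (scalar_module R)"
    and \<delta>: "\<delta> \<in> linear_maps R M (M \<boxtimes>[R] H)" and x: "x \<in> carrier M"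
  shows "(tensor_runit R M \<circ> tensor_map R M (scalar_module R) id \<epsilon> \<circ> \<delta>) x
    = tensor_lift R M (\<lambda>p q. \<epsilon> q \<odot>\<^bsub>M\<^esub> p) (\<delta> x)"
proof -
  note modules = multilinear H M
  note \<delta>x = linear_closed[OF \<delta> x]
  have "(tensor_runit R M \<circ> tensor_map R M (scalar_module R) id \<epsilon> \<circ> \<delta>) x
      = tensor_runit R M (tensor_lift R (M \<boxtimes>[R] scalar_module R)
          (\<lambda>p q. pure_tensor R M (scalar_module R) p (\<epsilon> q)) (\<delta> x))"
    by (simp add: tensor_map_def)
  also have "\<dots> = tensor_lift R M (\<lambda>p q. tensor_runit R M (pure_tensor R M (scalar_module R) p (\<epsilon> q))) (\<delta> x)"
    by (rule tensor_lift_hom[OF linear_tensor_runit \<delta>x])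
       (assumption | rule modules linear_comp[OF \<epsilon>] linear_closed[OF \<epsilon>])+
  also have "\<dots> = tensor_lift R M (\<lambda>p q. \<epsilon> q \<odot>\<^bsub>M\<^esub> p) (\<delta> x)"
    by (rule tensor_lift_cong[OF M H \<delta>x]) (simp add: tensor_runit_pure[OF M] linear_closed[OF \<epsilon>])
  finally show ?thesis .
qed

end

text \<open>
  Makes the statements on coactions below available for the comultiplication itself.
\<close>

lemma (in counital_coalgebra) regular_coaction: "right_coaction R C \<Delta> \<epsilon> C \<Delta>"
  by (intro right_coaction.intro right_coaction_axioms.intro counital_coalgebra_axioms
      module_axioms comult_linear comult_coassoc comult_counit_right)

text \<open>
  Coassociativity in the form needed inside a calculation, where the three components of \<open>x\<close> are not
  tensored but inserted into a trilinear term \<open>\<beta>\<close>. It is the image of the axiom under the linear map that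
  \<open>\<beta>\<close> induces on \<open>M \<otimes> (H \<otimes> H)\<close>.
\<close>

lemma (in right_coaction) coassoc_lift:
  fixes P :: "('a, 'p, 'z) module_scheme"
  assumes P: "module R P" and x: "x \<in> carrier M"
    and \<beta>1: "\<And>q. q \<in> carrier H \<Longrightarrow> (\<lambda>u v. \<beta> u v q) \<in> bilinear_maps R M H P"
    and \<beta>2: "\<And>p. p \<in> carrier M \<Longrightarrow> (\<lambda>u v. \<beta> p u v) \<in> bilinear_maps R H H P"
  shows "tensor_lift R P (\<lambda>p q. tensor_lift R P (\<lambda>u v. \<beta> u v q) (\<delta> p)) (\<delta> x)
    = tensor_lift R P (\<lambda>p q. tensor_lift R P (\<lambda>u v. \<beta> p u v) (\<Delta> q)) (\<delta> x)"
proof -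
  have H: "module R H" and M: "module R M" by unfold_locales
  note modules = multilinear H M P linear_comp[OF coaction_linear] linear_closed[OF coaction_linear]
    linear_comp[OF comult_linear] linear_closed[OF comult_linear]
  note lin = bilinear_left[OF \<beta>1] bilinear_right[OF \<beta>1] bilinear_left[OF \<beta>2] bilinear_right[OF \<beta>2]
  note \<delta>x = linear_closed[OF coaction_linear x]
  let ?T = "M \<boxtimes>[R] (H \<boxtimes>[R] H)"
  let ?\<gamma> = "\<lambda>p t. tensor_lift R P (\<lambda>u v. \<beta> p u v) t"
  have HH: "module R (H \<boxtimes>[R] H)" by (rule modules)+
  have \<gamma>: "?\<gamma> \<in> bilinear_maps R M (H \<boxtimes>[R] H) P"
    by (assumption | rule modules lin)+
  note \<phi> = tensor_lift_linear[OF M HH P \<gamma>]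
  have \<phi>_pure: "tensor_lift R P ?\<gamma> (pure_tensor R M (H \<boxtimes>[R] H) p (pure_tensor R H H u v)) = \<beta> p u v"
    if "p \<in> carrier M" "u \<in> carrier H" "v \<in> carrier H" for p u v
    using that by (simp add: tensor_lift_pure[OF M HH P \<gamma>] pure_tensor_closed[OF H H] tensor_lift_pure[OF H H P \<beta>2])
  have "tensor_lift R P ?\<gamma> (tensor_lift R ?T (\<lambda>p q. tensor_lift R ?T
        (\<lambda>u v. pure_tensor R M (H \<boxtimes>[R] H) u (pure_tensor R H H v q)) (\<delta> p)) (\<delta> x))
      = tensor_lift R P (\<lambda>p q. tensor_lift R P ?\<gamma> (tensor_lift R ?T
        (\<lambda>u v. pure_tensor R M (H \<boxtimes>[R] H) u (pure_tensor R H H v q)) (\<delta> p))) (\<delta> x)"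
    by (rule tensor_lift_hom[OF \<phi> \<delta>x]) (assumption | rule modules)+
  also have "\<dots> = tensor_lift R P (\<lambda>p q. tensor_lift R P
        (\<lambda>u v. tensor_lift R P ?\<gamma> (pure_tensor R M (H \<boxtimes>[R] H) u (pure_tensor R H H v q))) (\<delta> p)) (\<delta> x)"
    by (rule tensor_lift_cong[OF M H \<delta>x], rule tensor_lift_hom[OF \<phi>]) (assumption | rule modules)+
  also have "\<dots> = tensor_lift R P (\<lambda>p q. tensor_lift R P (\<lambda>u v. \<beta> u v q) (\<delta> p)) (\<delta> x)"
    by (rule tensor_lift_cong[OF M H \<delta>x], rule tensor_lift_cong[OF M H])
       (assumption | rule modules \<phi>_pure)+
  finally have l: "tensor_lift R P ?\<gamma> (tensor_lift R ?T (\<lambda>p q. tensor_lift R ?T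
        (\<lambda>u v. pure_tensor R M (H \<boxtimes>[R] H) u (pure_tensor R H H v q)) (\<delta> p)) (\<delta> x))
      = tensor_lift R P (\<lambda>p q. tensor_lift R P (\<lambda>u v. \<beta> u v q) (\<delta> p)) (\<delta> x)" .
  have "tensor_lift R P ?\<gamma> (tensor_lift R ?T (\<lambda>p q. tensor_lift R ?T
        (\<lambda>u v. pure_tensor R M (H \<boxtimes>[R] H) p (pure_tensor R H H u v)) (\<Delta> q)) (\<delta> x))
      = tensor_lift R P (\<lambda>p q. tensor_lift R P ?\<gamma> (tensor_lift R ?T
        (\<lambda>u v. pure_tensor R M (H \<boxtimes>[R] H) p (pure_tensor R H H u v)) (\<Delta> q))) (\<delta> x)"
    by (rule tensor_lift_hom[OF \<phi> \<delta>x]) (assumption | rule modules)+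
  also have "\<dots> = tensor_lift R P (\<lambda>p q. tensor_lift R P
        (\<lambda>u v. tensor_lift R P ?\<gamma> (pure_tensor R M (H \<boxtimes>[R] H) p (pure_tensor R H H u v))) (\<Delta> q)) (\<delta> x)"
    by (rule tensor_lift_cong[OF M H \<delta>x], rule tensor_lift_hom[OF \<phi>]) (assumption | rule modules)+
  also have "\<dots> = tensor_lift R P (\<lambda>p q. tensor_lift R P (\<lambda>u v. \<beta> p u v) (\<Delta> q)) (\<delta> x)"
    by (rule tensor_lift_cong[OF M H \<delta>x], rule tensor_lift_cong[OF H H])
       (assumption | rule modules \<phi>_pure)+
  finally have r: "tensor_lift R P ?\<gamma> (tensor_lift R ?T (\<lambda>p q. tensor_lift R ?T
        (\<lambda>u v. pure_tensor R M (H \<boxtimes>[R] H) p (pure_tensor R H H u v)) (\<Delta> q)) (\<delta> x))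
      = tensor_lift R P (\<lambda>p q. tensor_lift R P (\<lambda>u v. \<beta> p u v) (\<Delta> q)) (\<delta> x)" .
  have "(tensor_assoc R M H H \<circ> tensor_map R (M \<boxtimes>[R] H) H \<delta> id \<circ> \<delta>) x
      = (tensor_map R M (H \<boxtimes>[R] H) id \<Delta> \<circ> \<delta>) x"
    using coaction_comult x by blast
  then show ?thesis
    unfolding coassoc_left_side[OF H M coaction_linear x]
      coassoc_right_side[OF H M comult_linear coaction_linear x]
    by (simp only: l[symmetric] r[symmetric])
qed

lemma (in right_coaction) counit_lift:
  assumes x: "x \<in> carrier M"
  shows "tensor_lift R M (\<lambda>p q. \<epsilon> q \<odot>\<^bsub>M\<^esub> p) (\<delta> x) = x"
proof -
  have H: "module R H" and M: "module R M" by unfold_locales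
  show ?thesis
    using bspec[OF coaction_counit x]
    unfolding counit_side[OF H M counit_linear coaction_linear x] .
qed

lemma (in counital_coalgebra) right_coactionI:
  fixes M :: "('a, 'm, 'x) module_scheme"
  assumes M: "module R M" and \<delta>: "\<delta> \<in> linear_maps R M (M \<boxtimes>[R] C)"
    and coassoc: "\<And>x. x \<in> carrier M \<Longrightarrow>
      tensor_lift R (M \<boxtimes>[R] (C \<boxtimes>[R] C)) (\<lambda>p q. tensor_lift R (M \<boxtimes>[R] (C \<boxtimes>[R] C))
        (\<lambda>u v. pure_tensor R M (C \<boxtimes>[R] C) u (pure_tensor R C C v q)) (\<delta> p)) (\<delta> x)
      = tensor_lift R (M \<boxtimes>[R] (C \<boxtimes>[R] C)) (\<lambda>p q. tensor_lift R (M \<boxtimes>[R] (C \<boxtimes>[R] C))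
        (\<lambda>u v. pure_tensor R M (C \<boxtimes>[R] C) p (pure_tensor R C C u v)) (\<Delta> q)) (\<delta> x)"
    and counit: "\<And>x. x \<in> carrier M \<Longrightarrow> tensor_lift R M (\<lambda>p q. \<epsilon> q \<odot>\<^bsub>M\<^esub> p) (\<delta> x) = x"
  shows "right_coaction R C \<Delta> \<epsilon> M \<delta>"
proof -
  have C: "module R C" ..
  show ?thesis
    by (intro right_coaction.intro right_coaction_axioms.intro counital_coalgebra_axioms M \<delta> ballI)
       (simp_all only: coassoc_left_side[OF C M \<delta>] coassoc_right_side[OF C M comult_linear \<delta>]
         counit_side[OF C M counit_linear \<delta>] coassoc counit)
qed

text \<open>
  The image of the compatibility condition under the linear map on \<open>M \<otimes> H\<close> induced by \<open>\<beta>\<close>.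
\<close>

lemma (in yetter_drinfeld_module) yetter_drinfeld_lift:
  fixes P :: "('a, 'p, 'z) module_scheme"
  assumes P: "module R P" and h: "h \<in> carrier H" and x: "x \<in> carrier M"
    and \<beta>: "(\<lambda>p q. \<beta> p q) \<in> bilinear_maps R M H P"
  shows "tensor_lift R P (\<lambda>a b. tensor_lift R P
        (\<lambda>p q. \<beta> p (\<mu> (pure_tensor R H H q a))) (\<delta> (\<rho> (pure_tensor R H M b x)))) (\<Delta> h)
    = tensor_lift R P (\<lambda>a b. tensor_lift R P
        (\<lambda>p q. \<beta> (\<rho> (pure_tensor R H M a p)) (\<mu> (pure_tensor R H H b q))) (\<delta> x)) (\<Delta> h)"
proof -
  have H: "module R H" and M: "module R M" by unfold_locales
  note ops = mult_linear comult_linear action_linear coaction_linear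
  note modules = multilinear H M P linear_comp[OF mult_linear] linear_closed[OF mult_linear]
    linear_comp[OF comult_linear] linear_closed[OF comult_linear]
    linear_comp[OF action_linear] linear_closed[OF action_linear]
    linear_comp[OF coaction_linear] linear_closed[OF coaction_linear] x
  note \<phi> = tensor_lift_linear[OF M H P \<beta>] and \<phi>_pure = tensor_lift_pure[OF M H P \<beta>]
  note \<Delta>h = linear_closed[OF comult_linear h]
  note \<delta>x = linear_closed[OF coaction_linear x]
  let ?Q = "M \<boxtimes>[R] H"
  have "tensor_lift R P \<beta> (tensor_lift R ?Q (\<lambda>a b. tensor_lift R ?Q
        (\<lambda>p q. pure_tensor R M H p (\<mu> (pure_tensor R H H q a))) (\<delta> (\<rho> (pure_tensor R H M b x)))) (\<Delta> h))
      = tensor_lift R P (\<lambda>a b. tensor_lift R P \<beta> (tensor_lift R ?Q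
        (\<lambda>p q. pure_tensor R M H p (\<mu> (pure_tensor R H H q a))) (\<delta> (\<rho> (pure_tensor R H M b x))))) (\<Delta> h)"
    by (rule tensor_lift_hom[OF \<phi> \<Delta>h]) (assumption | rule modules)+
  also have "\<dots> = tensor_lift R P (\<lambda>a b. tensor_lift R P
        (\<lambda>p q. tensor_lift R P \<beta> (pure_tensor R M H p (\<mu> (pure_tensor R H H q a))))
        (\<delta> (\<rho> (pure_tensor R H M b x)))) (\<Delta> h)"
    by (rule tensor_lift_cong[OF H H \<Delta>h], rule tensor_lift_hom[OF \<phi>]) (assumption | rule modules)+
  also have "\<dots> = tensor_lift R P (\<lambda>a b. tensor_lift R P
        (\<lambda>p q. \<beta> p (\<mu> (pure_tensor R H H q a))) (\<delta> (\<rho> (pure_tensor R H M b x)))) (\<Delta> h)"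
    by (rule tensor_lift_cong[OF H H \<Delta>h], rule tensor_lift_cong[OF M H])
       (assumption | rule modules \<phi>_pure)+
  finally have l: "tensor_lift R P \<beta> (tensor_lift R ?Q (\<lambda>a b. tensor_lift R ?Q
        (\<lambda>p q. pure_tensor R M H p (\<mu> (pure_tensor R H H q a))) (\<delta> (\<rho> (pure_tensor R H M b x)))) (\<Delta> h))
      = tensor_lift R P (\<lambda>a b. tensor_lift R P
        (\<lambda>p q. \<beta> p (\<mu> (pure_tensor R H H q a))) (\<delta> (\<rho> (pure_tensor R H M b x)))) (\<Delta> h)" .
  have "tensor_lift R P \<beta> (tensor_lift R ?Q (\<lambda>a b. tensor_lift R ?Q
        (\<lambda>p q. pure_tensor R M H (\<rho> (pure_tensor R H M a p)) (\<mu> (pure_tensor R H H b q))) (\<delta> x)) (\<Delta> h))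
      = tensor_lift R P (\<lambda>a b. tensor_lift R P \<beta> (tensor_lift R ?Q
        (\<lambda>p q. pure_tensor R M H (\<rho> (pure_tensor R H M a p)) (\<mu> (pure_tensor R H H b q))) (\<delta> x))) (\<Delta> h)"
    by (rule tensor_lift_hom[OF \<phi> \<Delta>h]) (assumption | rule modules)+
  also have "\<dots> = tensor_lift R P (\<lambda>a b. tensor_lift R P
        (\<lambda>p q. tensor_lift R P \<beta> (pure_tensor R M H (\<rho> (pure_tensor R H M a p)) (\<mu> (pure_tensor R H H b q))))
        (\<delta> x)) (\<Delta> h)"
    by (rule tensor_lift_cong[OF H H \<Delta>h], rule tensor_lift_hom[OF \<phi>]) (assumption | rule modules)+
  also have "\<dots> = tensor_lift R P (\<lambda>a b. tensor_lift R P
        (\<lambda>p q. \<beta> (\<rho> (pure_tensor R H M a p)) (\<mu> (pure_tensor R H H b q))) (\<delta> x)) (\<Delta> h)"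
    by (rule tensor_lift_cong[OF H H \<Delta>h], rule tensor_lift_cong[OF M H])
       (assumption | rule modules \<phi>_pure)+
  finally have r: "tensor_lift R P \<beta> (tensor_lift R ?Q (\<lambda>a b. tensor_lift R ?Q
        (\<lambda>p q. pure_tensor R M H (\<rho> (pure_tensor R H M a p)) (\<mu> (pure_tensor R H H b q))) (\<delta> x)) (\<Delta> h))
      = tensor_lift R P (\<lambda>a b. tensor_lift R P
        (\<lambda>p q. \<beta> (\<rho> (pure_tensor R H M a p)) (\<mu> (pure_tensor R H H b q))) (\<delta> x)) (\<Delta> h)" .
  have "pure_tensor R H M h x \<in> carrier (H \<boxtimes>[R] M)" by (rule modules h)+
  note bspec[OF yetter_drinfeld this, unfolded
      yetter_drinfeld_left_side[OF H M ops h x] yetter_drinfeld_right_side[OF H M ops h x]]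
  then show ?thesis by (simp only: l[symmetric] r[symmetric])
qed

section \<open>The tensor product of two Yetter-Drinfel'd modules\<close>

text \<open>
  The action of \<open>H\<close> through the opposite comultiplication, and the coaction that multiplies the two
  components in \<open>H\<close>.
\<close>

definition tensor_action where
  "tensor_action R H \<Delta> M N \<rho>\<^sub>1 \<rho>\<^sub>2 =
     tensor_map R M N \<rho>\<^sub>1 \<rho>\<^sub>2 \<circ> middle_flip R H H M N
       \<circ> tensor_map R (H \<boxtimes>[R] H) (M \<boxtimes>[R] N) (tensor_flip R H H \<circ> \<Delta>) id"

definition tensor_coaction where
  "tensor_coaction R H \<mu> M N \<delta>\<^sub>1 \<delta>\<^sub>2 =
     tensor_map R (M \<boxtimes>[R] N) H id \<mu> \<circ> middle_flip R M H N H
       \<circ> tensor_map R (M \<boxtimes>[R] H) (N \<boxtimes>[R] H) \<delta>\<^sub>1 \<delta>\<^sub>2"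

context cring
begin

lemma linear_tensor_action:
  assumes H: "module R H" and M: "module R M" and N: "module R N"
    and \<Delta>: "\<Delta> \<in> linear_maps R H (H \<boxtimes>[R] H)"
    and \<rho>1: "\<rho>\<^sub>1 \<in> linear_maps R (H \<boxtimes>[R] M) M" and \<rho>2: "\<rho>\<^sub>2 \<in> linear_maps R (H \<boxtimes>[R] N) N"
  shows "tensor_action R H \<Delta> M N \<rho>\<^sub>1 \<rho>\<^sub>2 \<in> linear_maps R (H \<boxtimes>[R] (M \<boxtimes>[R] N)) (M \<boxtimes>[R] N)"
  unfolding tensor_action_def
  by (rule linear_o linear_tensor_map linear_middle_flip linear_tensor_flip linear_id
      tensor_is_module assms)+

text \<open>
  The formula \<open>h(x \<otimes> y) = h\<^sub>2 x \<otimes> h\<^sub>1 y\<close>, with a linear map \<open>f\<close> applied to both sides so that it can be used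
  in the middle of a larger term.
\<close>

lemma tensor_action_hom:
  fixes P :: "('a, 'p, 'z) module_scheme"
  assumes H: "module R H" and M: "module R M" and N: "module R N" and P: "module R P"
    and \<Delta>: "\<Delta> \<in> linear_maps R H (H \<boxtimes>[R] H)"
    and \<rho>1: "\<rho>\<^sub>1 \<in> linear_maps R (H \<boxtimes>[R] M) M" and \<rho>2: "\<rho>\<^sub>2 \<in> linear_maps R (H \<boxtimes>[R] N) N"
    and f: "f \<in> linear_maps R (M \<boxtimes>[R] N) P"
    and h: "h \<in> carrier H" and x: "x \<in> carrier M" and y: "y \<in> carrier N"
  shows "f (tensor_action R H \<Delta> M N \<rho>\<^sub>1 \<rho>\<^sub>2 (pure_tensor R H (M \<boxtimes>[R] N) h (pure_tensor R M N x y)))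
    = tensor_lift R P (\<lambda>a b. f (pure_tensor R M N
        (\<rho>\<^sub>1 (pure_tensor R H M b x)) (\<rho>\<^sub>2 (pure_tensor R H N a y)))) (\<Delta> h)"
proof -
  note modules = multilinear H M N P
  have HH: "module R (H \<boxtimes>[R] H)" and MN: "module R (M \<boxtimes>[R] N)"
    and HM: "module R (H \<boxtimes>[R] M)" and HN: "module R (H \<boxtimes>[R] N)" by (rule modules)+
  note \<Delta>h = linear_closed[OF \<Delta> h]
  have xy: "pure_tensor R M N x y \<in> carrier (M \<boxtimes>[R] N)" by (rule modules x y)+
  let ?\<psi> = "\<lambda>s. f (tensor_map R M N \<rho>\<^sub>1 \<rho>\<^sub>2 (middle_flip R H H M N
      (pure_tensor R (H \<boxtimes>[R] H) (M \<boxtimes>[R] N) s (pure_tensor R M N x y))))"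
  have \<psi>: "?\<psi> \<in> linear_maps R (H \<boxtimes>[R] H) P"
    by (assumption | rule linear_comp[OF f] linear_comp[OF linear_tensor_map[OF HM HN M N \<rho>1 \<rho>2]]
        linear_comp[OF linear_middle_flip[OF H H M N]] modules x y)+
  have flip: "tensor_flip R H H \<circ> \<Delta> \<in> linear_maps R H (H \<boxtimes>[R] H)"
    by (rule linear_o linear_tensor_flip H \<Delta>)+
  have "f (tensor_action R H \<Delta> M N \<rho>\<^sub>1 \<rho>\<^sub>2 (pure_tensor R H (M \<boxtimes>[R] N) h (pure_tensor R M N x y)))
      = ?\<psi> (tensor_lift R (H \<boxtimes>[R] H) (\<lambda>a b. pure_tensor R H H b a) (\<Delta> h))"
    by (simp add: tensor_action_def tensor_map_pure[OF H MN HH MN flip linear_id h xy])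
       (simp add: tensor_flip_def)
  also have "\<dots> = tensor_lift R P (\<lambda>a b. ?\<psi> (pure_tensor R H H b a)) (\<Delta> h)"
    by (rule tensor_lift_hom[OF \<psi> \<Delta>h]) (assumption | rule modules)+
  also have "\<dots> = tensor_lift R P (\<lambda>a b. f (pure_tensor R M N
        (\<rho>\<^sub>1 (pure_tensor R H M b x)) (\<rho>\<^sub>2 (pure_tensor R H N a y)))) (\<Delta> h)"
    by (rule tensor_lift_cong[OF H H \<Delta>h])
       (simp add: middle_flip_pure[OF H H M N] x y tensor_map_pure[OF HM HN M N \<rho>1 \<rho>2]
         pure_tensor_closed H M N)
  finally show ?thesis .
qed

lemma linear_tensor_coaction:
  assumes H: "module R H" and M: "module R M" and N: "module R N"
    and \<mu>: "\<mu> \<in> linear_maps R (H \<boxtimes>[R] H) H"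
    and \<delta>1: "\<delta>\<^sub>1 \<in> linear_maps R M (M \<boxtimes>[R] H)" and \<delta>2: "\<delta>\<^sub>2 \<in> linear_maps R N (N \<boxtimes>[R] H)"
  shows "tensor_coaction R H \<mu> M N \<delta>\<^sub>1 \<delta>\<^sub>2 \<in> linear_maps R (M \<boxtimes>[R] N) ((M \<boxtimes>[R] N) \<boxtimes>[R] H)"
  unfolding tensor_coaction_def
  by (rule linear_o linear_tensor_map linear_middle_flip linear_id tensor_is_module assms)+

text \<open>
  The formula \<open>x \<otimes> y \<mapsto> (x\<^sub>0 \<otimes> y\<^sub>0) \<otimes> x\<^sub>1 y\<^sub>1\<close>, with the components inserted into a bilinear term.
\<close>

lemma tensor_coaction_lift:
  fixes P :: "('a, 'p, 'z) module_scheme"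
  assumes H: "module R H" and M: "module R M" and N: "module R N" and P: "module R P"
    and \<mu>: "\<mu> \<in> linear_maps R (H \<boxtimes>[R] H) H"
    and \<delta>1: "\<delta>\<^sub>1 \<in> linear_maps R M (M \<boxtimes>[R] H)" and \<delta>2: "\<delta>\<^sub>2 \<in> linear_maps R N (N \<boxtimes>[R] H)"
    and \<beta>: "(\<lambda>t q. \<beta> t q) \<in> bilinear_maps R (M \<boxtimes>[R] N) H P"
    and x: "x \<in> carrier M" and y: "y \<in> carrier N"
  shows "tensor_lift R P (\<lambda>t q. \<beta> t q) (tensor_coaction R H \<mu> M N \<delta>\<^sub>1 \<delta>\<^sub>2 (pure_tensor R M N x y))
    = tensor_lift R P (\<lambda>p q. tensor_lift R P (\<lambda>u v.
        \<beta> (pure_tensor R M N p u) (\<mu> (pure_tensor R H H q v))) (\<delta>\<^sub>2 y)) (\<delta>\<^sub>1 x)"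
proof -
  note modules = multilinear H M N P linear_comp[OF \<mu>] linear_closed[OF \<mu>]
  have MH: "module R (M \<boxtimes>[R] H)" and MN: "module R (M \<boxtimes>[R] N)" and NH: "module R (N \<boxtimes>[R] H)"
    by (rule modules)+
  let ?Q = "(M \<boxtimes>[R] N) \<boxtimes>[R] H"
  note \<delta>x = linear_closed[OF \<delta>1 x] and \<delta>y = linear_closed[OF \<delta>2 y]
  note \<phi> = tensor_lift_linear[OF MN H P \<beta>] and \<phi>_pure = tensor_lift_pure[OF MN H P \<beta>]
  have "tensor_lift R P \<beta> (tensor_coaction R H \<mu> M N \<delta>\<^sub>1 \<delta>\<^sub>2 (pure_tensor R M N x y))
      = tensor_lift R P \<beta> (tensor_lift R ?Q (\<lambda>p q. tensor_lift R ?Q (\<lambda>u v.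
        pure_tensor R (M \<boxtimes>[R] N) H (pure_tensor R M N p u) (\<mu> (pure_tensor R H H q v))) (\<delta>\<^sub>2 y)) (\<delta>\<^sub>1 x))"
    by (simp add: tensor_coaction_def tensor_map_pure[OF M N MH NH \<delta>1 \<delta>2 x y]
        tensor_map_middle_flip[OF M H N H MN H linear_id \<mu> \<delta>x \<delta>y])
  also have "\<dots> = tensor_lift R P (\<lambda>p q. tensor_lift R P \<beta> (tensor_lift R ?Q (\<lambda>u v.
        pure_tensor R (M \<boxtimes>[R] N) H (pure_tensor R M N p u) (\<mu> (pure_tensor R H H q v))) (\<delta>\<^sub>2 y))) (\<delta>\<^sub>1 x)"
    by (rule tensor_lift_hom[OF \<phi> \<delta>x]) (assumption | rule modules \<delta>y)+
  also have "\<dots> = tensor_lift R P (\<lambda>p q. tensor_lift R P (\<lambda>u v. tensor_lift R P \<beta>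
        (pure_tensor R (M \<boxtimes>[R] N) H (pure_tensor R M N p u) (\<mu> (pure_tensor R H H q v)))) (\<delta>\<^sub>2 y)) (\<delta>\<^sub>1 x)"
    by (rule tensor_lift_cong[OF M H \<delta>x], rule tensor_lift_hom[OF \<phi> \<delta>y]) (assumption | rule modules)+
  also have "\<dots> = tensor_lift R P (\<lambda>p q. tensor_lift R P (\<lambda>u v.
        \<beta> (pure_tensor R M N p u) (\<mu> (pure_tensor R H H q v))) (\<delta>\<^sub>2 y)) (\<delta>\<^sub>1 x)"
    by (rule tensor_lift_cong[OF M H \<delta>x], rule tensor_lift_cong[OF N H \<delta>y])
       (assumption | rule modules \<phi>_pure)+
  finally show ?thesis .
qed

end

context bialgebra
begin

lemma H_module: "module R H" ..

lemmas bialgebra_multilinear = multilinear H_module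
  linear_comp[OF mult_linear] linear_closed[OF mult_linear]
  linear_comp[OF comult_linear] linear_closed[OF comult_linear]
  linear_comp[OF counit_linear] linear_closed[OF counit_linear]

lemma unit_closed: "\<eta> \<one> \<in> carrier H"
  using linear_closed[OF unit_linear] by (simp add: scalar_module_def)

lemma mult_assoc_pure:
  assumes a: "a \<in> carrier H" and b: "b \<in> carrier H" and c: "c \<in> carrier H"
  shows "\<mu> (pure_tensor R H H (\<mu> (pure_tensor R H H a b)) c)
    = \<mu> (pure_tensor R H H a (\<mu> (pure_tensor R H H b c)))"
proof -
  note H = H_module
  have ab: "pure_tensor R H H a b \<in> carrier (H \<boxtimes>[R] H)" and bc: "pure_tensor R H H b c \<in> carrier (H \<boxtimes>[R] H)"
    and HH: "module R (H \<boxtimes>[R] H)"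
    by (rule multilinear H a b c)+
  have "pure_tensor R (H \<boxtimes>[R] H) H (pure_tensor R H H a b) c \<in> carrier ((H \<boxtimes>[R] H) \<boxtimes>[R] H)"
    by (rule multilinear H a b c)+
  from bspec[OF mult_assoc this] show ?thesis
    by (simp only: comp_apply id_apply tensor_map_pure[OF HH H H H mult_linear linear_id ab c]
        tensor_assoc_pure[OF H H H a b c] tensor_map_pure[OF H HH H H linear_id mult_linear a bc])
qed

text \<open>
  Multiplicativity \<open>\<Delta>(a b) = a\<^sub>1 b\<^sub>1 \<otimes> a\<^sub>2 b\<^sub>2\<close>, with the components inserted into a bilinear term.
\<close>

lemma comult_mult_lift:
  fixes P :: "('a, 'p, 'z) module_scheme"
  assumes P: "module R P" and a: "a \<in> carrier H" and b: "b \<in> carrier H"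
    and \<beta>: "(\<lambda>u v. \<beta> u v) \<in> bilinear_maps R H H P"
  shows "tensor_lift R P (\<lambda>u v. \<beta> u v) (\<Delta> (\<mu> (pure_tensor R H H a b)))
    = tensor_lift R P (\<lambda>p q. tensor_lift R P (\<lambda>u v.
        \<beta> (\<mu> (pure_tensor R H H p u)) (\<mu> (pure_tensor R H H q v))) (\<Delta> b)) (\<Delta> a)"
proof -
  have ab: "pure_tensor R H H a b \<in> carrier (H \<boxtimes>[R] H)"
    by (rule multilinear H_module a b)+
  note H = H_module
  note modules = bialgebra_multilinear P
  have HH: "module R (H \<boxtimes>[R] H)" by (rule modules)+
  note \<Delta>a = linear_closed[OF comult_linear a] and \<Delta>b = linear_closed[OF comult_linear b]
  note \<phi> = tensor_lift_linear[OF H H P \<beta>] and \<phi>_pure = tensor_lift_pure[OF H H P \<beta>]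
  have "tensor_lift R P \<beta> (\<Delta> (\<mu> (pure_tensor R H H a b)))
      = tensor_lift R P \<beta> (tensor_lift R (H \<boxtimes>[R] H) (\<lambda>p q. tensor_lift R (H \<boxtimes>[R] H) (\<lambda>u v.
          pure_tensor R H H (\<mu> (pure_tensor R H H p u)) (\<mu> (pure_tensor R H H q v))) (\<Delta> b)) (\<Delta> a))"
    using bspec[OF comult_mult ab]
    by (simp add: tensor_map_pure[OF H H HH HH comult_linear comult_linear a b]
        tensor_map_middle_flip[OF H H H H H H mult_linear mult_linear \<Delta>a \<Delta>b])
  also have "\<dots> = tensor_lift R P (\<lambda>p q. tensor_lift R P \<beta> (tensor_lift R (H \<boxtimes>[R] H) (\<lambda>u v.
          pure_tensor R H H (\<mu> (pure_tensor R H H p u)) (\<mu> (pure_tensor R H H q v))) (\<Delta> b))) (\<Delta> a)"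
    by (rule tensor_lift_hom[OF \<phi> \<Delta>a]) (assumption | rule modules \<Delta>b)+
  also have "\<dots> = tensor_lift R P (\<lambda>p q. tensor_lift R P (\<lambda>u v. tensor_lift R P \<beta>
          (pure_tensor R H H (\<mu> (pure_tensor R H H p u)) (\<mu> (pure_tensor R H H q v)))) (\<Delta> b)) (\<Delta> a)"
    by (rule tensor_lift_cong[OF H H \<Delta>a], rule tensor_lift_hom[OF \<phi> \<Delta>b]) (assumption | rule modules)+
  also have "\<dots> = tensor_lift R P (\<lambda>p q. tensor_lift R P (\<lambda>u v.
        \<beta> (\<mu> (pure_tensor R H H p u)) (\<mu> (pure_tensor R H H q v))) (\<Delta> b)) (\<Delta> a)"
    by (rule tensor_lift_cong[OF H H \<Delta>a], rule tensor_lift_cong[OF H H \<Delta>b])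
       (assumption | rule modules \<phi>_pure)+
  finally show ?thesis .
qed

lemma counit_mult_pure:
  assumes a: "a \<in> carrier H" and b: "b \<in> carrier H"
  shows "\<epsilon> (\<mu> (pure_tensor R H H a b)) = \<epsilon> a \<otimes> \<epsilon> b"
proof -
  note S = scalar_module_is_module and H = H_module
  have "pure_tensor R H H a b \<in> carrier (H \<boxtimes>[R] H)"
    by (rule multilinear H a b)+
  from bspec[OF counit_mult this] show ?thesis
    by (simp add: tensor_map_pure[OF H H S S counit_linear counit_linear a b] tensor_lunit_pure[OF S]
        linear_closed[OF counit_linear] a b) (simp add: scalar_module_def)
qed

lemma action_mult_pure:
  assumes "left_action R H \<mu> \<eta> M \<rho>"
    and a: "a \<in> carrier H" and b: "b \<in> carrier H" and x: "x \<in> carrier M"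
  shows "\<rho> (pure_tensor R H M (\<mu> (pure_tensor R H H a b)) x)
    = \<rho> (pure_tensor R H M a (\<rho> (pure_tensor R H M b x)))"
proof -
  note H = H_module and M = left_action.axioms(2)[OF assms(1)]
  note \<rho> = left_action.action_linear[OF assms(1)]
  have ab: "pure_tensor R H H a b \<in> carrier (H \<boxtimes>[R] H)" and bx: "pure_tensor R H M b x \<in> carrier (H \<boxtimes>[R] M)"
    and HH: "module R (H \<boxtimes>[R] H)" and HM: "module R (H \<boxtimes>[R] M)"
    by (rule multilinear H M a b x)+
  have "pure_tensor R (H \<boxtimes>[R] H) M (pure_tensor R H H a b) x \<in> carrier ((H \<boxtimes>[R] H) \<boxtimes>[R] M)"
    by (rule multilinear H M a b x)+
  from bspec[OF left_action.action_mult[OF assms(1)] this] show ?thesis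
    by (simp only: comp_apply id_apply tensor_map_pure[OF HH M H M mult_linear linear_id ab x]
        tensor_assoc_pure[OF H H M a b x] tensor_map_pure[OF H HM H M linear_id \<rho> a bx])
qed

lemma action_unit_pure:
  assumes "left_action R H \<mu> \<eta> M \<rho>" and x: "x \<in> carrier M"
  shows "\<rho> (pure_tensor R H M (\<eta> \<one>) x) = x"
proof -
  note S = scalar_module_is_module and H = H_module and M = left_action.axioms(2)[OF assms(1)]
  have one: "\<one> \<in> carrier (scalar_module R)" by (simp add: scalar_module_def)
  have "pure_tensor R (scalar_module R) M \<one> x \<in> carrier (scalar_module R \<boxtimes>[R] M)"
    by (rule multilinear M x one)+
  from bspec[OF left_action.action_unit[OF assms(1)] this] show ?thesis
    by (simp only: comp_apply id_apply tensor_map_pure[OF S M H M unit_linear linear_id one x]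
        tensor_lunit_pure[OF M one x] module.smult_one[OF M x])
qed

text \<open>
  Associativity is the calculation \<open>(a b)(x \<otimes> y) = a\<^sub>2 (b\<^sub>2 x) \<otimes> a\<^sub>1 (b\<^sub>1 y) = a(b(x \<otimes> y))\<close> from \<open>\<Delta>(a b) = \<Delta> a \<Delta> b\<close> and
  exchanging the two sums. The unit acts trivially because \<open>\<Delta> 1 = 1 \<otimes> 1\<close>.
\<close>

proposition left_action_tensor:
  fixes M :: "('a, 'm, 'y) module_scheme" and N :: "('a, 'n, 'z) module_scheme"
  assumes A1: "left_action R H \<mu> \<eta> M \<rho>\<^sub>1" and A2: "left_action R H \<mu> \<eta> N \<rho>\<^sub>2"
  shows "left_action R H \<mu> \<eta> (M \<boxtimes>[R] N) (tensor_action R H \<Delta> M N \<rho>\<^sub>1 \<rho>\<^sub>2)"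
    (is "left_action R H \<mu> \<eta> ?P ?\<rho>")
proof (rule left_actionI[OF unital_algebra_axioms])
  note H = H_module and M = left_action.axioms(2)[OF A1] and N = left_action.axioms(2)[OF A2]
  note \<rho>1 = left_action.action_linear[OF A1] and \<rho>2 = left_action.action_linear[OF A2]
  show P: "module R ?P" by (rule tensor_is_module[OF M N])
  show \<rho>: "?\<rho> \<in> linear_maps R (H \<boxtimes>[R] ?P) ?P"
    by (rule linear_tensor_action[OF H M N comult_linear \<rho>1 \<rho>2])
  note modules = bialgebra_multilinear M N linear_comp[OF \<rho>1] linear_closed[OF \<rho>1]
    linear_comp[OF \<rho>2] linear_closed[OF \<rho>2] linear_comp[OF \<rho>] linear_closed[OF \<rho>]
  note \<rho>_hom = tensor_action_hom[OF H M N _ comult_linear \<rho>1 \<rho>2]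
  note \<rho>_pure = \<rho>_hom[OF P linear_ident]
  fix t assume t: "t \<in> carrier ?P"
  show "?\<rho> (pure_tensor R H ?P (\<eta> \<one>) t) = t"
  proof (rule tensor_ext[OF M N P _ linear_ident _ t])
    show "(\<lambda>t. ?\<rho> (pure_tensor R H ?P (\<eta> \<one>) t)) \<in> linear_maps R ?P ?P"
      by (assumption | rule modules unit_closed)+
    fix x y assume x: "x \<in> carrier M" and y: "y \<in> carrier N"
    have \<beta>: "(\<lambda>a b. pure_tensor R M N (\<rho>\<^sub>1 (pure_tensor R H M b x)) (\<rho>\<^sub>2 (pure_tensor R H N a y)))
        \<in> bilinear_maps R H H ?P"
      by (assumption | rule modules x y)+
    show "?\<rho> (pure_tensor R H ?P (\<eta> \<one>) (pure_tensor R M N x y)) = pure_tensor R M N x y"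
      by (simp add: \<rho>_pure[OF unit_closed x y] comult_unit tensor_lift_pure[OF H H P \<beta>] unit_closed
          action_unit_pure[OF A1 x] action_unit_pure[OF A2 y])
  qed
  fix a b assume a: "a \<in> carrier H" and b: "b \<in> carrier H"
  let ?m = "\<lambda>u v. \<mu> (pure_tensor R H H u v)"
  show "?\<rho> (pure_tensor R H ?P (?m a b) t) = ?\<rho> (pure_tensor R H ?P a (?\<rho> (pure_tensor R H ?P b t)))"
  proof (rule tensor_ext[OF M N P _ _ _ t])
    show "(\<lambda>t. ?\<rho> (pure_tensor R H ?P (?m a b) t)) \<in> linear_maps R ?P ?P"
      by (assumption | rule modules a b)+
    show "(\<lambda>t. ?\<rho> (pure_tensor R H ?P a (?\<rho> (pure_tensor R H ?P b t)))) \<in> linear_maps R ?P ?P"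
      by (assumption | rule modules a b)+
    have a_lin: "(\<lambda>t. ?\<rho> (pure_tensor R H ?P a t)) \<in> linear_maps R ?P ?P"
      by (assumption | rule modules a)+
    note \<Delta>a = linear_closed[OF comult_linear a] and \<Delta>b = linear_closed[OF comult_linear b]
    fix x y assume x: "x \<in> carrier M" and y: "y \<in> carrier N"
    have ab: "?m a b \<in> carrier H" by (rule modules a b)+
    have "?\<rho> (pure_tensor R H ?P (?m a b) (pure_tensor R M N x y))
        = tensor_lift R ?P (\<lambda>u v. pure_tensor R M N
            (\<rho>\<^sub>1 (pure_tensor R H M v x)) (\<rho>\<^sub>2 (pure_tensor R H N u y))) (\<Delta> (?m a b))"
      by (rule \<rho>_pure[OF ab x y])
    also have "\<dots> = tensor_lift R ?P (\<lambda>p q. tensor_lift R ?P (\<lambda>u v. pure_tensor R M N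
            (\<rho>\<^sub>1 (pure_tensor R H M (?m q v) x)) (\<rho>\<^sub>2 (pure_tensor R H N (?m p u) y))) (\<Delta> b)) (\<Delta> a)"
      by (rule comult_mult_lift[OF P a b]) (assumption | rule modules x y)+
    also have "\<dots> = tensor_lift R ?P (\<lambda>p q. tensor_lift R ?P (\<lambda>u v. pure_tensor R M N
            (\<rho>\<^sub>1 (pure_tensor R H M q (\<rho>\<^sub>1 (pure_tensor R H M v x))))
            (\<rho>\<^sub>2 (pure_tensor R H N p (\<rho>\<^sub>2 (pure_tensor R H N u y))))) (\<Delta> b)) (\<Delta> a)"
      by (rule tensor_lift_cong[OF H H \<Delta>a], rule tensor_lift_cong[OF H H \<Delta>b])
         (simp add: action_mult_pure[OF A1] action_mult_pure[OF A2] x y)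
    also have "\<dots> = tensor_lift R ?P (\<lambda>u v. tensor_lift R ?P (\<lambda>p q. pure_tensor R M N
            (\<rho>\<^sub>1 (pure_tensor R H M q (\<rho>\<^sub>1 (pure_tensor R H M v x))))
            (\<rho>\<^sub>2 (pure_tensor R H N p (\<rho>\<^sub>2 (pure_tensor R H N u y))))) (\<Delta> a)) (\<Delta> b)"
      by (rule tensor_lift_swap[OF \<Delta>a \<Delta>b]) (assumption | rule modules x y)+
    also have "\<dots> = tensor_lift R ?P (\<lambda>u v. ?\<rho> (pure_tensor R H ?P a (pure_tensor R M N
            (\<rho>\<^sub>1 (pure_tensor R H M v x)) (\<rho>\<^sub>2 (pure_tensor R H N u y))))) (\<Delta> b)"
      by (rule tensor_lift_cong[OF H H \<Delta>b], rule \<rho>_pure[symmetric, OF a]) (assumption | rule modules x y)+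
    also have "\<dots> = ?\<rho> (pure_tensor R H ?P a (?\<rho> (pure_tensor R H ?P b (pure_tensor R M N x y))))"
      by (rule \<rho>_hom[OF P a_lin b x y, symmetric])
    finally show "?\<rho> (pure_tensor R H ?P (?m a b) (pure_tensor R M N x y))
        = ?\<rho> (pure_tensor R H ?P a (?\<rho> (pure_tensor R H ?P b (pure_tensor R M N x y))))" .
  qed
qed

text \<open>
  Applying coassociativity of \<open>M\<close> and of \<open>N\<close> to \<open>(x\<^sub>0\<^sub>0 \<otimes> y\<^sub>0\<^sub>0) \<otimes> (x\<^sub>0\<^sub>1 y\<^sub>0\<^sub>1 \<otimes> x\<^sub>1 y\<^sub>1)\<close> gives
  \<open>(x\<^sub>0 \<otimes> y\<^sub>0) \<otimes> (x\<^sub>1\<^sub>1 y\<^sub>1\<^sub>1 \<otimes> x\<^sub>1\<^sub>2 y\<^sub>1\<^sub>2)\<close>, and the last factor is \<open>\<Delta>(x\<^sub>1 y\<^sub>1)\<close>. The counit is handled by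
  \<open>\<epsilon>(x\<^sub>1 y\<^sub>1) = \<epsilon>(x\<^sub>1) \<epsilon>(y\<^sub>1)\<close>, which lets the two sums be evaluated one after the other.
\<close>

proposition right_coaction_tensor:
  fixes M :: "('a, 'm, 'y) module_scheme" and N :: "('a, 'n, 'z) module_scheme"
  assumes C1: "right_coaction R H \<Delta> \<epsilon> M \<delta>\<^sub>1" and C2: "right_coaction R H \<Delta> \<epsilon> N \<delta>\<^sub>2"
  shows "right_coaction R H \<Delta> \<epsilon> (M \<boxtimes>[R] N) (tensor_coaction R H \<mu> M N \<delta>\<^sub>1 \<delta>\<^sub>2)"
    (is "right_coaction R H \<Delta> \<epsilon> ?P ?\<delta>")
proof (rule right_coactionI)
  note H = H_module and M = right_coaction.axioms(2)[OF C1] and N = right_coaction.axioms(2)[OF C2]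
  note \<delta>1 = right_coaction.coaction_linear[OF C1] and \<delta>2 = right_coaction.coaction_linear[OF C2]
  show P: "module R ?P" by (rule tensor_is_module[OF M N])
  show \<delta>: "?\<delta> \<in> linear_maps R ?P (?P \<boxtimes>[R] H)"
    by (rule linear_tensor_coaction[OF H M N mult_linear \<delta>1 \<delta>2])
  note modules = bialgebra_multilinear M N linear_comp[OF \<delta>1] linear_closed[OF \<delta>1]
    linear_comp[OF \<delta>2] linear_closed[OF \<delta>2] linear_comp[OF \<delta>] linear_closed[OF \<delta>]
  note \<delta>_lift = tensor_coaction_lift[OF H M N _ mult_linear \<delta>1 \<delta>2]
  let ?m = "\<lambda>u v. \<mu> (pure_tensor R H H u v)"
  fix t assume t: "t \<in> carrier ?P"
  show "tensor_lift R ?P (\<lambda>p q. \<epsilon> q \<odot>\<^bsub>?P\<^esub> p) (?\<delta> t) = t"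
  proof (rule tensor_ext[OF M N P _ linear_ident _ t])
    show "(\<lambda>t. tensor_lift R ?P (\<lambda>p q. \<epsilon> q \<odot>\<^bsub>?P\<^esub> p) (?\<delta> t)) \<in> linear_maps R ?P ?P"
      by (assumption | rule modules)+
    fix x y assume x: "x \<in> carrier M" and y: "y \<in> carrier N"
    note \<delta>x = linear_closed[OF \<delta>1 x] and \<delta>y = linear_closed[OF \<delta>2 y]
    have y_lin: "(\<lambda>p. pure_tensor R M N p y) \<in> linear_maps R M ?P"
      by (assumption | rule modules y)+
    have "tensor_lift R ?P (\<lambda>p q. \<epsilon> q \<odot>\<^bsub>?P\<^esub> p) (?\<delta> (pure_tensor R M N x y))
        = tensor_lift R ?P (\<lambda>p q. tensor_lift R ?P (\<lambda>u v.
            \<epsilon> (?m q v) \<odot>\<^bsub>?P\<^esub> pure_tensor R M N p u) (\<delta>\<^sub>2 y)) (\<delta>\<^sub>1 x)"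
      by (rule \<delta>_lift[OF P _ x y]) (assumption | rule modules)+
    also have "\<dots> = tensor_lift R ?P (\<lambda>p q. tensor_lift R ?P (\<lambda>u v.
            pure_tensor R M N (\<epsilon> q \<odot>\<^bsub>M\<^esub> p) (\<epsilon> v \<odot>\<^bsub>N\<^esub> u)) (\<delta>\<^sub>2 y)) (\<delta>\<^sub>1 x)"
    proof (rule tensor_lift_cong[OF M H \<delta>x], rule tensor_lift_cong[OF N H \<delta>y])
      fix p q u v assume "p \<in> carrier M" "u \<in> carrier N" and q: "q \<in> carrier H" and v: "v \<in> carrier H"
      moreover have "\<epsilon> q \<in> carrier R" "\<epsilon> v \<in> carrier R"
        using linear_closed[OF counit_linear] q v by (simp_all add: scalar_module_def)
      moreover from this have "\<epsilon> (?m q v) = \<epsilon> v \<otimes> \<epsilon> q"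
        by (simp add: counit_mult_pure q v m_comm)
      ultimately show "\<epsilon> (?m q v) \<odot>\<^bsub>?P\<^esub> pure_tensor R M N p u
          = pure_tensor R M N (\<epsilon> q \<odot>\<^bsub>M\<^esub> p) (\<epsilon> v \<odot>\<^bsub>N\<^esub> u)"
        using M N P
        by (simp add: module.smult_assoc1[OF P] pure_tensor_closed module.smult_closed
            linear_smult[OF bilinear_left[OF pure_tensor_bilinear]]
            linear_smult[OF bilinear_right[OF pure_tensor_bilinear]])
    qed
    also have "\<dots> = tensor_lift R ?P (\<lambda>p q. pure_tensor R M N (\<epsilon> q \<odot>\<^bsub>M\<^esub> p) y) (\<delta>\<^sub>1 x)"
    proof (rule tensor_lift_cong[OF M H \<delta>x])
      fix p q assume p: "p \<in> carrier M" and q: "q \<in> carrier H"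
      have lin: "(\<lambda>u. pure_tensor R M N (\<epsilon> q \<odot>\<^bsub>M\<^esub> p) u) \<in> linear_maps R N ?P"
        by (assumption | rule modules p q)+
      have "tensor_lift R ?P (\<lambda>u v. pure_tensor R M N (\<epsilon> q \<odot>\<^bsub>M\<^esub> p) (\<epsilon> v \<odot>\<^bsub>N\<^esub> u)) (\<delta>\<^sub>2 y)
          = pure_tensor R M N (\<epsilon> q \<odot>\<^bsub>M\<^esub> p) (tensor_lift R N (\<lambda>u v. \<epsilon> v \<odot>\<^bsub>N\<^esub> u) (\<delta>\<^sub>2 y))"
        by (rule tensor_lift_hom[OF lin \<delta>y, symmetric]) (assumption | rule modules)+
      then show "tensor_lift R ?P (\<lambda>u v. pure_tensor R M N (\<epsilon> q \<odot>\<^bsub>M\<^esub> p) (\<epsilon> v \<odot>\<^bsub>N\<^esub> u)) (\<delta>\<^sub>2 y)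
          = pure_tensor R M N (\<epsilon> q \<odot>\<^bsub>M\<^esub> p) y"
        by (simp only: right_coaction.counit_lift[OF C2 y])
    qed
    also have "\<dots> = pure_tensor R M N (tensor_lift R M (\<lambda>p q. \<epsilon> q \<odot>\<^bsub>M\<^esub> p) (\<delta>\<^sub>1 x)) y"
      by (rule tensor_lift_hom[OF y_lin \<delta>x, symmetric]) (assumption | rule modules)+
    also have "\<dots> = pure_tensor R M N x y"
      by (simp only: right_coaction.counit_lift[OF C1 x])
    finally show "tensor_lift R ?P (\<lambda>p q. \<epsilon> q \<odot>\<^bsub>?P\<^esub> p) (?\<delta> (pure_tensor R M N x y)) = pure_tensor R M N x y" .
  qed
  let ?T = "?P \<boxtimes>[R] (H \<boxtimes>[R] H)"
  let ?t = "\<lambda>p q r s. pure_tensor R ?P (H \<boxtimes>[R] H) (pure_tensor R M N p q) (pure_tensor R H H r s)"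
  have T: "module R ?T" by (rule modules)+
  show "tensor_lift R ?T (\<lambda>p q. tensor_lift R ?T
        (\<lambda>u v. pure_tensor R ?P (H \<boxtimes>[R] H) u (pure_tensor R H H v q)) (?\<delta> p)) (?\<delta> t)
      = tensor_lift R ?T (\<lambda>p q. tensor_lift R ?T
        (\<lambda>u v. pure_tensor R ?P (H \<boxtimes>[R] H) p (pure_tensor R H H u v)) (\<Delta> q)) (?\<delta> t)"
  proof (rule tensor_ext[OF M N T _ _ _ t])
    show "(\<lambda>t. tensor_lift R ?T (\<lambda>p q. tensor_lift R ?T
          (\<lambda>u v. pure_tensor R ?P (H \<boxtimes>[R] H) u (pure_tensor R H H v q)) (?\<delta> p)) (?\<delta> t))
        \<in> linear_maps R ?P ?T"
      by (assumption | rule modules)+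
    show "(\<lambda>t. tensor_lift R ?T (\<lambda>p q. tensor_lift R ?T
          (\<lambda>u v. pure_tensor R ?P (H \<boxtimes>[R] H) p (pure_tensor R H H u v)) (\<Delta> q)) (?\<delta> t))
        \<in> linear_maps R ?P ?T"
      by (assumption | rule modules)+
    fix x y assume x: "x \<in> carrier M" and y: "y \<in> carrier N"
    note \<delta>x = linear_closed[OF \<delta>1 x] and \<delta>y = linear_closed[OF \<delta>2 y]
    have "tensor_lift R ?T (\<lambda>p q. tensor_lift R ?T
          (\<lambda>u v. pure_tensor R ?P (H \<boxtimes>[R] H) u (pure_tensor R H H v q)) (?\<delta> p)) (?\<delta> (pure_tensor R M N x y))
        = tensor_lift R ?T (\<lambda>p q. tensor_lift R ?T (\<lambda>u v. tensor_lift R ?T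
            (\<lambda>s r. pure_tensor R ?P (H \<boxtimes>[R] H) s (pure_tensor R H H r (?m q v)))
            (?\<delta> (pure_tensor R M N p u))) (\<delta>\<^sub>2 y)) (\<delta>\<^sub>1 x)"
      by (rule \<delta>_lift[OF T _ x y]) (assumption | rule modules)+
    also have "\<dots> = tensor_lift R ?T (\<lambda>p q. tensor_lift R ?T (\<lambda>u v. tensor_lift R ?T (\<lambda>p' q'.
            tensor_lift R ?T (\<lambda>u' v'. ?t p' u' (?m q' v') (?m q v)) (\<delta>\<^sub>2 u)) (\<delta>\<^sub>1 p)) (\<delta>\<^sub>2 y)) (\<delta>\<^sub>1 x)"
      by (rule tensor_lift_cong[OF M H \<delta>x], rule tensor_lift_cong[OF N H \<delta>y], rule \<delta>_lift[OF T])
         (assumption | rule modules)+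
    \<comment> \<open>Brings the two coactions of \<open>M\<close> next to each other, which leaves those of \<open>N\<close> together as well.\<close>
    also have "\<dots> = tensor_lift R ?T (\<lambda>p q. tensor_lift R ?T (\<lambda>p' q'. tensor_lift R ?T (\<lambda>u v.
            tensor_lift R ?T (\<lambda>u' v'. ?t p' u' (?m q' v') (?m q v)) (\<delta>\<^sub>2 u)) (\<delta>\<^sub>2 y)) (\<delta>\<^sub>1 p)) (\<delta>\<^sub>1 x)"
      by (rule tensor_lift_cong[OF M H \<delta>x], rule tensor_lift_swap[OF \<delta>y]) (assumption | rule modules)+
    also have "\<dots> = tensor_lift R ?T (\<lambda>p q. tensor_lift R ?T (\<lambda>q' q''. tensor_lift R ?T (\<lambda>u v.
            tensor_lift R ?T (\<lambda>u' v'. ?t p u' (?m q' v') (?m q'' v)) (\<delta>\<^sub>2 u)) (\<delta>\<^sub>2 y)) (\<Delta> q)) (\<delta>\<^sub>1 x)"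
      by (rule right_coaction.coassoc_lift[OF C1 T x]) (assumption | rule modules \<delta>y)+
    also have "\<dots> = tensor_lift R ?T (\<lambda>p q. tensor_lift R ?T (\<lambda>q' q''. tensor_lift R ?T (\<lambda>u v.
            tensor_lift R ?T (\<lambda>v' v''. ?t p u (?m q' v') (?m q'' v'')) (\<Delta> v)) (\<delta>\<^sub>2 y)) (\<Delta> q)) (\<delta>\<^sub>1 x)"
      by (rule tensor_lift_cong[OF M H \<delta>x], rule tensor_lift_cong[OF H H],
          erule linear_closed[OF comult_linear], rule right_coaction.coassoc_lift[OF C2 T y])
         (assumption | rule modules)+
    also have "\<dots> = tensor_lift R ?T (\<lambda>p q. tensor_lift R ?T (\<lambda>u v. tensor_lift R ?T (\<lambda>q' q''.
            tensor_lift R ?T (\<lambda>v' v''. ?t p u (?m q' v') (?m q'' v'')) (\<Delta> v)) (\<Delta> q)) (\<delta>\<^sub>2 y)) (\<delta>\<^sub>1 x)"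
      by (rule tensor_lift_cong[OF M H \<delta>x], rule tensor_lift_swap[OF _ \<delta>y]) (assumption | rule modules)+
    also have "\<dots> = tensor_lift R ?T (\<lambda>p q. tensor_lift R ?T (\<lambda>u v. tensor_lift R ?T (\<lambda>r s.
            ?t p u r s) (\<Delta> (?m q v))) (\<delta>\<^sub>2 y)) (\<delta>\<^sub>1 x)"
      by (rule tensor_lift_cong[OF M H \<delta>x], rule tensor_lift_cong[OF N H \<delta>y],
          rule comult_mult_lift[OF T, symmetric]) (assumption | rule modules)+
    also have "\<dots> = tensor_lift R ?T (\<lambda>p q. tensor_lift R ?T
          (\<lambda>u v. pure_tensor R ?P (H \<boxtimes>[R] H) p (pure_tensor R H H u v)) (\<Delta> q)) (?\<delta> (pure_tensor R M N x y))"
      by (rule \<delta>_lift[OF T _ x y, symmetric]) (assumption | rule modules)+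
    finally show "tensor_lift R ?T (\<lambda>p q. tensor_lift R ?T
          (\<lambda>u v. pure_tensor R ?P (H \<boxtimes>[R] H) u (pure_tensor R H H v q)) (?\<delta> p)) (?\<delta> (pure_tensor R M N x y))
        = tensor_lift R ?T (\<lambda>p q. tensor_lift R ?T
          (\<lambda>u v. pure_tensor R ?P (H \<boxtimes>[R] H) p (pure_tensor R H H u v)) (\<Delta> q))
          (?\<delta> (pure_tensor R M N x y))" .
  qed
qed

text \<open>
  The chain of equations in the proof is the calculation with three components \<open>h\<^sub>1, h\<^sub>2, h\<^sub>3\<close> of \<open>h\<close>. An
  iterated sum has to say which of them come from the second comultiplication. Coassociativity moves
  the brackets, so that the two components that the compatibility condition of \<open>N\<close> (first \<open>h\<^sub>1, h\<^sub>2\<close>) or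
  of \<open>M\<close> (then \<open>h\<^sub>2, h\<^sub>3\<close>) talks about are the components of a single element, and exchanging sums makes
  the sum over them the one directly outside the coaction in question.
\<close>

proposition yetter_drinfeld_tensor:
  fixes M :: "('a, 'm, 'y) module_scheme" and N :: "('a, 'n, 'z) module_scheme"
  assumes Y1: "yetter_drinfeld_module R H \<mu> \<eta> \<Delta> \<epsilon> M \<rho>\<^sub>1 \<delta>\<^sub>1"
    and Y2: "yetter_drinfeld_module R H \<mu> \<eta> \<Delta> \<epsilon> N \<rho>\<^sub>2 \<delta>\<^sub>2"
  shows "yetter_drinfeld_module R H \<mu> \<eta> \<Delta> \<epsilon> (M \<boxtimes>[R] N)
    (tensor_action R H \<Delta> M N \<rho>\<^sub>1 \<rho>\<^sub>2) (tensor_coaction R H \<mu> M N \<delta>\<^sub>1 \<delta>\<^sub>2)"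
    (is "yetter_drinfeld_module R H \<mu> \<eta> \<Delta> \<epsilon> ?M ?\<rho> ?\<delta>")
proof -
  note A1 = yetter_drinfeld_module.axioms(2)[OF Y1] and C1 = yetter_drinfeld_module.axioms(3)[OF Y1]
  note A2 = yetter_drinfeld_module.axioms(2)[OF Y2] and C2 = yetter_drinfeld_module.axioms(3)[OF Y2]
  note H = H_module and M = left_action.axioms(2)[OF A1] and N = left_action.axioms(2)[OF A2]
  note \<rho>1 = left_action.action_linear[OF A1] and \<rho>2 = left_action.action_linear[OF A2]
  note \<delta>1 = right_coaction.coaction_linear[OF C1] and \<delta>2 = right_coaction.coaction_linear[OF C2]
  note A = left_action_tensor[OF A1 A2] and C = right_coaction_tensor[OF C1 C2]
  note \<rho> = left_action.action_linear[OF A] and \<delta> = right_coaction.coaction_linear[OF C]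
  have MN: "module R ?M" by (rule tensor_is_module[OF M N])
  note ops = mult_linear comult_linear \<rho> \<delta>
  note modules = bialgebra_multilinear M N
    linear_comp[OF \<rho>1] linear_closed[OF \<rho>1] linear_comp[OF \<rho>2] linear_closed[OF \<rho>2]
    linear_comp[OF \<delta>1] linear_closed[OF \<delta>1] linear_comp[OF \<delta>2] linear_closed[OF \<delta>2]
    linear_comp[OF \<rho>] linear_closed[OF \<rho>] linear_comp[OF \<delta>] linear_closed[OF \<delta>]
  note \<rho>_hom = tensor_action_hom[OF H M N _ comult_linear \<rho>1 \<rho>2]
  note \<delta>_lift = tensor_coaction_lift[OF H M N _ mult_linear \<delta>1 \<delta>2]
  note coassoc = right_coaction.coassoc_lift[OF regular_coaction]
  let ?P = "?M \<boxtimes>[R] H"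
  have P: "module R ?P" by (rule modules)+
  let ?m = "\<lambda>a b. \<mu> (pure_tensor R H H a b)"
  let ?r1 = "\<lambda>a x. \<rho>\<^sub>1 (pure_tensor R H M a x)" and ?r2 = "\<lambda>a y. \<rho>\<^sub>2 (pure_tensor R H N a y)"
  let ?g = "\<lambda>p q r. pure_tensor R ?M H (pure_tensor R M N p q) r"
  let ?l = "\<lambda>h t. tensor_lift R ?P (\<lambda>a b. tensor_lift R ?P
        (\<lambda>p q. pure_tensor R ?M H p (?m q a)) (?\<delta> (?\<rho> (pure_tensor R H ?M b t)))) (\<Delta> h)"
  let ?r = "\<lambda>h t. tensor_lift R ?P (\<lambda>a b. tensor_lift R ?P
        (\<lambda>p q. pure_tensor R ?M H (?\<rho> (pure_tensor R H ?M a p)) (?m b q)) (?\<delta> t)) (\<Delta> h)"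
  have main: "?l h (pure_tensor R M N x y) = ?r h (pure_tensor R M N x y)"
    if h: "h \<in> carrier H" and x: "x \<in> carrier M" and y: "y \<in> carrier N" for h x y
  proof -
    note \<Delta>h = linear_closed[OF comult_linear h]
    note \<delta>x = linear_closed[OF \<delta>1 x] and \<delta>y = linear_closed[OF \<delta>2 y]
    have \<delta>r1: "\<delta>\<^sub>1 (?r1 b x) \<in> carrier (M \<boxtimes>[R] H)" if "b \<in> carrier H" for b
      by (rule modules that x)+
    have "?l h (pure_tensor R M N x y)
        = tensor_lift R ?P (\<lambda>a b. tensor_lift R ?P (\<lambda>b\<^sub>1 b\<^sub>2. tensor_lift R ?P (\<lambda>p q.
            pure_tensor R ?M H p (?m q a)) (?\<delta> (pure_tensor R M N (?r1 b\<^sub>2 x) (?r2 b\<^sub>1 y)))) (\<Delta> b)) (\<Delta> h)"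
    proof (rule tensor_lift_cong[OF H H \<Delta>h])
      fix a b assume a: "a \<in> carrier H" and b: "b \<in> carrier H"
      have lin: "(\<lambda>t. tensor_lift R ?P (\<lambda>p q. pure_tensor R ?M H p (?m q a)) (?\<delta> t)) \<in> linear_maps R ?M ?P"
        by (assumption | rule modules a)+
      show "tensor_lift R ?P (\<lambda>p q. pure_tensor R ?M H p (?m q a))
            (?\<delta> (?\<rho> (pure_tensor R H ?M b (pure_tensor R M N x y))))
          = tensor_lift R ?P (\<lambda>b\<^sub>1 b\<^sub>2. tensor_lift R ?P (\<lambda>p q.
              pure_tensor R ?M H p (?m q a)) (?\<delta> (pure_tensor R M N (?r1 b\<^sub>2 x) (?r2 b\<^sub>1 y)))) (\<Delta> b)"
        by (rule \<rho>_hom[OF P lin b x y])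
    qed
    also have "\<dots> = tensor_lift R ?P (\<lambda>a b. tensor_lift R ?P (\<lambda>b\<^sub>1 b\<^sub>2.
          tensor_lift R ?P (\<lambda>p\<^sub>0 p\<^sub>1. tensor_lift R ?P (\<lambda>q\<^sub>0 q\<^sub>1. ?g p\<^sub>0 q\<^sub>0 (?m (?m p\<^sub>1 q\<^sub>1) a))
            (\<delta>\<^sub>2 (?r2 b\<^sub>1 y))) (\<delta>\<^sub>1 (?r1 b\<^sub>2 x))) (\<Delta> b)) (\<Delta> h)"
      by (rule tensor_lift_cong[OF H H \<Delta>h], rule tensor_lift_cong[OF H H],
          erule linear_closed[OF comult_linear], rule \<delta>_lift[OF P])
         (assumption | rule modules x y)+
    \<comment> \<open>Bracketing \<open>h\<^sub>1\<close> with \<open>h\<^sub>2\<close>, the element that acts on \<open>y\<close>, prepares for the condition on \<open>N\<close>.\<close>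
    also have "\<dots> = tensor_lift R ?P (\<lambda>c b\<^sub>2. tensor_lift R ?P (\<lambda>a b\<^sub>1.
          tensor_lift R ?P (\<lambda>p\<^sub>0 p\<^sub>1. tensor_lift R ?P (\<lambda>q\<^sub>0 q\<^sub>1. ?g p\<^sub>0 q\<^sub>0 (?m (?m p\<^sub>1 q\<^sub>1) a))
            (\<delta>\<^sub>2 (?r2 b\<^sub>1 y))) (\<delta>\<^sub>1 (?r1 b\<^sub>2 x))) (\<Delta> c)) (\<Delta> h)"
      by (rule coassoc[OF P h, symmetric]) (assumption | rule modules x y)+
    also have "\<dots> = tensor_lift R ?P (\<lambda>c b\<^sub>2. tensor_lift R ?P (\<lambda>p\<^sub>0 p\<^sub>1.
          tensor_lift R ?P (\<lambda>a b\<^sub>1. tensor_lift R ?P (\<lambda>q\<^sub>0 q\<^sub>1. ?g p\<^sub>0 q\<^sub>0 (?m (?m p\<^sub>1 q\<^sub>1) a))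
            (\<delta>\<^sub>2 (?r2 b\<^sub>1 y))) (\<Delta> c)) (\<delta>\<^sub>1 (?r1 b\<^sub>2 x))) (\<Delta> h)"
      by (rule tensor_lift_cong[OF H H \<Delta>h], rule tensor_lift_swap) (assumption | rule modules x y)+
    also have "\<dots> = tensor_lift R ?P (\<lambda>c b\<^sub>2. tensor_lift R ?P (\<lambda>p\<^sub>0 p\<^sub>1.
          tensor_lift R ?P (\<lambda>a b\<^sub>1. tensor_lift R ?P (\<lambda>q\<^sub>0 q\<^sub>1. ?g p\<^sub>0 (?r2 a q\<^sub>0) (?m (?m p\<^sub>1 b\<^sub>1) q\<^sub>1))
            (\<delta>\<^sub>2 y)) (\<Delta> c)) (\<delta>\<^sub>1 (?r1 b\<^sub>2 x))) (\<Delta> h)"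
    proof (rule tensor_lift_cong[OF H H \<Delta>h], rule tensor_lift_cong[OF M H \<delta>r1], assumption)
      fix c b p r assume c: "c \<in> carrier H" and b: "b \<in> carrier H" and p: "p \<in> carrier M" and r: "r \<in> carrier H"
      note \<Delta>c = linear_closed[OF comult_linear c]
      have "tensor_lift R ?P (\<lambda>a b\<^sub>1. tensor_lift R ?P (\<lambda>q\<^sub>0 q\<^sub>1. ?g p q\<^sub>0 (?m (?m r q\<^sub>1) a))
            (\<delta>\<^sub>2 (?r2 b\<^sub>1 y))) (\<Delta> c)
          = tensor_lift R ?P (\<lambda>a b\<^sub>1. tensor_lift R ?P (\<lambda>q\<^sub>0 q\<^sub>1. ?g p q\<^sub>0 (?m r (?m q\<^sub>1 a)))
            (\<delta>\<^sub>2 (?r2 b\<^sub>1 y))) (\<Delta> c)"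
        by (rule tensor_lift_cong[OF H H \<Delta>c], rule tensor_lift_cong[OF N H])
           ((assumption | rule modules y)+, simp only: mult_assoc_pure r)
      \<comment> \<open>The condition on \<open>N\<close>, with \<open>q\<^sub>0 \<otimes> q\<^sub>1\<close> inserted into the bilinear term \<open>(p \<otimes> q\<^sub>0) \<otimes> r q\<^sub>1\<close>.\<close>
      also have "\<dots> = tensor_lift R ?P (\<lambda>a b\<^sub>1. tensor_lift R ?P (\<lambda>q\<^sub>0 q\<^sub>1. ?g p (?r2 a q\<^sub>0) (?m r (?m b\<^sub>1 q\<^sub>1)))
            (\<delta>\<^sub>2 y)) (\<Delta> c)"
        by (rule yetter_drinfeld_module.yetter_drinfeld_lift[OF Y2 P c y])
           (assumption | rule modules p r)+
      also have "\<dots> = tensor_lift R ?P (\<lambda>a b\<^sub>1. tensor_lift R ?P (\<lambda>q\<^sub>0 q\<^sub>1. ?g p (?r2 a q\<^sub>0) (?m (?m r b\<^sub>1) q\<^sub>1))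
            (\<delta>\<^sub>2 y)) (\<Delta> c)"
        by (rule tensor_lift_cong[OF H H \<Delta>c], rule tensor_lift_cong[OF N H \<delta>y])
           (simp only: mult_assoc_pure r)
      finally show "tensor_lift R ?P (\<lambda>a b\<^sub>1. tensor_lift R ?P (\<lambda>q\<^sub>0 q\<^sub>1. ?g p q\<^sub>0 (?m (?m r q\<^sub>1) a))
            (\<delta>\<^sub>2 (?r2 b\<^sub>1 y))) (\<Delta> c)
          = tensor_lift R ?P (\<lambda>a b\<^sub>1. tensor_lift R ?P (\<lambda>q\<^sub>0 q\<^sub>1. ?g p (?r2 a q\<^sub>0) (?m (?m r b\<^sub>1) q\<^sub>1))
            (\<delta>\<^sub>2 y)) (\<Delta> c)" .
    qed
    also have "\<dots> = tensor_lift R ?P (\<lambda>c b\<^sub>2. tensor_lift R ?P (\<lambda>a b\<^sub>1.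
          tensor_lift R ?P (\<lambda>p\<^sub>0 p\<^sub>1. tensor_lift R ?P (\<lambda>q\<^sub>0 q\<^sub>1. ?g p\<^sub>0 (?r2 a q\<^sub>0) (?m (?m p\<^sub>1 b\<^sub>1) q\<^sub>1))
            (\<delta>\<^sub>2 y)) (\<delta>\<^sub>1 (?r1 b\<^sub>2 x))) (\<Delta> c)) (\<Delta> h)"
      by (rule tensor_lift_cong[OF H H \<Delta>h], rule tensor_lift_swap) (assumption | rule modules x \<delta>y)+
    \<comment> \<open>Bracketing \<open>h\<^sub>2\<close> with \<open>h\<^sub>3\<close> prepares for the condition on \<open>M\<close>.\<close>
    also have "\<dots> = tensor_lift R ?P (\<lambda>a b. tensor_lift R ?P (\<lambda>b\<^sub>1 b\<^sub>2.
          tensor_lift R ?P (\<lambda>p\<^sub>0 p\<^sub>1. tensor_lift R ?P (\<lambda>q\<^sub>0 q\<^sub>1. ?g p\<^sub>0 (?r2 a q\<^sub>0) (?m (?m p\<^sub>1 b\<^sub>1) q\<^sub>1))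
            (\<delta>\<^sub>2 y)) (\<delta>\<^sub>1 (?r1 b\<^sub>2 x))) (\<Delta> b)) (\<Delta> h)"
      by (rule coassoc[OF P h]) (assumption | rule modules x \<delta>y)+
    \<comment> \<open>The inner sum over the components of \<open>\<delta>\<^sub>2 y\<close> is the bilinear term into which \<open>p\<^sub>0 \<otimes> p\<^sub>1\<close> is inserted.\<close>
    also have "\<dots> = tensor_lift R ?P (\<lambda>a b. tensor_lift R ?P (\<lambda>b\<^sub>1 b\<^sub>2.
          tensor_lift R ?P (\<lambda>p\<^sub>0 p\<^sub>1. tensor_lift R ?P (\<lambda>q\<^sub>0 q\<^sub>1. ?g (?r1 b\<^sub>1 p\<^sub>0) (?r2 a q\<^sub>0) (?m (?m b\<^sub>2 p\<^sub>1) q\<^sub>1))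
            (\<delta>\<^sub>2 y)) (\<delta>\<^sub>1 x)) (\<Delta> b)) (\<Delta> h)"
      by (rule tensor_lift_cong[OF H H \<Delta>h],
          rule yetter_drinfeld_module.yetter_drinfeld_lift[OF Y1 P _ x]) (assumption | rule modules \<delta>y)+
    also have "\<dots> = tensor_lift R ?P (\<lambda>a b. tensor_lift R ?P (\<lambda>b\<^sub>1 b\<^sub>2.
          tensor_lift R ?P (\<lambda>p\<^sub>0 p\<^sub>1. tensor_lift R ?P (\<lambda>q\<^sub>0 q\<^sub>1. ?g (?r1 b\<^sub>1 p\<^sub>0) (?r2 a q\<^sub>0) (?m b\<^sub>2 (?m p\<^sub>1 q\<^sub>1)))
            (\<delta>\<^sub>2 y)) (\<delta>\<^sub>1 x)) (\<Delta> b)) (\<Delta> h)"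
      by (rule tensor_lift_cong[OF H H \<Delta>h], rule tensor_lift_cong[OF H H],
          erule linear_closed[OF comult_linear], rule tensor_lift_cong[OF M H \<delta>x],
          rule tensor_lift_cong[OF N H \<delta>y])
         (simp only: mult_assoc_pure)
    \<comment> \<open>Brackets \<open>h\<^sub>1\<close> with \<open>h\<^sub>2\<close> once more: together they are one element acting on \<open>p\<^sub>0 \<otimes> q\<^sub>0\<close>.\<close>
    also have "\<dots> = tensor_lift R ?P (\<lambda>c b. tensor_lift R ?P (\<lambda>a\<^sub>1 a\<^sub>2.
          tensor_lift R ?P (\<lambda>p\<^sub>0 p\<^sub>1. tensor_lift R ?P (\<lambda>q\<^sub>0 q\<^sub>1. ?g (?r1 a\<^sub>2 p\<^sub>0) (?r2 a\<^sub>1 q\<^sub>0) (?m b (?m p\<^sub>1 q\<^sub>1)))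
            (\<delta>\<^sub>2 y)) (\<delta>\<^sub>1 x)) (\<Delta> c)) (\<Delta> h)"
      by (rule coassoc[OF P h, symmetric]) (assumption | rule modules \<delta>x \<delta>y)+
    also have "\<dots> = tensor_lift R ?P (\<lambda>c b. tensor_lift R ?P (\<lambda>p\<^sub>0 p\<^sub>1.
          tensor_lift R ?P (\<lambda>a\<^sub>1 a\<^sub>2. tensor_lift R ?P (\<lambda>q\<^sub>0 q\<^sub>1. ?g (?r1 a\<^sub>2 p\<^sub>0) (?r2 a\<^sub>1 q\<^sub>0) (?m b (?m p\<^sub>1 q\<^sub>1)))
            (\<delta>\<^sub>2 y)) (\<Delta> c)) (\<delta>\<^sub>1 x)) (\<Delta> h)"
      by (rule tensor_lift_cong[OF H H \<Delta>h], rule tensor_lift_swap[OF _ \<delta>x])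
         (assumption | rule modules \<delta>y)+
    also have "\<dots> = tensor_lift R ?P (\<lambda>c b. tensor_lift R ?P (\<lambda>p\<^sub>0 p\<^sub>1.
          tensor_lift R ?P (\<lambda>q\<^sub>0 q\<^sub>1. tensor_lift R ?P (\<lambda>a\<^sub>1 a\<^sub>2. ?g (?r1 a\<^sub>2 p\<^sub>0) (?r2 a\<^sub>1 q\<^sub>0) (?m b (?m p\<^sub>1 q\<^sub>1)))
            (\<Delta> c)) (\<delta>\<^sub>2 y)) (\<delta>\<^sub>1 x)) (\<Delta> h)"
      by (rule tensor_lift_cong[OF H H \<Delta>h], rule tensor_lift_cong[OF M H \<delta>x],
          rule tensor_lift_swap[OF _ \<delta>y]) (assumption | rule modules)+
    also have "\<dots> = tensor_lift R ?P (\<lambda>c b. tensor_lift R ?P (\<lambda>p\<^sub>0 p\<^sub>1.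
          tensor_lift R ?P (\<lambda>q\<^sub>0 q\<^sub>1. pure_tensor R ?M H
            (?\<rho> (pure_tensor R H ?M c (pure_tensor R M N p\<^sub>0 q\<^sub>0))) (?m b (?m p\<^sub>1 q\<^sub>1)))
            (\<delta>\<^sub>2 y)) (\<delta>\<^sub>1 x)) (\<Delta> h)"
    proof (rule tensor_lift_cong[OF H H \<Delta>h], rule tensor_lift_cong[OF M H \<delta>x],
        rule tensor_lift_cong[OF N H \<delta>y])
      fix c b p r q s
      assume c: "c \<in> carrier H" and b: "b \<in> carrier H" and p: "p \<in> carrier M" and r: "r \<in> carrier H"
        and q: "q \<in> carrier N" and s: "s \<in> carrier H"
      have lin: "(\<lambda>t. pure_tensor R ?M H t (?m b (?m r s))) \<in> linear_maps R ?M ?P"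
        by (assumption | rule modules b r s)+
      show "tensor_lift R ?P (\<lambda>a\<^sub>1 a\<^sub>2. ?g (?r1 a\<^sub>2 p) (?r2 a\<^sub>1 q) (?m b (?m r s))) (\<Delta> c)
          = pure_tensor R ?M H (?\<rho> (pure_tensor R H ?M c (pure_tensor R M N p q))) (?m b (?m r s))"
        by (rule \<rho>_hom[OF P lin c p q, symmetric])
    qed
    also have "\<dots> = ?r h (pure_tensor R M N x y)"
      by (rule tensor_lift_cong[OF H H \<Delta>h], rule \<delta>_lift[OF P _ x y, symmetric])
         (assumption | rule modules)+
    finally show ?thesis .
  qed
  show ?thesis
  proof (intro yetter_drinfeld_module.intro yetter_drinfeld_module_axioms.intro
      bialgebra_axioms A C ballI)
    fix t assume t: "t \<in> carrier (H \<boxtimes>[R] ?M)"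
    let ?left = "tensor_map R ?M H id \<mu> \<circ> tensor_assoc R ?M H H \<circ> tensor_map R ?P H ?\<delta> id
        \<circ> tensor_flip R H ?M \<circ> tensor_map R H ?M id ?\<rho> \<circ> tensor_assoc R H H ?M
        \<circ> tensor_map R (H \<boxtimes>[R] H) ?M \<Delta> id"
    let ?right = "tensor_map R ?M H ?\<rho> \<mu> \<circ> middle_flip R H H ?M H
        \<circ> tensor_map R (H \<boxtimes>[R] H) ?P \<Delta> ?\<delta>"
    note composites = linear_o linear_tensor_assoc linear_tensor_map linear_tensor_flip
      linear_middle_flip linear_id tensor_is_module ops H M N
    show "?left t = ?right t"
    proof (rule tensor_ext[OF H MN P _ _ _ t])
      show "?left \<in> linear_maps R (H \<boxtimes>[R] ?M) ?P" by (rule composites)+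
      show "?right \<in> linear_maps R (H \<boxtimes>[R] ?M) ?P" by (rule composites)+
      fix h s assume h: "h \<in> carrier H" and s: "s \<in> carrier ?M"
      have "?l h s = ?r h s"
        by (rule tensor_ext[OF M N P _ _ _ s])
           (assumption | rule main[OF h] modules linear_closed[OF comult_linear h])+
      then show "?left (pure_tensor R H ?M h s) = ?right (pure_tensor R H ?M h s)"
        by (simp only: yetter_drinfeld_left_side[OF H MN ops h s]
            yetter_drinfeld_right_side[OF H MN ops h s])
    qed
  qed
qed

end

theorem corollary3p20:
  fixes R :: "('a, 'r) ring_scheme"
    and H :: "('a, 'h, 'x) module_scheme"
    and M\<^sub>1 :: "('a, 'm, 'y) module_scheme"
    and M\<^sub>2 :: "('a, 'n, 'z) module_scheme"
  assumes "field R"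
    and "bialgebra R H \<mu> \<eta> \<Delta> \<epsilon>"
    and "finite_dimensional R H"
    and "yetter_drinfeld_module R H \<mu> \<eta> \<Delta> \<epsilon> M\<^sub>1 \<rho>\<^sub>1 \<delta>\<^sub>1"
    and "yetter_drinfeld_module R H \<mu> \<eta> \<Delta> \<epsilon> M\<^sub>2 \<rho>\<^sub>2 \<delta>\<^sub>2"
  shows "yetter_drinfeld_module R H \<mu> \<eta> \<Delta> \<epsilon> (M\<^sub>1 \<boxtimes>[R] M\<^sub>2)
    (tensor_map R M\<^sub>1 M\<^sub>2 \<rho>\<^sub>1 \<rho>\<^sub>2
      \<circ> middle_flip R H H M\<^sub>1 M\<^sub>2
      \<circ> tensor_map R (H \<boxtimes>[R] H) (M\<^sub>1 \<boxtimes>[R] M\<^sub>2) (tensor_flip R H H \<circ> \<Delta>) id)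
    (tensor_map R (M\<^sub>1 \<boxtimes>[R] M\<^sub>2) H id \<mu>
      \<circ> middle_flip R M\<^sub>1 H M\<^sub>2 H
      \<circ> tensor_map R (M\<^sub>1 \<boxtimes>[R] H) (M\<^sub>2 \<boxtimes>[R] H) \<delta>\<^sub>1 \<delta>\<^sub>2)"
  using bialgebra.yetter_drinfeld_tensor[OF assms(2,4,5)]
  unfolding tensor_action_def tensor_coaction_def .

end
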